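(* Fix an integer $M\ge1$ and let $C_n$ and $S_n$ be the number of key comparisons and of swaps (as defined in the context) used by Yaroslavskiy's dual-pivot Quicksort with Insertionsort threshold $M$ on a uniformly random permutation of $\{1,\dots,n\}$. Then, as $n\to\infty$, \[ \mathrm{Cov}(C_n,S_n)\sim\sigma_{C,S}\,n^2,\qquad \sigma_{C,S}=\tfrac{28}{15}-\tfrac{19}{100}\pi^2=-0.00855817\ldots, \] and consequently the correlation coefficient satisfies \[ \frac{\mathrm{Cov}(C_n,S_n)}{\sqrt{\mathrm{Var}(C_n)}\sqrt{\mathrm{Var}(S_n)}}\sim\rho\approx-0.0512112. \]
   Context: Yaroslavskiy's dual-pivot Quicksort with threshold $M$: procedure $\mathrm{QS}(A,\mathit{left},\mathit{right})$, initial call $\mathrm{QS}(A,1,n)$: (1) if $\mathit{right}-\mathit{left}<M$, run InsertionSort$(A,\mathit{left},\mathit{right})$ and return; (2) else (partitioning step) if $A[\mathit{left}]>A[\mathit{right}]$ set $p\gets A[\mathit{right}],q\gets A[\mathit{left}]$, else $p\gets A[\mathit{left}],q\gets A[\mathit{right}]$; set $\ell\gets\mathit{left}+1$, $g\gets\mathit{right}-1$, $k\gets\ell$; (3) while $k\le g$: if $A[k]<p$ then swap $A[k],A[\ell]$, $\ell\gets\ell+1$; else if $A[k]\ge q$ then {while ($A[g]>q$ and $k<g$) do $g\gets g-1$; if $A[g]\ge p$ swap $A[k],A[g]$, else swap $A[k],A[g]$, swap $A[k],A[\ell]$, $\ell\gets\ell+1$; $g\gets g-1$}; $k\gets k+1$;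 (4) $\ell\gets\ell-1$, $g\gets g+1$, $A[\mathit{left}]\gets A[\ell]$, $A[\ell]\gets p$, $A[\mathit{right}]\gets A[g]$, $A[g]\gets q$; (5) recursively call QS on $(\mathit{left},\ell-1)$, $(\ell+1,g-1)$, $(g+1,\mathit{right})$. InsertionSort$(A,\mathit{left},\mathit{right})$: for $i=\mathit{left}+1..\mathit{right}$: $j\gets i-1$, $v\gets A[i]$; while $j\ge\mathit{left}$ and $v<A[j]$: $A[j+1]\gets A[j]$, $j\gets j-1$; $A[j+1]\gets v$. Key comparisons $C_n$: $A[\mathit{left}]>A[\mathit{right}]$ once per partitioning step, plus every evaluation of $A[k]<p$, $A[k]\ge q$, $A[g]>q$, $A[g]\ge p$, and $v<A[j]$ (evaluated only when $j\ge\mathit{left}$). Swaps $S_n$: each swap executed in step (3) counts one, plus two per partitioning step for step (4). *)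

theory Defs
  imports "HOL-Probability.Probability"
begin

text \<open>
  Arrays are functions on \<^typ>\<open>int\<close>; integer indices avoid truncated subtraction in expressions such
  as \<open>right - left\<close> and \<open>left - 1\<close>, which can leave the index range. The counters are threaded
  through the program: \<open>c\<close> counts key comparisons and \<open>s\<close> counts swaps.
\<close>

definition swap :: "(int \<Rightarrow> 'a) \<Rightarrow> int \<Rightarrow> int \<Rightarrow> (int \<Rightarrow> 'a)" where
  "swap A i j = A(i := A j, j := A i)"

text \<open>Insertionsort: the comparison \<open>v < A j\<close> is evaluated only when \<open>left \<le> j\<close>.\<close>

function insert_key ::
  "(int \<Rightarrow> 'a::linorder) \<Rightarrow> int \<Rightarrow> 'a \<Rightarrow> int \<Rightarrow> nat \<Rightarrow> (int \<Rightarrow> 'a) \<times> nat" where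
  "insert_key A left v j c =
     (if j \<ge> left then
        (if v < A j then insert_key (A(j + 1 := A j)) left v (j - 1) (c + 1)
         else (A(j + 1 := v), c + 1))
      else (A(j + 1 := v), c))"
  by pat_completeness auto
termination
  by (relation "Wellfounded.measure (\<lambda>(A, left, v, j, c). nat (j - left + 1))") auto

definition insertion_sort ::
  "(int \<Rightarrow> 'a::linorder) \<Rightarrow> int \<Rightarrow> int \<Rightarrow> (int \<Rightarrow> 'a) \<times> nat" where
  "insertion_sort A left right =
     fold (\<lambda>i (A, c). insert_key A left (A i) (i - 1) c) [left + 1..right] (A, 0)"

text \<open>
  The inner loop of a partitioning step, returning the new \<open>g\<close>. The conjuncts of its guard
  \<open>A g > q \<and> k < g\<close> are evaluated from left to right, so that each evaluation of the guard,
  including the last one, costs a key comparison.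
\<close>

function scan_left ::
  "(int \<Rightarrow> 'a::linorder) \<Rightarrow> 'a \<Rightarrow> int \<Rightarrow> int \<Rightarrow> nat \<Rightarrow> int \<times> nat" where
  "scan_left A q k g c =
     (if A g > q \<and> k < g then scan_left A q k (g - 1) (c + 1) else (g, c + 1))"
  by pat_completeness auto
termination
  by (relation "Wellfounded.measure (\<lambda>(A, q, k, g, c). nat (g - k))") auto

declare insert_key.simps [simp del] scan_left.simps [simp del]

lemma scan_left_le: "scan_left A q k g c = (g', c') \<Longrightarrow> g' \<le> g"
proof (induction A q k g c rule: scan_left.induct)
  case (1 A q k g c)
  then show ?case
    by (subst (asm) (2) scan_left.simps) (auto split: if_splits)
qed

lemma scan_left_ge: "scan_left A q k g c = (g', c') \<Longrightarrow> k \<le> g \<Longrightarrow> k \<le> g'"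
proof (induction A q k g c rule: scan_left.induct)
  case (1 A q k g c)
  then show ?case
    by (subst (asm) (2) scan_left.simps) (auto split: if_splits)
qed

function partition_loop ::
  "(int \<Rightarrow> 'a::linorder) \<Rightarrow> 'a \<Rightarrow> 'a \<Rightarrow> int \<Rightarrow> int \<Rightarrow> int \<Rightarrow> nat \<Rightarrow> nat \<Rightarrow>
    (int \<Rightarrow> 'a) \<times> int \<times> int \<times> nat \<times> nat" where
  "partition_loop A p q l g k c s =
     (if k \<le> g then
        (if A k < p then
           partition_loop (swap A k l) p q (l + 1) g (k + 1) (c + 1) (s + 1)
         else if A k \<ge> q then
           (case scan_left A q k g (c + 2) of (g', c') \<Rightarrow>
              if A g' \<ge> p then
                partition_loop (swap A k g') p q l (g' - 1) (k + 1) (c' + 1) (s + 1)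
              else
                partition_loop (swap (swap A k g') k l) p q (l + 1) (g' - 1) (k + 1)
                  (c' + 1) (s + 2))
         else partition_loop A p q l g (k + 1) (c + 2) s)
      else (A, l, g, c, s))"
  by pat_completeness auto
termination
  by (relation "Wellfounded.measure (\<lambda>(A, p, q, l, g, k, c, s). nat (g - k + 1))")
     (auto dest!: sym[of "(_, _)" "scan_left _ _ _ _ _"] scan_left_le)

declare partition_loop.simps [simp del]

definition partition_step ::
  "(int \<Rightarrow> 'a::linorder) \<Rightarrow> int \<Rightarrow> int \<Rightarrow> (int \<Rightarrow> 'a) \<times> int \<times> int \<times> nat \<times> nat" where
  "partition_step A left right =
     (let (p, q) = (if A left > A right then (A right, A left) else (A left, A right));
          (A, l, g, c, s) = partition_loop A p q (left + 1) (right - 1) (left + 1) 1 0;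
          l = l - 1;
          g = g + 1;
          A = A(left := A l);
          A = A(l := p);
          A = A(right := A g);
          A = A(g := q)
      in (A, l, g, c, s + 2))"

lemma partition_loop_bounds:
  assumes "partition_loop A p q l g k c s = (A', l', g', c', s')" "l \<le> k" "k \<le> g + 2"
  shows "l \<le> l' \<and> l' \<le> g' + 2 \<and> k \<le> g' + 2 \<and> g' \<le> g"
  using assms
proof (induction A p q l g k c s rule: partition_loop.induct)
  case (1 A p q l g k c s)
  show ?case
  proof (cases "k \<le> g")
    case False
    then show ?thesis
      using "1.prems" by (subst (asm) partition_loop.simps) auto
  next
    case kg: True
    show ?thesis
    proof (cases "A k < p")
      case True
      then show ?thesis
        using "1.prems" "1.IH"(1) kg by (subst (asm) partition_loop.simps) auto
    next
      case kp: False
      show ?thesis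
      proof (cases "A k \<ge> q")
        case False
        then show ?thesis
          using "1.prems" "1.IH"(4) kg kp by (subst (asm) partition_loop.simps) auto
      next
        case kq: True
        obtain g1 c1 where sc: "scan_left A q k g (c + 2) = (g1, c1)" by fastforce
        have le: "g1 \<le> g" "k \<le> g1"
          using scan_left_le[OF sc] scan_left_ge[OF sc] kg by auto
        show ?thesis
          using "1.prems" "1.IH"(2)[OF kg kp kq sc[symmetric]]
            "1.IH"(3)[OF kg kp kq sc[symmetric]] kg kp kq sc le
          by (subst (asm) partition_loop.simps) (auto split: if_splits)
      qed
    qed
  qed
qed

lemma partition_step_bounds:
  assumes "partition_step A left right = (A', l, g, c, s)" "left \<le> right"
  shows "left \<le> l \<and> l \<le> right \<and> left \<le> g \<and> g \<le> right"
  using assms partition_loop_bounds[of A _ _ "left + 1" "right - 1" "left + 1" 1 0]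
  by (fastforce simp: partition_step_def Let_def split: prod.splits if_splits)

text \<open>
  \<open>quicksort M A left right\<close> returns the resulting array, the number of key comparisons and the
  number of swaps; Insertionsort contributes no swaps.
\<close>

function quicksort ::
  "nat \<Rightarrow> (int \<Rightarrow> 'a::linorder) \<Rightarrow> int \<Rightarrow> int \<Rightarrow> (int \<Rightarrow> 'a) \<times> nat \<times> nat" where
  "quicksort M A left right =
     (if right - left < int M then
        (case insertion_sort A left right of (A, c) \<Rightarrow> (A, c, 0))
      else
        (case partition_step A left right of (A, l, g, c, s) \<Rightarrow>
         case quicksort M A left (l - 1) of (A, c1, s1) \<Rightarrow>
         case quicksort M A (l + 1) (g - 1) of (A, c2, s2) \<Rightarrow>
         case quicksort M A (g + 1) right of (A, c3, s3) \<Rightarrow>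
           (A, c + c1 + c2 + c3, s + s1 + s2 + s3)))"
  by pat_completeness auto
termination
proof (relation "Wellfounded.measure (\<lambda>(M, A, left, right). nat (right - left + 1))", goal_cases)
qed (auto dest!: partition_step_bounds[OF sym])

declare quicksort.simps [simp del]

definition key_comparisons :: "nat \<Rightarrow> nat \<Rightarrow> (int \<Rightarrow> int) \<Rightarrow> real" where
  "key_comparisons M n A = real (fst (snd (quicksort M A 1 (int n))))"

definition swaps :: "nat \<Rightarrow> nat \<Rightarrow> (int \<Rightarrow> int) \<Rightarrow> real" where
  "swaps M n A = real (snd (snd (quicksort M A 1 (int n))))"

definition random_permutation :: "nat \<Rightarrow> (int \<Rightarrow> int) pmf" where
  "random_permutation n = pmf_of_set {\<pi>. \<pi> permutes {1..int n}}"

definition covariance :: "'a pmf \<Rightarrow> ('a \<Rightarrow> real) \<Rightarrow> ('a \<Rightarrow> real) \<Rightarrow> real" where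
  "covariance P X Y =
     measure_pmf.expectation P
       (\<lambda>x. (X x - measure_pmf.expectation P X) * (Y x - measure_pmf.expectation P Y))"

definition correlation :: "'a pmf \<Rightarrow> ('a \<Rightarrow> real) \<Rightarrow> ('a \<Rightarrow> real) \<Rightarrow> real" where
  "correlation P X Y =
     covariance P X Y / (sqrt (measure_pmf.variance P X) * sqrt (measure_pmf.variance P Y))"

definition sigma_CS :: real  ("\<sigma>\<^sub>C\<^sub>S") where
  "\<sigma>\<^sub>C\<^sub>S = 28 / 15 - 19 / 100 * pi\<^sup>2"

end

theory Submission
  imports Defs "HOL-Real_Asymp.Real_Asymp"
begin

text \<open>
  By polarization it suffices to find the variance of every combination \<open>\<alpha> C + \<beta> S\<close>.
  A partitioning step only compares keys with the two pivots, so permuting the values within the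
  small, the medium and the large keys does not change its course. Averaging over these permutations
  shows that, given the step, the costs of the three recursive calls are independent and distributed
  like the costs of random permutations. This gives recurrences for the mean and the variance of the
  form \<open>r n = 6 / (n (n - 1)) (\<Sum>i<n. (n - 1 - i) r i) + \<epsilon> n\<close>, which reduce
  to two first-order recurrences. The means are \<open>\<kappa> n ln n + l n + o(n)\<close>, and the
  variance is asymptotic to \<open>2 E n\<^sup>2\<close> where \<open>E\<close> is the second moment of the
  limit of the centred toll, a function of the relative subproblem sizes, which are asymptotically
  uniform on the simplex. The integral defining \<open>E\<close> contains
  \<open>x (1 - x)\<^sup>2 ln x ln (1 - x)\<close>, the source of \<open>\<pi>\<^sup>2\<close>.
\<close>

text \<open>The means enter the variance recurrence inside a square of order \<open>n^2\<close>, so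
  they must be known up to \<open>o(n)\<close>. Their linear coefficient depends on \<open>M\<close>
  and is never computed: the centred toll is the toll plus the means at the three sizes minus the
  mean at \<open>n\<close>, and as the sizes add up to \<open>n - 2\<close>, the linear terms cancel
  up to a constant. The terms \<open>n ln n\<close> cancel up to \<open>n\<close> times the negative
  entropy of the relative sizes. Hence the limit is the same for every \<open>M\<close>. The toll is
  not a function of the sizes alone: it also depends on how many small and large keys lie in the
  positions visited by \<open>k\<close>. Given the pivots, these counts are hypergeometric with
  fluctuations of order \<open>sqrt n\<close>, which vanish on the scale \<open>n\<close>; only
  their means survive. The constants of the recurrence come from the uniform law on the simplex. The
  squares of the three coordinates have total mean \<open>1 / 2\<close>, so a toll
  \<open>E n^2\<close> yields \<open>E n^2 / (1 - 1 / 2)\<close>; the entropy has mean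
  \<open>5 / 6\<close>, so a toll \<open>\<tau> n\<close> yields
  \<open>(6 / 5) \<tau> n ln n\<close>.\<close>

section \<open>Partitioning and relabelling of values\<close>

text \<open>The set \<open>V\<close> confines the keys that occur, so that order conditions on
  \<open>f\<close> are imposed only there. The shift \<open>d\<close> lets a subarray be moved to
  start at position 1; \<open>f\<close> covers both translations of values and permutations inside
  the blocks of small, medium and large keys.\<close>

definition array_image ::
  "('a \<Rightarrow> 'b) \<Rightarrow> 'a set \<Rightarrow> int \<Rightarrow> int \<Rightarrow> int \<Rightarrow> (int \<Rightarrow> 'a) \<Rightarrow> (int \<Rightarrow> 'b) \<Rightarrow> bool" where
  "array_image f V d l r A B \<longleftrightarrow> (\<forall>i\<in>{l..r}. A i \<in> V \<and> B (i + d) = f (A i))"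

lemma array_imageD:
  "array_image f V d l r A B \<Longrightarrow> l \<le> i \<Longrightarrow> i \<le> r \<Longrightarrow> A i \<in> V"
  "array_image f V d l r A B \<Longrightarrow> l \<le> i \<Longrightarrow> i \<le> r \<Longrightarrow> B (i + d) = f (A i)"
  by (auto simp: array_image_def)

lemma array_image_upd:
  "array_image f V d l r A B \<Longrightarrow> v \<in> V \<Longrightarrow> array_image f V d l r (A(i := v)) (B(i + d := f v))"
  by (auto simp: array_image_def)

lemma array_image_swap:
  "array_image f V d l r A B \<Longrightarrow> i \<in> {l..r} \<Longrightarrow> j \<in> {l..r} \<Longrightarrow>
    array_image f V d l r (swap A i j) (swap B (i + d) (j + d))"
  by (auto simp: array_image_def swap_def)

lemma insert_key_image:
  assumes "array_image f V d l r A B" "strict_mono_on V f" "v \<in> V" "j < r" "l \<le> j + 1"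
    "insert_key A l v j c = (A', c1)" "insert_key B (l + d) (f v) (j + d) c = (B', c2)"
  shows "array_image f V d l r A' B' \<and> c1 = c2"
  using assms
proof (induction A l v j c arbitrary: B rule: insert_key.induct)
  case (1 A l v j c)
  show ?case
  proof (cases "j \<ge> l")
    case False
    then show ?thesis
      using 1(2-) array_image_upd[OF "1.prems"(1,3), of "j + 1"]
      by (simp add: insert_key.simps[of A] insert_key.simps[of B] algebra_simps)
  next
    case True
    have Aj: "A j \<in> V" "B (j + d) = f (A j)"
      using array_imageD[OF "1.prems"(1), of j] True "1.prems"(4) by auto
    have cmp: "f v < f (A j) \<longleftrightarrow> v < A j"
      using "1.prems"(2,3) Aj by (auto simp: strict_mono_on_less)
    have eq: "j + d + 1 = j + 1 + d" "j + d - 1 = j - 1 + d" by auto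
    show ?thesis
    proof (cases "v < A j")
      case True2: True
      have e: "insert_key A l v j c = insert_key (A(j + 1 := A j)) l v (j - 1) (c + 1)"
        using True True2 by (subst insert_key.simps) simp
      have e': "insert_key B (l + d) (f v) (j + d) c =
        insert_key (B(j + 1 + d := f (A j))) (l + d) (f v) (j - 1 + d) (c + 1)"
        using True True2 cmp Aj by (subst insert_key.simps) (simp add: algebra_simps)
      show ?thesis
        by (rule "1.IH"[OF True True2 array_image_upd[OF "1.prems"(1) Aj(1)] "1.prems"(2,3)])
           (use True "1.prems" e e' in \<open>auto simp: fun_upd_def\<close>)
    next
      case False
      then show ?thesis
        using 1(2-) array_image_upd[OF "1.prems"(1,3), of "j + 1"] True Aj cmp
        unfolding insert_key.simps[of A] insert_key.simps[of B] eq
        by simp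
    qed
  qed
qed

lemma insert_key_outside:
  assumes "insert_key A l v j c = (A', c')" "l \<le> j + 1" "i < l \<or> i > j + 1"
  shows "A' i = A i"
  using assms
proof (induction A l v j c rule: insert_key.induct)
  case (1 A l v j c)
  show ?case
  proof (cases "l \<le> j \<and> v < A j")
    case True
    then have "insert_key (A(j + 1 := A j)) l v (j - 1) (c + 1) = (A', c')"
      using "1.prems" by (subst (asm) insert_key.simps) simp
    then have "A' i = (A(j + 1 := A j)) i"
      using True "1.prems"(3) by (intro "1.IH") (auto simp: fun_upd_def)
    then show ?thesis using "1.prems" by auto
  next
    case False
    then show ?thesis
      using "1.prems" by (subst (asm) insert_key.simps) (auto split: if_splits)
  qed
qed

lemma insertion_sort_image:
  fixes A :: "int \<Rightarrow> 'a::linorder" and B :: "int \<Rightarrow> 'b::linorder"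
  assumes "array_image f V d l r A B" "strict_mono_on V f"
    "insertion_sort A l r = (A', c1)" "insertion_sort B (l + d) (r + d) = (B', c2)"
  shows "array_image f V d l r A' B' \<and> c1 = c2"
proof -
  let ?F = "\<lambda>(A::int \<Rightarrow> 'a) i (A, c). insert_key A l (A i) (i - 1) c"
  have shift: "[l + d + 1..r + d] = map (\<lambda>i. i + d) [l + 1..r]"
    by (rule nth_equalityI) auto
  have gen: "array_image f V d l r A' B' \<and> c1 = c2"
    if "array_image f V d l r A B" "set xs \<subseteq> {l + 1..r}"
      "fold (\<lambda>i (A, c). insert_key A l (A i) (i - 1) c) xs (A, c) = (A', c1)"
      "fold (\<lambda>i (A, c). insert_key A (l + d) (A i) (i - 1) c) (map (\<lambda>i. i + d) xs) (B, c) = (B', c2)"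
    for xs c and A :: "int \<Rightarrow> 'a" and B :: "int \<Rightarrow> 'b"
    using that
  proof (induction xs arbitrary: A B c)
    case Nil
    then show ?case by auto
  next
    case (Cons i xs)
    obtain A1 e1 where a: "insert_key A l (A i) (i - 1) c = (A1, e1)" by fastforce
    obtain B1 e2 where b: "insert_key B (l + d) (B (i + d)) (i - 1 + d) c = (B1, e2)" by fastforce
    have i: "l < i" "i \<le> r" using Cons.prems by auto
    have "array_image f V d l r A1 B1 \<and> e1 = e2"
      using insert_key_image[OF Cons.prems(1) assms(2) _ _ _ a] b i
        array_imageD[OF Cons.prems(1), of i] by auto
    moreover have "fold (\<lambda>i (A, c). insert_key A l (A i) (i - 1) c) xs (A1, e1) = (A', c1)"
      using Cons.prems(3) a by simp
    moreover have "i + d - 1 = i - 1 + d" by simp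
    note b = b[folded this]
    have "fold (\<lambda>i (A, c). insert_key A (l + d) (A i) (i - 1) c) (map (\<lambda>i. i + d) xs) (B1, e2) = (B', c2)"
      using Cons.prems(4) b by simp
    ultimately show ?case
      using Cons.IH[of A1 B1 e1] Cons.prems(2) by auto
  qed
  show ?thesis
    using gen[OF assms(1), of "[l + 1..r]" 0] assms(3,4)
    by (simp add: insertion_sort_def shift)
qed

lemma insertion_sort_outside:
  assumes "insertion_sort A l r = (A', c')" "i < l \<or> i > r"
  shows "A' i = A i"
proof -
  have "A' i = A i"
    if "set xs \<subseteq> {l + 1..r}"
      "fold (\<lambda>i (A, c). insert_key A l (A i) (i - 1) c) xs (A, c) = (A', c')" for xs A c
    using that
  proof (induction xs arbitrary: A c)
    case Nil
    then show ?case by auto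
  next
    case (Cons k xs)
    obtain A1 e1 where a: "insert_key A l (A k) (k - 1) c = (A1, e1)" by fastforce
    have "A1 i = A i"
      using insert_key_outside[OF a] Cons.prems(1) assms(2) by auto
    then show ?case using Cons a by auto
  qed
  from this[of "[l + 1..r]" A 0] show ?thesis using assms by (simp add: insertion_sort_def)
qed

text \<open>Unlike Insertionsort, this loop compares keys with \<open>q\<close> only. Accordingly
  the condition on \<open>f\<close> concerns just that comparison; the case of interest later is an
  \<open>f\<close> that is not monotone.\<close>

lemma scan_left_image:
  assumes "array_image f V d l r A B" "l \<le> k" "k \<le> g" "g \<le> r"
    "\<And>v. v \<in> V \<Longrightarrow> q' < f v \<longleftrightarrow> q < v"
    "scan_left A q k g c = (g1, c1)"
  shows "scan_left B q' (k + d) (g + d) c = (g1 + d, c1)"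
  using assms
proof (induction A q k g c rule: scan_left.induct)
  case (1 A q k g c)
  have g: "B (g + d) = f (A g)" "A g \<in> V" using array_imageD[OF "1.prems"(1), of g] "1.prems" by auto
  have eq: "g + d - 1 = g - 1 + d" by simp
  show ?case
  proof (cases "A g > q \<and> k < g")
    case True
    have "scan_left A q k (g - 1) (c + 1) = (g1, c1)"
      using "1.prems"(6) True by (subst (asm) scan_left.simps) simp
    then have "scan_left B q' (k + d) (g - 1 + d) (c + 1) = (g1 + d, c1)"
      using 1 True by auto
    then show ?thesis
      using True g "1.prems"(5) by (subst scan_left.simps) (simp add: eq)
  next
    case False
    then show ?thesis
      using g 1(2-) by (subst scan_left.simps) (auto simp: scan_left.simps[of A])
  qed
qed

text \<open>The scan stops at a key that is not large or at \<open>k\<close> itself. The last,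
  failing evaluation of the guard is charged too, hence \<open>g - g1 + 1\<close> and not
  \<open>g - g1\<close>.\<close>

lemma scan_left_result:
  assumes "scan_left A q k g c = (g1, c1)" "k \<le> g"
  shows "k \<le> g1 \<and> g1 \<le> g \<and> (\<forall>i\<in>{g1<..g}. A i > q) \<and> (A g1 \<le> q \<or> g1 = k) \<and>
    c1 = c + nat (g - g1 + 1)"
  using assms
proof (induction A q k g c rule: scan_left.induct)
  case (1 A q k g c)
  show ?case
  proof (cases "A g > q \<and> k < g")
    case True
    have "scan_left A q k (g - 1) (c + 1) = (g1, c1)"
      using "1.prems"(1) True by (subst (asm) scan_left.simps) simp
    then have *: "k \<le> g1 \<and> g1 \<le> g - 1 \<and> (\<forall>i\<in>{g1<..g - 1}. A i > q) \<and> (A g1 \<le> q \<or> g1 = k) \<and>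
      c1 = c + 1 + nat (g - 1 - g1 + 1)"
      using 1 True by auto
    have "{g1<..g} = insert g {g1<..g - 1}" using * by auto
    with * True show ?thesis by auto
  next
    case False
    then show ?thesis
      using 1(2-) by (subst (asm) scan_left.simps) auto
  qed
qed

text \<open>Both runs take the same branches because each test involves \<open>p\<close> or
  \<open>q\<close>. Pointers and counters come out equal (up to the shift), which is what makes the
  toll invariant under relabellings inside the blocks.\<close>

lemma partition_loop_image:
  assumes "array_image f V d L R A B" "L \<le> l" "l \<le> k" "g \<le> R"
    "\<And>v. v \<in> V \<Longrightarrow> (f v < p' \<longleftrightarrow> v < p) \<and> (f v < q' \<longleftrightarrow> v < q) \<and> (q' < f v \<longleftrightarrow> q < v)"
    "partition_loop A p q l g k c s = (A', l1, g1, c1, s1)"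
  shows "\<exists>B'. partition_loop B p' q' (l + d) (g + d) (k + d) c s = (B', l1 + d, g1 + d, c1, s1) \<and>
    array_image f V d L R A' B'"
  using assms
proof (induction A p q l g k c s arbitrary: B rule: partition_loop.induct)
  case (1 A p q l g k c s)
  have eq: "k + d + 1 = k + 1 + d" "l + d + 1 = l + 1 + d" by auto
  show ?case
  proof (cases "k \<le> g")
    case False
    then show ?thesis
      using "1.prems" by (subst partition_loop.simps) (auto simp: partition_loop.simps[of A])
  next
    case kg: True
    have Ak: "A k \<in> V" "B (k + d) = f (A k)"
      using array_imageD[OF "1.prems"(1), of k] kg "1.prems" by auto
    have mem: "k \<in> {L..R}" "l \<in> {L..R}" using kg "1.prems"(2-4) by auto
    show ?thesis
    proof (cases "A k < p")
      case True
      have "\<exists>B'. partition_loop (swap B (k + d) (l + d)) p' q' (l + 1 + d) (g + d) (k + 1 + d) (c + 1) (s + 1)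
          = (B', l1 + d, g1 + d, c1, s1) \<and> array_image f V d L R A' B'"
        by (rule "1.IH"(1)[OF kg True array_image_swap[OF "1.prems"(1) mem] _ _ _ "1.prems"(5)])
           (use "1.prems" kg True in \<open>auto simp: partition_loop.simps[of A]\<close>)
      then show ?thesis
        using kg True Ak "1.prems"(5) by (subst partition_loop.simps) (auto simp: eq)
    next
      case kp: False
      show ?thesis
      proof (cases "A k \<ge> q")
        case False
        have "\<exists>B'. partition_loop B p' q' (l + d) (g + d) (k + 1 + d) (c + 2) s
          = (B', l1 + d, g1 + d, c1, s1) \<and> array_image f V d L R A' B'"
          by (rule "1.IH"(4)[OF kg kp False "1.prems"(1) _ _ _ "1.prems"(5)])
             (use "1.prems" kg kp False in \<open>auto simp: partition_loop.simps[of A]\<close>)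
        moreover have "\<not> f (A k) < p'" "\<not> q' \<le> f (A k)"
          using kp False Ak "1.prems"(5) by (auto simp: not_le)
        ultimately show ?thesis
          using kg Ak by (subst partition_loop.simps) (auto simp: eq)
      next
        case kq: True
        obtain h c2 where sc: "scan_left A q k g (c + 2) = (h, c2)" by fastforce
        have h: "k \<le> h" "h \<le> g" using scan_left_result[OF sc kg] by auto
        have sc': "scan_left B q' (k + d) (g + d) (c + 2) = (h + d, c2)"
          by (rule scan_left_image[OF "1.prems"(1) _ kg "1.prems"(4) _ sc]) (use "1.prems" in auto)
        have Ah: "A h \<in> V" "B (h + d) = f (A h)"
          using array_imageD[OF "1.prems"(1), of h] h "1.prems" by auto
        have ph: "p' \<le> f (A h) \<longleftrightarrow> p \<le> A h"
          using "1.prems"(5)[OF Ah(1)] by (metis not_less)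
        have memh: "h \<in> {L..R}" using h "1.prems" by auto
        have kp': "\<not> f (A k) < p'" "\<not> f (A k) < q'" using kp kq Ak "1.prems"(5) by auto
        have eqh: "h + d - 1 = h - 1 + d" by simp
        note sw = array_image_swap[OF "1.prems"(1) mem(1) memh]
        show ?thesis
        proof (cases "A h \<ge> p")
          case True
          have "\<exists>B'. partition_loop (swap B (k + d) (h + d)) p' q' (l + d) (h - 1 + d) (k + 1 + d) (c2 + 1) (s + 1)
            = (B', l1 + d, g1 + d, c1, s1) \<and> array_image f V d L R A' B'"
            by (rule "1.IH"(2)[OF kg kp kq sc[symmetric] True sw _ _ _ "1.prems"(5)])
               (use "1.prems" kg kp kq True h sc in \<open>auto simp: partition_loop.simps[of A]\<close>)
          then show ?thesis
            using kg kp' Ak Ah True ph sc'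
            by (subst partition_loop.simps) (auto simp: eq eqh not_le not_less)
        next
          case False
          have "\<exists>B'. partition_loop (swap (swap B (k + d) (h + d)) (k + d) (l + d)) p' q'
              (l + 1 + d) (h - 1 + d) (k + 1 + d) (c2 + 1) (s + 2)
            = (B', l1 + d, g1 + d, c1, s1) \<and> array_image f V d L R A' B'"
            by (rule "1.IH"(3)[OF kg kp kq sc[symmetric] False array_image_swap[OF sw mem(1,2)] _ _ _ "1.prems"(5)])
               (use "1.prems" kg kp kq False h sc in \<open>auto simp: partition_loop.simps[of A]\<close>)
          then show ?thesis
            using kg kp' Ak Ah False ph sc'
            by (subst partition_loop.simps) (auto simp: eq eqh not_le not_less)
        qed
      qed
    qed
  qed
qed


lemma swap_eq_comp: "swap A i j = A \<circ> Transposition.transpose i j"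
  by (auto simp: swap_def Transposition.transpose_def fun_eq_iff)

text \<open>Loop invariant: keys before \<open>l\<close> are small, those from \<open>l\<close> to
  \<open>k - 1\<close> medium, those after \<open>g\<close> large. The slack
  \<open>k \<le> g + 2\<close> is attained when both pointers meet in a large key: it is swapped
  with itself, \<open>g\<close> drops to \<open>k - 1\<close> and \<open>k\<close> rises to
  \<open>k + 1\<close>. Every change of the array is a transposition, whence the
  permutation.\<close>

lemma partition_loop_result:
  assumes "partition_loop A p q l g k c s = (A', l', g', c', s')"
    "L \<le> l" "l \<le> k" "l \<le> g + 1" "k \<le> g + 2" "g \<le> R" "p \<le> q"
    "\<forall>i\<in>{L..<l}. A i < p" "\<forall>i\<in>{l..g}. i < k \<longrightarrow> p \<le> A i \<and> A i \<le> q" "\<forall>i\<in>{g<..R}. q \<le> A i"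
  shows "L \<le> l' \<and> l' \<le> g' + 1 \<and> g' \<le> R \<and>
    (\<forall>i\<in>{L..<l'}. A' i < p) \<and> (\<forall>i\<in>{l'..g'}. p \<le> A' i \<and> A' i \<le> q) \<and> (\<forall>i\<in>{g'<..R}. q \<le> A' i) \<and>
    (\<exists>\<pi>. \<pi> permutes {L..R} \<and> A' = A \<circ> \<pi>)"
  using assms
proof (induction A p q l g k c s rule: partition_loop.induct)
  case (1 A p q l g k c s)
  let ?Q = "\<lambda>B. L \<le> l' \<and> l' \<le> g' + 1 \<and> g' \<le> R \<and>
    (\<forall>i\<in>{L..<l'}. A' i < p) \<and> (\<forall>i\<in>{l'..g'}. p \<le> A' i \<and> A' i \<le> q) \<and> (\<forall>i\<in>{g'<..R}. q \<le> A' i) \<and>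
    (\<exists>\<pi>. \<pi> permutes {L..R} \<and> A' = B \<circ> \<pi>)"
  have perm: "\<exists>\<pi>. \<pi> permutes {L..R} \<and> A' = A \<circ> \<pi>"
    if "\<exists>\<pi>. \<pi> permutes {L..R} \<and> A' = swap A i j \<circ> \<pi>" "i \<in> {L..R}" "j \<in> {L..R}" for i j A
    using that permutes_compose[OF _ permutes_swap_id[OF that(2,3)]]
    by (auto simp: swap_eq_comp comp_assoc)
  show ?case
  proof (cases "k \<le> g")
    case False
    then show ?thesis
      using "1.prems" by (subst (asm) partition_loop.simps) (auto intro!: exI[of _ id] permutes_id)
  next
    case kg: True
    show ?thesis
    proof (cases "A k < p")
      case True
      have e: "partition_loop (swap A k l) p q (l + 1) g (k + 1) (c + 1) (s + 1) = (A', l', g', c', s')"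
        using "1.prems"(1) kg True by (subst (asm) partition_loop.simps) simp
      have "?Q (swap A k l)"
        by (rule "1.IH"(1)[OF kg True e]) (use "1.prems" kg True in \<open>auto simp: swap_def\<close>)
      moreover from this have "\<exists>\<pi>. \<pi> permutes {L..R} \<and> A' = A \<circ> \<pi>"
        by (intro perm[of A k l]) (use "1.prems"(2-6) kg in auto)
      ultimately show ?thesis
        by blast
    next
      case kp: False
      show ?thesis
      proof (cases "A k \<ge> q")
        case False
        have e: "partition_loop A p q l g (k + 1) (c + 2) s = (A', l', g', c', s')"
          using "1.prems"(1) kg kp False by (subst (asm) partition_loop.simps) simp
        show ?thesis
          by (rule "1.IH"(4)[OF kg kp False e]) (use "1.prems" kg kp False in \<open>auto simp: not_less not_le\<close>)
      next
        case kq: True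
        obtain h c2 where sc: "scan_left A q k g (c + 2) = (h, c2)" by fastforce
        have h: "k \<le> h" "h \<le> g" "\<forall>i\<in>{h<..g}. A i > q" "A h \<le> q \<or> h = k"
          using scan_left_result[OF sc kg] by auto
        show ?thesis
        proof (cases "A h \<ge> p")
          case True
          have e: "partition_loop (swap A k h) p q l (h - 1) (k + 1) (c2 + 1) (s + 1) = (A', l', g', c', s')"
            using "1.prems"(1) kg kp kq True sc by (subst (asm) partition_loop.simps) simp
          have q: "\<forall>i\<in>{h - 1<..R}. q \<le> swap A k h i"
          proof
            fix i assume "i \<in> {h - 1<..R}"
            then consider "i = h" | "i \<in> {h<..g}" | "i \<in> {g<..R}" by fastforce
            then show "q \<le> swap A k h i"
              using h kq "1.prems"(10) kg by cases (auto simp: swap_def less_imp_le)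
          qed
          have "?Q (swap A k h)"
            by (rule "1.IH"(2)[OF kg kp kq sc[symmetric] True e])
               (use "1.prems" kg h True q in \<open>auto simp: swap_def\<close>)
          moreover from this have "\<exists>\<pi>. \<pi> permutes {L..R} \<and> A' = A \<circ> \<pi>"
            by (intro perm[of A k h]) (use "1.prems"(2-6) kg h in auto)
          ultimately show ?thesis
            by blast
        next
          case False
          have e: "partition_loop (swap (swap A k h) k l) p q (l + 1) (h - 1) (k + 1) (c2 + 1) (s + 2) = (A', l', g', c', s')"
            using "1.prems"(1) kg kp kq False sc by (subst (asm) partition_loop.simps) simp
          \<comment> \<open>A small key at \<open>h\<close> excludes \<open>h = k\<close>, since the
            key at \<open>k\<close> is not small.\<close>
          have hk: "h > k" using False kp h by (cases "h = k") auto
          have q: "\<forall>i\<in>{h - 1<..R}. q \<le> swap (swap A k h) k l i"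
          proof
            fix i assume "i \<in> {h - 1<..R}"
            then consider "i = h" | "i \<in> {h<..g}" | "i \<in> {g<..R}" by fastforce
            then show "q \<le> swap (swap A k h) k l i"
              using h hk kq "1.prems"(3,10) kg by cases (auto simp: swap_def less_imp_le)
          qed
          have mid: "\<forall>i\<in>{l + 1..h - 1}. i < k + 1 \<longrightarrow>
              p \<le> swap (swap A k h) k l i \<and> swap (swap A k h) k l i \<le> q"
          proof (intro ballI impI)
            fix i assume i: "i \<in> {l + 1..h - 1}" "i < k + 1"
            then show "p \<le> swap (swap A k h) k l i \<and> swap (swap A k h) k l i \<le> q"
              using h hk "1.prems"(3,9) kg by (auto simp: swap_def)
          qed
          have "?Q (swap (swap A k h) k l)"
            by (rule "1.IH"(3)[OF kg kp kq sc[symmetric] False e _ _ _ _ _ _ _ mid q])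
               (use "1.prems" kg h hk False in \<open>auto simp: swap_def\<close>)
          moreover from this have "\<exists>\<pi>. \<pi> permutes {L..R} \<and> A' = A \<circ> \<pi>"
            by (intro perm[of A k h] perm[of "swap A k h" k l]) (use "1.prems"(2-6) kg h in auto)
          ultimately show ?thesis
            by blast
        qed
      qed
    qed
  qed
qed


section \<open>Exact cost of a partitioning step\<close>

lemma card_interval_split:
  fixes a b c :: int
  assumes "a \<le> b" "b \<le> c + 1"
  shows "card {i\<in>{a..c}. P i} = card {i\<in>{a..b - 1}. P i} + card {i\<in>{b..c}. P i}"
proof -
  have "{i\<in>{a..c}. P i} = {i\<in>{a..b - 1}. P i} \<union> {i\<in>{b..c}. P i}"
    using assms by auto
  moreover have fin: "finite {i\<in>{x..y}. P i}" for x y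
    by (rule finite_subset[of _ "{x..y}"]) auto
  ultimately show ?thesis
    by (simp only:) (rule card_Un_disjoint[OF fin fin], auto)
qed

lemma card_singleton_filter: "card {i\<in>{k..k}. P i} = (if P (k::int) then 1 else 0)"
proof -
  have "{i\<in>{k..k}. P i} = (if P k then {k} else {})" by auto
  then show ?thesis by simp
qed

lemma card_interval_Cons:
  fixes k g :: int
  assumes "k \<le> g"
  shows "card {i\<in>{k..g}. P i} = (if P k then 1 else 0) + card {i\<in>{k + 1..g}. P i}"
  using card_interval_split[of k "k + 1" g P] assms card_singleton_filter[of k P] by simp

text \<open>
  Each large key met by \<open>k\<close> is exchanged with a key found by \<open>g\<close> that is not large.
  Hence \<open>k\<close> inspects the first \<open>K\<close> positions of the untouched window \<open>{k..g}\<close>,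
  where \<open>K\<close> is the number of keys in it that are not large; \<open>e\<close> accounts for the case
  that \<open>k\<close> and \<open>g\<close> meet in a large key.
\<close>

lemma partition_loop_cost:
  assumes "partition_loop A p q l g k c s = (A', l', g', c', s')"
    "l \<le> k" "k \<le> g + 2" "p \<le> q" "\<forall>i\<in>{k..g}. A i \<noteq> q"
  defines "K \<equiv> int (card {i\<in>{k..g}. A i < q})"
  shows "\<exists>e\<le>1. c' = c + nat (g - k + 1) + card {i\<in>{k..k + K - 1}. A i \<ge> p}
      + card {i\<in>{k..k + K - 1}. A i > q} + 3 * e \<and>
    s' = s + card {i\<in>{k..g}. A i < p} + card {i\<in>{k..k + K - 1}. A i > q} + e"
  using assms(1-5) unfolding K_def
proof (induction A p q l g k c s rule: partition_loop.induct)
  case (1 A p q l g k c s)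
  show ?case
  proof (cases "k \<le> g")
    case False
    then have "nat (g - k + 1) = 0" by auto
    then show ?thesis
      using "1.prems" False by (subst (asm) partition_loop.simps) (auto intro!: exI[of _ 0])
  next
    case kg: True
    define K where "K = int (card {i\<in>{k..g}. A i < q})"
    show ?thesis
    proof (cases "A k < q")
      case kq: True
      define K1 where "K1 = int (card {i\<in>{k + 1..g}. A i < q})"
      have K: "K = 1 + K1" using kq card_interval_Cons[OF kg, of "\<lambda>i. A i < q"] by (simp add: K_def K1_def)
      have K1: "0 \<le> K1" by (simp add: K1_def)
      note C = card_interval_Cons[of k "k + K - 1", unfolded K, simplified, OF K1]
      note D = C[of "\<lambda>i. p \<le> A i"] C[of "\<lambda>i. q < A i"] card_interval_Cons[OF kg, of "\<lambda>i. A i < p"]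
      show ?thesis
      proof (cases "A k < p")
        case True
        have e: "partition_loop (swap A k l) p q (l + 1) g (k + 1) (c + 1) (s + 1) = (A', l', g', c', s')"
          using "1.prems"(1) kg True by (subst (asm) partition_loop.simps) simp
        have eq: "swap A k l i = A i" if "k + 1 \<le> i" for i
          using that "1.prems"(2) by (auto simp: swap_def)
        have eqs: "{i \<in> {k + 1..u}. swap A k l i < x} = {i \<in> {k + 1..u}. A i < x}"
          "{i \<in> {k + 1..u}. x < swap A k l i} = {i \<in> {k + 1..u}. x < A i}"
          "{i \<in> {k + 1..u}. x \<le> swap A k l i} = {i \<in> {k + 1..u}. x \<le> A i}" for u x
          using eq by auto
        have "\<exists>e\<le>1. c' = c + 1 + nat (g - (k + 1) + 1) + card {i\<in>{k + 1..k + 1 + K1 - 1}. A i \<ge> p}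
            + card {i\<in>{k + 1..k + 1 + K1 - 1}. A i > q} + 3 * e \<and>
          s' = s + 1 + card {i\<in>{k + 1..g}. A i < p} + card {i\<in>{k + 1..k + 1 + K1 - 1}. A i > q} + e"
          using "1.IH"(1)[OF kg True e, unfolded eqs, folded K1_def] "1.prems" kg eq by auto
        moreover have "nat (g - k + 1) = Suc (nat (g - (k + 1) + 1))" using kg by auto
        ultimately show ?thesis
          unfolding K_def[symmetric] K
          using True kq D by auto
      next
        case kp: False
        have e: "partition_loop A p q l g (k + 1) (c + 2) s = (A', l', g', c', s')"
          using "1.prems"(1) kq by (subst (asm) partition_loop.simps) (simp only: kg kp not_le[THEN iffD2, OF kq] if_True if_False)
        have "\<exists>e\<le>1. c' = c + 2 + nat (g - (k + 1) + 1) + card {i\<in>{k + 1..k + 1 + K1 - 1}. A i \<ge> p}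
            + card {i\<in>{k + 1..k + 1 + K1 - 1}. A i > q} + 3 * e \<and>
          s' = s + card {i\<in>{k + 1..g}. A i < p} + card {i\<in>{k + 1..k + 1 + K1 - 1}. A i > q} + e"
          using "1.IH"(4)[OF kg kp _ e] "1.prems" kg kq unfolding K1_def by auto
        moreover have "nat (g - k + 1) = Suc (nat (g - (k + 1) + 1))" using kg by auto
        ultimately show ?thesis
          unfolding K_def[symmetric] K
          using kp kq D by auto
      qed
    next
      case False
      then have kq: "q < A k" using "1.prems"(5) kg by force
      then have kq': "q \<le> A k" and kp: "\<not> A k < p" using "1.prems"(4) by auto
      obtain h c2 where sc: "scan_left A q k g (c + 2) = (h, c2)" by fastforce
      have h: "k \<le> h" "h \<le> g" "\<forall>i\<in>{h<..g}. A i > q" "A h \<le> q \<or> h = k"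
        "c2 = c + 2 + nat (g - h + 1)"
        using scan_left_result[OF sc kg] by auto
      show ?thesis
      proof (cases "h = k")
        \<comment> \<open>The scan ran down to \<open>k\<close>, so the whole window is large,
          \<open>K = 0\<close> and all counts vanish. Besides one test per window position there are
          the tests \<open>A k < p\<close>, \<open>A k \<ge> q\<close> and
          \<open>A h \<ge> p\<close>, and one swap: this is the case \<open>e = 1\<close>.\<close>
        case True
        have e: "partition_loop (swap A k h) p q l (h - 1) (k + 1) (c2 + 1) (s + 1) = (A', l', g', c', s')"
          using "1.prems"(1) kg kp kq' True sc kp[unfolded not_less] by (subst (asm) partition_loop.simps) simp
        have large: "\<forall>i\<in>{k..g}. A i > q"
          using h(3) kq True by force
        then have "{i\<in>{k..g}. A i < q} = {}" "{i\<in>{k..g}. A i < p} = {}"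
          using "1.prems"(4) by force+
        moreover have "c' = c2 + 1" "s' = s + 1"
          using e True by (subst (asm) partition_loop.simps; simp)+
        moreover have "{i\<in>{k..k + int (card ({}::int set)) - 1}. P i} = {}" for P
          by auto
        ultimately show ?thesis
          using h(5) True kg by (intro exI[of _ 1]) (simp only:, simp)
      next
        case hk: False
        then have hq: "A h < q" "k < h" using h "1.prems"(5) kg by force+
        define K1 where "K1 = int (card {i\<in>{k + 1..h - 1}. A i < q})"
        have none: "{i\<in>{h + 1..g}. A i < x} = {}" if "x \<le> q" for x
          using h(3) that by force
        have split: "card {i\<in>{k..g}. A i < x} = card {i\<in>{k + 1..h - 1}. A i < x} + (if A h < x then 1 else 0)"
          if "x \<le> q" for x
          using card_interval_Cons[OF kg, of "\<lambda>i. A i < x"] card_interval_split[of "k + 1" h g "\<lambda>i. A i < x"]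
            card_interval_Cons[of h g "\<lambda>i. A i < x", unfolded none[OF that]] h hq kq that by auto
        have K: "K = 1 + K1" using split[of q] hq by (simp add: K_def K1_def)
        have K1: "0 \<le> K1" by (simp add: K1_def)
        \<comment> \<open>The positions \<open>{k + 1..k + K1}\<close> counted by the induction
          hypothesis stay left of \<open>h\<close>, so the swaps of this round do not alter their
          keys.\<close>
        have K1h: "K1 \<le> h - 1 - k"
        proof -
          have "card {i\<in>{k + 1..h - 1}. A i < q} \<le> card {k + 1..h - 1}"
            by (rule card_mono) auto
          then show ?thesis using hq by (simp add: K1_def)
        qed
        have ub: "k + 1 + K1 - 1 \<le> h - 1" using K1h by simp
        note C = card_interval_Cons[of k "k + K - 1", unfolded K, simplified, OF K1]
        note D = C[of "\<lambda>i. p \<le> A i"] C[of "\<lambda>i. q < A i"] split[of p]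
        \<comment> \<open>The new window loses \<open>k\<close> and the \<open>g - h + 1\<close>
          scanned positions. The scan pays for the latter; the other three comparisons of the round
          are charged to \<open>k\<close>, once as a window position, once as a key at least
          \<open>p\<close> and once as a key above \<open>q\<close>.\<close>
        have n: "nat (g - k + 1) = Suc (nat (h - 1 - (k + 1) + 1) + nat (g - h + 1))"
          using h hq by auto
        show ?thesis
        proof (cases "A h \<ge> p")
          case True
          have e: "partition_loop (swap A k h) p q l (h - 1) (k + 1) (c2 + 1) (s + 1) = (A', l', g', c', s')"
            using "1.prems"(1) kg kp kq' True sc by (subst (asm) partition_loop.simps) simp
          have eq: "swap A k h i = A i" if "k + 1 \<le> i" "i \<le> h - 1" for i
            using that by (auto simp: swap_def)
          have eqs: "{i \<in> {k + 1..u}. swap A k h i < x} = {i \<in> {k + 1..u}. A i < x}"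
            "{i \<in> {k + 1..u}. x < swap A k h i} = {i \<in> {k + 1..u}. x < A i}"
            "{i \<in> {k + 1..u}. x \<le> swap A k h i} = {i \<in> {k + 1..u}. x \<le> A i}" if "u \<le> h - 1" for u x
            using eq that by auto
          have *: "\<exists>e\<le>1. c' = c2 + 1 + nat (h - 1 - (k + 1) + 1) + card {i\<in>{k + 1..k + 1 + K1 - 1}. A i \<ge> p}
              + card {i\<in>{k + 1..k + 1 + K1 - 1}. A i > q} + 3 * e \<and>
            s' = s + 1 + card {i\<in>{k + 1..h - 1}. A i < p} + card {i\<in>{k + 1..k + 1 + K1 - 1}. A i > q} + e"
            using "1.IH"(2)[OF kg kp kq' sc[symmetric] True e, unfolded eqs[OF order_refl], folded K1_def,
                unfolded eqs[OF ub]] "1.prems"(2-5) h hq K1h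
            by (auto simp: eq)
          show ?thesis
            unfolding K_def[symmetric] K n
            using True kq kp h(5) * "1.prems"(4) D by auto
        next
          case False
          have e: "partition_loop (swap (swap A k h) k l) p q (l + 1) (h - 1) (k + 1) (c2 + 1) (s + 2) = (A', l', g', c', s')"
            using "1.prems"(1) kg kp kq' False sc by (subst (asm) partition_loop.simps) simp
          have eq: "swap (swap A k h) k l i = A i" if "k + 1 \<le> i" "i \<le> h - 1" for i
            using that "1.prems"(2) by (auto simp: swap_def)
          have eqs: "{i \<in> {k + 1..u}. swap (swap A k h) k l i < x} = {i \<in> {k + 1..u}. A i < x}"
            "{i \<in> {k + 1..u}. x < swap (swap A k h) k l i} = {i \<in> {k + 1..u}. x < A i}"
            "{i \<in> {k + 1..u}. x \<le> swap (swap A k h) k l i} = {i \<in> {k + 1..u}. x \<le> A i}" if "u \<le> h - 1" for u x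
            using eq that by auto
          have *: "\<exists>e\<le>1. c' = c2 + 1 + nat (h - 1 - (k + 1) + 1) + card {i\<in>{k + 1..k + 1 + K1 - 1}. A i \<ge> p}
              + card {i\<in>{k + 1..k + 1 + K1 - 1}. A i > q} + 3 * e \<and>
            s' = s + 2 + card {i\<in>{k + 1..h - 1}. A i < p} + card {i\<in>{k + 1..k + 1 + K1 - 1}. A i > q} + e"
            using "1.IH"(3)[OF kg kp kq' sc[symmetric] False e, unfolded eqs[OF order_refl], folded K1_def,
                unfolded eqs[OF ub]] "1.prems"(2-5) h hq K1h
            by (auto simp: eq)
          show ?thesis
            unfolding K_def[symmetric] K n
            using False kq kp h(5) * "1.prems"(4) D by auto
        qed
      qed
    qed
  qed
qed


lemma array_image_subset:
  "array_image f V d l r A B \<Longrightarrow> l \<le> l' \<Longrightarrow> r' \<le> r \<Longrightarrow> array_image f V d l' r' A B"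
  by (auto simp: array_image_def)

lemma array_image_glue:
  assumes "array_image f V d l r A B" "array_image f V d l' r' A1 B1"
    "\<And>i. i < l' \<or> i > r' \<Longrightarrow> A1 i = A i" "\<And>i. i < l' + d \<or> i > r' + d \<Longrightarrow> B1 i = B i"
  shows "array_image f V d l r A1 B1"
  unfolding array_image_def
proof
  fix i assume i: "i \<in> {l..r}"
  show "A1 i \<in> V \<and> B1 (i + d) = f (A1 i)"
  proof (cases "i \<in> {l'..r'}")
    case True
    then show ?thesis using assms(2) by (auto simp: array_image_def)
  next
    case False
    then show ?thesis using assms(3)[of i] assms(1) assms(4)[of "i + d"] i by (auto simp: array_image_def)
  qed
qed

lemma partition_step_unfold:
  assumes "partition_step A left right = (A', l, g, c, s)" "left < right"
  defines "p \<equiv> min (A left) (A right)" and "q \<equiv> max (A left) (A right)"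
  obtains A1 where "partition_loop A p q (left + 1) (right - 1) (left + 1) 1 0 = (A1, l + 1, g - 1, c, s - 2)"
    "s \<ge> 2" "A' = A1(left := A1 l, l := p, right := (A1(left := A1 l, l := p)) g, g := q)"
proof -
  obtain A1 l1 g1 c1 s1 where *:
    "partition_loop A p q (left + 1) (right - 1) (left + 1) 1 0 = (A1, l1, g1, c1, s1)"
    by (metis prod_cases5)
  have "(if A left > A right then (A right, A left) else (A left, A right)) = (p, q)"
    by (auto simp: p_def q_def)
  then have "l1 = l + 1" "g1 = g - 1" "c1 = c" "s1 = s - 2" "s \<ge> 2"
    "A' = A1(left := A1 l, l := p, right := (A1(left := A1 l, l := p)) g, g := q)"
    using assms(1) * by (auto simp: partition_step_def Let_def)
  with * that show ?thesis by simp
qed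

lemma partition_step_permutes:
  assumes "partition_step A left right = (A', l, g, c, s)" "left < right"
  defines "p \<equiv> min (A left) (A right)" and "q \<equiv> max (A left) (A right)"
  shows "left \<le> l \<and> l < g \<and> g \<le> right \<and> A' l = p \<and> A' g = q \<and>
    (\<forall>i\<in>{left..<l}. A' i < p) \<and> (\<forall>i\<in>{l<..<g}. p \<le> A' i \<and> A' i \<le> q) \<and> (\<forall>i\<in>{g<..right}. q \<le> A' i) \<and>
    (\<exists>\<pi>. \<pi> permutes {left..right} \<and> A' = A \<circ> \<pi>)"
proof -
  obtain A1 where loop: "partition_loop A p q (left + 1) (right - 1) (left + 1) 1 0 = (A1, l + 1, g - 1, c, s - 2)"
    and A': "A' = A1(left := A1 l, l := p, right := (A1(left := A1 l, l := p)) g, g := q)"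
    using partition_step_unfold[OF assms(1,2)] unfolding p_def q_def by blast
  have res: "left + 1 \<le> l + 1 \<and> l + 1 \<le> g - 1 + 1 \<and> g - 1 \<le> right - 1 \<and>
    (\<forall>i\<in>{left + 1..<l + 1}. A1 i < p) \<and> (\<forall>i\<in>{l + 1..g - 1}. p \<le> A1 i \<and> A1 i \<le> q) \<and>
    (\<forall>i\<in>{g - 1<..right - 1}. q \<le> A1 i) \<and> (\<exists>\<pi>. \<pi> permutes {left + 1..right - 1} \<and> A1 = A \<circ> \<pi>)"
    by (rule partition_loop_result[OF loop]) (use assms(2) in \<open>auto simp: p_def q_def min_le_iff_disj le_max_iff_disj\<close>)
  then obtain \<pi> where \<pi>: "\<pi> permutes {left + 1..right - 1}" "A1 = A \<circ> \<pi>" by blast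
  have "\<pi> left = left" "\<pi> right = right"
    using \<pi>(1) by (auto intro!: permutes_not_in)
  then have ends: "A1 left = A left" "A1 right = A right" using \<pi> by auto
  have bounds: "left \<le> l" "l < g" "g \<le> right" using res by auto
  \<comment> \<open>The final assignments overwrite both ends instead of swapping. They become two
    genuine swaps once the pivots are imagined in sorted order at the ends, which \<open>A0\<close>
    achieves by at most one swap; so the result is a rearrangement of \<open>A\<close>.\<close>
  define A0 where "A0 = (if A left > A right then swap A1 left right else A1)"
  have A0: "A0 = A1(left := p, right := q)"
    using ends by (auto simp: A0_def swap_def p_def q_def fun_eq_iff)
  have A'': "A' = swap (swap A0 left l) right g"
    using bounds by (auto simp: A' A0 swap_def fun_eq_iff)
  have sub: "\<pi> permutes {left..right}"
    using \<pi>(1) by (rule permutes_subset) auto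
  have step: "\<exists>\<pi>. \<pi> permutes {left..right} \<and> swap B i j = A \<circ> \<pi>"
    if "\<exists>\<pi>. \<pi> permutes {left..right} \<and> B = A \<circ> \<pi>" "i \<in> {left..right}" "j \<in> {left..right}" for B i j
    using that permutes_compose[OF permutes_swap_id[OF that(2,3)]]
    by (force simp: swap_eq_comp comp_assoc)
  have "\<exists>\<pi>. \<pi> permutes {left..right} \<and> A1 = A \<circ> \<pi>" using sub \<pi>(2) by blast
  then have "\<exists>\<pi>. \<pi> permutes {left..right} \<and> A0 = A \<circ> \<pi>"
    unfolding A0_def using step[of A1 left right] assms(2) by auto
  then have "\<exists>\<pi>. \<pi> permutes {left..right} \<and> A' = A \<circ> \<pi>"
    unfolding A'' using bounds by (intro step) auto
  moreover have "A' l = p" "A' g = q" using bounds by (auto simp: A')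
  moreover have "\<forall>i\<in>{left..<l}. A' i < p"
    using res bounds by (auto simp: A')
  moreover have "\<forall>i\<in>{l<..<g}. p \<le> A' i \<and> A' i \<le> q"
    using res bounds by (auto simp: A')
  moreover have "\<forall>i\<in>{g<..right}. q \<le> A' i"
    using res bounds by (auto simp: A')
  ultimately show ?thesis using bounds by blast
qed

lemma partition_step_cost:
  assumes "partition_step A left right = (A', l, g, c, s)" "left < right" "inj_on A {left..right}"
  defines "p \<equiv> min (A left) (A right)" and "q \<equiv> max (A left) (A right)"
  defines "K \<equiv> int (card {i\<in>{left + 1..right - 1}. A i < q})"
  shows "\<exists>e\<le>1. c = 1 + nat (right - left - 1) + card {i\<in>{left + 1..left + K}. A i \<ge> p}
      + card {i\<in>{left + 1..left + K}. A i > q} + 3 * e \<and>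
    s = 2 + card {i\<in>{left + 1..right - 1}. A i < p} + card {i\<in>{left + 1..left + K}. A i > q} + e"
proof -
  obtain A1 where loop: "partition_loop A p q (left + 1) (right - 1) (left + 1) 1 0 = (A1, l + 1, g - 1, c, s - 2)"
    and s: "s \<ge> 2"
    using partition_step_unfold[OF assms(1,2)] unfolding p_def q_def by blast
  have "\<forall>i\<in>{left + 1..right - 1}. A i \<noteq> q"
  proof
    fix i assume "i \<in> {left + 1..right - 1}"
    then have "A i \<noteq> A left" "A i \<noteq> A right"
      using inj_onD[OF assms(3), of i left] inj_onD[OF assms(3), of i right] by auto
    then show "A i \<noteq> q" by (auto simp: q_def max_def)
  qed
  from partition_loop_cost[OF loop _ _ _ this] show ?thesis
    using assms(2) s unfolding K_def[symmetric] by (auto simp: p_def q_def min_le_iff_disj le_max_iff_disj)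
qed

text \<open>Serves two kinds of relabelling: strictly monotone ones, which commute with the whole
  recursion, and permutations of the values inside the three blocks, which commute with this one
  step only.\<close>

lemma partition_step_image:
  assumes im: "array_image f V d left right A B" and "left < right"
    and cmp: "\<And>v x. v \<in> V \<Longrightarrow> x \<in> {A left, A right} \<Longrightarrow> (f v < f x \<longleftrightarrow> v < x) \<and> (f x < f v \<longleftrightarrow> x < v)"
    and step: "partition_step A left right = (A', l, g, c, s)"
  shows "\<exists>B'. partition_step B (left + d) (right + d) = (B', l + d, g + d, c, s) \<and>
    array_image f V d left right A' B'"
proof -
  define p q where "p = min (A left) (A right)" and "q = max (A left) (A right)"
  obtain A1 where loop: "partition_loop A p q (left + 1) (right - 1) (left + 1) 1 0 = (A1, l + 1, g - 1, c, s - 2)"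
    and s: "s \<ge> 2" and A': "A' = A1(left := A1 l, l := p, right := (A1(left := A1 l, l := p)) g, g := q)"
    using partition_step_unfold[OF step assms(2)] unfolding p_def q_def by blast
  have bounds: "left \<le> l" "l < g" "g \<le> right" using partition_step_permutes[OF step assms(2)] by auto
  have V: "A left \<in> V" "A right \<in> V" and B: "B (left + d) = f (A left)" "B (right + d) = f (A right)"
    using im assms(2) by (auto simp: array_image_def)
  have pV: "p \<in> V" "q \<in> V" using V by (auto simp: p_def q_def min_def max_def)
  have c': "(f v < f p \<longleftrightarrow> v < p) \<and> (f v < f q \<longleftrightarrow> v < q) \<and> (f q < f v \<longleftrightarrow> q < v)" if "v \<in> V" for v
    using cmp[OF that, of p] cmp[OF that, of q] by (auto simp: p_def q_def min_def max_def)
  have pq: "(if B (left + d) > B (right + d) then (B (right + d), B (left + d)) else (B (left + d), B (right + d)))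
    = (f p, f q)"
    using cmp[OF V(1), of "A right"] B by (auto simp: p_def q_def min_def max_def)
  obtain B1 where B1: "partition_loop B (f p) (f q) (left + 1 + d) (right - 1 + d) (left + 1 + d) 1 0
      = (B1, l + 1 + d, g - 1 + d, c, s - 2)" and im1: "array_image f V d left right A1 B1"
    using partition_loop_image[OF im _ _ _ c' loop] by auto
  have eq: "left + 1 + d = left + d + 1" "right - 1 + d = right + d - 1" by auto
  define A2 where "A2 = A1(left := A1 l, l := p)"
  define B2 where "B2 = B1(left + d := B1 (l + d), l + d := f p)"
  have im2: "array_image f V d left right A2 B2"
    unfolding A2_def B2_def using im1 bounds pV array_imageD[OF im1, of l]
    by (auto intro!: array_image_upd)
  have "array_image f V d left right A' (B2(right + d := B2 (g + d), g + d := f q))"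
    unfolding A' A2_def[symmetric] using im2 bounds pV array_imageD[OF im2, of g]
    by (auto intro!: array_image_upd)
  moreover have "partition_step B (left + d) (right + d) = (B2(right + d := B2 (g + d), g + d := f q), l + d, g + d, c, s)"
    unfolding partition_step_def pq using B1 s unfolding eq by (simp add: Let_def B2_def)
  ultimately show ?thesis by blast
qed

section \<open>Recursive calls: locality and invariance of the counts\<close>

lemma quicksort_outside:
  assumes "quicksort M A left right = (A', c, s)" "M \<ge> 1" "i < left \<or> i > right"
  shows "A' i = A i"
  using assms
proof (induction M A left right arbitrary: A' c s rule: quicksort.induct)
  case (1 M A left right)
  show ?case
  proof (cases "right - left < int M")
    case True
    then show ?thesis
      using "1.prems" insertion_sort_outside[of A left right _ _ i]
      by (subst (asm) quicksort.simps) (auto split: prod.splits)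
  next
    case False
    obtain A0 l g c0 s0 where 0: "partition_step A left right = (A0, l, g, c0, s0)" by (metis prod_cases5)
    obtain A1 c1 s1 where 1: "quicksort M A0 left (l - 1) = (A1, c1, s1)" by (metis prod_cases3)
    obtain A2 c2 s2 where 2: "quicksort M A1 (l + 1) (g - 1) = (A2, c2, s2)" by (metis prod_cases3)
    obtain A3 c3 s3 where 3: "quicksort M A2 (g + 1) right = (A3, c3, s3)" by (metis prod_cases3)
    have lr: "left < right" using False "1.prems" by auto
    have b: "left \<le> l" "l < g" "g \<le> right" using partition_step_permutes[OF 0 lr] by auto
    obtain \<pi> where "\<pi> permutes {left..right}" "A0 = A \<circ> \<pi>" using partition_step_permutes[OF 0 lr] by auto
    then have "A0 i = A i" using "1.prems"(3) by (auto simp: permutes_not_in)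
    moreover have "A1 i = A0 i"
      by (rule "1.IH"(1)[OF False 0[symmetric] refl refl refl 1]) (use "1.prems" b in auto)
    moreover have "A2 i = A1 i"
      by (rule "1.IH"(2)[OF False 0[symmetric] refl refl refl 1[symmetric] refl 2]) (use "1.prems" b in auto)
    moreover have "A3 i = A2 i"
      by (rule "1.IH"(3)[OF False 0[symmetric] refl refl refl 1[symmetric] refl 2[symmetric] refl 3]) (use "1.prems" b in auto)
    moreover have "A' = A3"
      using "1.prems"(1) False 0 1 2 3 by (subst (asm) quicksort.simps) simp
    ultimately show ?thesis by simp
  qed
qed

text \<open>Strict monotonicity on all of \<open>V\<close> is the right condition here, because
  later pivots and Insertionsort may compare any two keys. Each recursive call gives the image
  relation only on its own segment; \<open>array_image_glue\<close> extends it, as nothing outside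
  the segment has changed.\<close>

lemma quicksort_image:
  fixes A :: "int \<Rightarrow> 'a::linorder" and B :: "int \<Rightarrow> 'b::linorder"
  assumes "array_image f V d left right A B" "strict_mono_on V f" "M \<ge> 1"
    "quicksort M A left right = (A', c, s)"
  shows "\<exists>B'. quicksort M B (left + d) (right + d) = (B', c, s) \<and> array_image f V d left right A' B'"
  using assms
proof (induction M A left right arbitrary: A' B c s rule: quicksort.induct)
  case (1 M A left right)
  show ?case
  proof (cases "right - left < int M")
    case True
    obtain A1 c1 where 1: "insertion_sort A left right = (A1, c1)" by fastforce
    obtain B1 c2 where 2: "insertion_sort B (left + d) (right + d) = (B1, c2)" by fastforce
    show ?thesis
      using insertion_sort_image[OF "1.prems"(1,2) 1 2] "1.prems"(4) 1 2 True
      unfolding quicksort.simps[of M A] quicksort.simps[of M B] by simp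
  next
    case False
    obtain A0 l g c0 s0 where 0: "partition_step A left right = (A0, l, g, c0, s0)" by (metis prod_cases5)
    obtain A1 c1 s1 where 1: "quicksort M A0 left (l - 1) = (A1, c1, s1)" by (metis prod_cases3)
    obtain A2 c2 s2 where 2: "quicksort M A1 (l + 1) (g - 1) = (A2, c2, s2)" by (metis prod_cases3)
    obtain A3 c3 s3 where 3: "quicksort M A2 (g + 1) right = (A3, c3, s3)" by (metis prod_cases3)
    have lr: "left < right" using False "1.prems" by auto
    have b: "left \<le> l" "l < g" "g \<le> right" using partition_step_permutes[OF 0 lr] by auto
    have V: "A left \<in> V" "A right \<in> V" using array_imageD[OF "1.prems"(1)] lr by auto
    have cmp: "(f v < f x \<longleftrightarrow> v < x) \<and> (f x < f v \<longleftrightarrow> x < v)" if "v \<in> V" "x \<in> {A left, A right}" for v x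
      using V that strict_mono_on_less[OF "1.prems"(2)] by auto
    obtain B0 where B0: "partition_step B (left + d) (right + d) = (B0, l + d, g + d, c0, s0)"
      "array_image f V d left right A0 B0"
      using partition_step_image[OF "1.prems"(1) lr cmp 0] by blast
    have eq: "l - 1 + d = l + d - 1" "l + 1 + d = l + d + 1" "g - 1 + d = g + d - 1" "g + 1 + d = g + d + 1"
      by auto
    obtain B1 where B1: "quicksort M B0 (left + d) (l - 1 + d) = (B1, c1, s1)"
      "array_image f V d left (l - 1) A1 B1"
      using "1.IH"(1)[OF False 0[symmetric] refl refl refl array_image_subset[OF B0(2)] "1.prems"(2,3) 1] b by auto
    have im1: "array_image f V d left right A1 B1"
      by (rule array_image_glue[OF B0(2) B1(2)])
         (use quicksort_outside[OF 1 "1.prems"(3)] quicksort_outside[OF B1(1) "1.prems"(3)] in auto)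
    obtain B2 where B2: "quicksort M B1 (l + 1 + d) (g - 1 + d) = (B2, c2, s2)"
      "array_image f V d (l + 1) (g - 1) A2 B2"
      using "1.IH"(2)[OF False 0[symmetric] refl refl refl 1[symmetric] refl
          array_image_subset[OF im1] "1.prems"(2,3) 2] b by auto
    have im2: "array_image f V d left right A2 B2"
      by (rule array_image_glue[OF im1 B2(2)])
         (use quicksort_outside[OF 2 "1.prems"(3)] quicksort_outside[OF B2(1) "1.prems"(3)] in auto)
    obtain B3 where B3: "quicksort M B2 (g + 1 + d) (right + d) = (B3, c3, s3)"
      "array_image f V d (g + 1) right A3 B3"
      using "1.IH"(3)[OF False 0[symmetric] refl refl refl 1[symmetric] refl 2[symmetric] refl
          array_image_subset[OF im2] "1.prems"(2,3) 3] b by auto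
    have im3: "array_image f V d left right A3 B3"
      by (rule array_image_glue[OF im2 B3(2)])
         (use quicksort_outside[OF 3 "1.prems"(3)] quicksort_outside[OF B3(1) "1.prems"(3)] in auto)
    have "quicksort M A left right = (A3, c0 + c1 + c2 + c3, s0 + s1 + s2 + s3)"
      using False 0 1 2 3 by (subst quicksort.simps) simp
    moreover have "quicksort M B (left + d) (right + d) = (B3, c0 + c1 + c2 + c3, s0 + s1 + s2 + s3)"
      using False B0(1) B1(1) B2(1) B3(1) unfolding eq by (subst quicksort.simps) simp
    ultimately show ?thesis using im3 "1.prems"(4) by auto
  qed
qed

lemma quicksort_counts_image:
  assumes "array_image f V d left right A B" "strict_mono_on V f" "M \<ge> 1"
  shows "snd (quicksort M B (left + d) (right + d)) = snd (quicksort M A left right)"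
proof -
  obtain A' c s where "quicksort M A left right = (A', c, s)" by (metis prod_cases3)
  with quicksort_image[OF assms this] show ?thesis by auto
qed

lemma quicksort_counts_cong:
  assumes "\<And>i. left \<le> i \<Longrightarrow> i \<le> right \<Longrightarrow> A i = B i" "M \<ge> 1"
  shows "snd (quicksort M A left right) = snd (quicksort M B left right)"
  using quicksort_counts_image[of id UNIV 0 left right B A M] assms
  by (auto simp: array_image_def strict_mono_on_def)

text \<open>The program runs the calls on successive arrays, but each call finds its own segment as
  the partitioning step left it. So all three counts may be read off the same array
  \<open>A0\<close>, which frees them from the order of execution.\<close>

lemma quicksort_counts_rec:
  assumes "partition_step A left right = (A0, l, g, c0, s0)" "M \<ge> 1" "right - left \<ge> int M"
    "snd (quicksort M A0 left (l - 1)) = (c1, s1)"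
    "snd (quicksort M A0 (l + 1) (g - 1)) = (c2, s2)"
    "snd (quicksort M A0 (g + 1) right) = (c3, s3)"
  shows "snd (quicksort M A left right) = (c0 + c1 + c2 + c3, s0 + s1 + s2 + s3)"
proof -
  obtain A1 where 1: "quicksort M A0 left (l - 1) = (A1, c1, s1)" using assms(4) by (metis prod.collapse)
  have b: "left \<le> l" "l < g" "g \<le> right" using partition_step_permutes[OF assms(1)] assms(2,3) by auto
  have "snd (quicksort M A1 (l + 1) (g - 1)) = snd (quicksort M A0 (l + 1) (g - 1))"
    using quicksort_outside[OF 1 assms(2)] b by (intro quicksort_counts_cong assms(2)) auto
  then obtain A2 where 2: "quicksort M A1 (l + 1) (g - 1) = (A2, c2, s2)" using assms(5) by (metis prod.collapse)
  have "snd (quicksort M A2 (g + 1) right) = snd (quicksort M A0 (g + 1) right)"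
    using quicksort_outside[OF 1 assms(2)] quicksort_outside[OF 2 assms(2)] b
    by (intro quicksort_counts_cong assms(2)) auto
  then obtain A3 where 3: "quicksort M A2 (g + 1) right = (A3, c3, s3)" using assms(6) by (metis prod.collapse)
  show ?thesis using assms(1,3) 1 2 3 by (subst quicksort.simps) simp
qed

section \<open>Recurrences for mean and variance\<close>

definition avg :: "'a set \<Rightarrow> ('a \<Rightarrow> real) \<Rightarrow> real" where
  "avg S f = (\<Sum>x\<in>S. f x) / real (card S)"

lemma avg_const: "finite S \<Longrightarrow> S \<noteq> {} \<Longrightarrow> avg S (\<lambda>_. c) = c"
  by (simp add: avg_def)

lemma avg_add: "avg S (\<lambda>x. f x + g x) = avg S f + avg S g"
  by (simp add: avg_def sum.distrib add_divide_distrib)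

lemma avg_diff: "avg S (\<lambda>x. f x - g x) = avg S f - avg S g"
  by (simp add: avg_def sum_subtractf diff_divide_distrib)

lemma avg_cmult: "avg S (\<lambda>x. c * f x) = c * avg S f"
  by (simp add: avg_def sum_distrib_left)

lemma avg_cong: "(\<And>x. x \<in> S \<Longrightarrow> f x = g x) \<Longrightarrow> avg S f = avg S g"
  by (simp add: avg_def)

lemma avg_mono: "(\<And>x. x \<in> S \<Longrightarrow> f x \<le> g x) \<Longrightarrow> avg S f \<le> avg S g"
  unfolding avg_def by (intro divide_right_mono sum_mono) auto

lemma avg_sum: "avg S (\<lambda>x. \<Sum>y\<in>T. f x y) = (\<Sum>y\<in>T. avg S (\<lambda>x. f x y))"
  unfolding avg_def by (subst sum.swap) (simp add: sum_divide_distrib)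

definition variance_on :: "'a set \<Rightarrow> ('a \<Rightarrow> real) \<Rightarrow> real" where
  "variance_on S f = avg S (\<lambda>x. (f x - avg S f)\<^sup>2)"

text \<open>Bias and variance. Applied to one subproblem at a time, it makes the variances of the
  three subproblems add up in \<open>var_cost_rec\<close>.\<close>

lemma avg_square_shift:
  assumes "finite S" "S \<noteq> {}"
  shows "avg S (\<lambda>x. (u + f x)\<^sup>2) = (u + avg S f)\<^sup>2 + variance_on S f"
proof -
  define m where "m = avg S f"
  have "avg S (\<lambda>x. (u + f x)\<^sup>2) = avg S (\<lambda>x. (u + m)\<^sup>2 + (2 * (u + m) * (f x - m) + (f x - m)\<^sup>2))"
    by (rule avg_cong) (simp add: power2_eq_square algebra_simps)
  also have "\<dots> = (u + m)\<^sup>2 + variance_on S f"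
    using assms by (simp add: avg_add avg_const avg_cmult avg_diff variance_on_def m_def)
  finally show ?thesis by (simp add: m_def)
qed

abbreviation perms :: "nat \<Rightarrow> (int \<Rightarrow> int) set" where
  "perms n \<equiv> {\<pi>. \<pi> permutes {1..int n}}"

lemma finite_perms: "finite (perms n)" and perms_nonempty: "perms n \<noteq> {}"
  by (auto intro!: finite_permutations exI[of _ id] permutes_id)

definition seg_cost :: "real \<Rightarrow> real \<Rightarrow> nat \<Rightarrow> int \<Rightarrow> int \<Rightarrow> (int \<Rightarrow> int) \<Rightarrow> real" where
  "seg_cost \<alpha> \<beta> M l r A =
    \<alpha> * real (fst (snd (quicksort M A l r))) + \<beta> * real (snd (snd (quicksort M A l r)))"

abbreviation qs_cost :: "real \<Rightarrow> real \<Rightarrow> nat \<Rightarrow> nat \<Rightarrow> (int \<Rightarrow> int) \<Rightarrow> real" where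
  "qs_cost \<alpha> \<beta> M n \<equiv> seg_cost \<alpha> \<beta> M 1 (int n)"

definition toll :: "real \<Rightarrow> real \<Rightarrow> nat \<Rightarrow> (int \<Rightarrow> int) \<Rightarrow> real" where
  "toll \<alpha> \<beta> n A = (case partition_step A 1 (int n) of (_, _, _, c, s) \<Rightarrow> \<alpha> * real c + \<beta> * real s)"

abbreviation small_pivot :: "nat \<Rightarrow> (int \<Rightarrow> int) \<Rightarrow> int" where
  "small_pivot n A \<equiv> min (A 1) (A (int n))"

abbreviation large_pivot :: "nat \<Rightarrow> (int \<Rightarrow> int) \<Rightarrow> int" where
  "large_pivot n A \<equiv> max (A 1) (A (int n))"

definition small_size :: "nat \<Rightarrow> (int \<Rightarrow> int) \<Rightarrow> nat" where
  "small_size n A = nat (small_pivot n A - 1)"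

definition medium_size :: "nat \<Rightarrow> (int \<Rightarrow> int) \<Rightarrow> nat" where
  "medium_size n A = nat (large_pivot n A - small_pivot n A - 1)"

definition large_size :: "nat \<Rightarrow> (int \<Rightarrow> int) \<Rightarrow> nat" where
  "large_size n A = nat (int n - large_pivot n A)"

lemma pivots_bounds:
  assumes "A permutes {1..int n}" "n \<ge> 2"
  shows "1 \<le> small_pivot n A" "small_pivot n A < large_pivot n A" "large_pivot n A \<le> int n"
proof -
  have "A 1 \<in> {1..int n}" "A (int n) \<in> {1..int n}"
    using permutes_in_image[OF assms(1), of 1] permutes_in_image[OF assms(1), of "int n"] assms(2) by auto
  moreover have "A 1 \<noteq> A (int n)"
    using injD[OF permutes_inj[OF assms(1)], of 1 "int n"] assms(2) by auto
  ultimately show "1 \<le> small_pivot n A" "small_pivot n A < large_pivot n A" "large_pivot n A \<le> int n"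
    by auto
qed

text \<open>In a permutation of \<open>{1..n}\<close> a key equals its rank, so each pivot ends at
  the position given by its own value, and each subarray holds exactly the values of its index
  range.\<close>

lemma partition_step_perm:
  assumes A: "A permutes {1..int n}" and n: "n \<ge> 2"
    and step: "partition_step A 1 (int n) = (A0, l, g, c, s)"
  defines "p \<equiv> small_pivot n A" and "q \<equiv> large_pivot n A"
  shows "l = p" "g = q" "bij_betw A0 {1..p - 1} {1..p - 1}"
    "bij_betw A0 {p + 1..q - 1} {p + 1..q - 1}" "bij_betw A0 {q + 1..int n} {q + 1..int n}"
proof -
  have pq: "1 \<le> p" "p < q" "q \<le> int n" using pivots_bounds[OF A n] by (simp_all add: p_def q_def)
  have r: "1 \<le> l" "l < g" "g \<le> int n" "A0 l = p" "A0 g = q"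
    "\<forall>i\<in>{1..<l}. A0 i < p" "\<forall>i\<in>{l<..<g}. p \<le> A0 i \<and> A0 i \<le> q" "\<forall>i\<in>{g<..int n}. q \<le> A0 i"
    "\<exists>\<pi>. \<pi> permutes {1..int n} \<and> A0 = A \<circ> \<pi>"
    using partition_step_permutes[OF step] n unfolding p_def q_def by auto
  then have A0: "A0 permutes {1..int n}" using A by (auto intro: permutes_compose)
  have in_range: "A0 i \<in> {1..int n} \<longleftrightarrow> i \<in> {1..int n}" for i using permutes_in_image[OF A0] .
  have inj: "A0 i = A0 j \<longleftrightarrow> i = j" for i j using permutes_inj[OF A0] by (auto simp: inj_def)
  have rs: "A0 i < p" if "1 \<le> i" "i < l" for i using r(6) that by simp
  have rm: "p \<le> A0 i" "A0 i \<le> q" if "l < i" "i < g" for i using r(7) that by simp_all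
  have rl: "q \<le> A0 i" if "g < i" "i \<le> int n" for i using r(8) that by simp
  have lt: "A0 i < p \<longleftrightarrow> i < l" if "i \<in> {1..int n}" for i
  proof -
    consider "i < l" | "i = l" | "l < i" "i < g" | "i = g" | "g < i" by fastforce
    then show ?thesis
      using r(1-5) rs[of i] rm[of i] rl[of i] that pq by cases auto
  qed
  have lt': "A0 i < q \<longleftrightarrow> i < g" if "i \<in> {1..int n}" for i
  proof -
    consider "i < l" | "i = l" | "l < i" "i < g" | "i = g" | "g < i" by fastforce
    then show ?thesis
    proof cases
      \<comment> \<open>For medium positions only \<open>A0 i \<le> q\<close> is known; equality is
        excluded by injectivity, as \<open>q\<close> sits at \<open>g\<close>.\<close>
      case 3
      then have "A0 i \<le> q" "A0 i \<noteq> A0 g" using rm[of i] inj by auto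
      then show ?thesis using 3 r(5) by auto
    qed (use r(1-5) rs[of i] rl[of i] that pq in auto)
  qed
  have surj: "\<exists>i\<in>{1..int n}. A0 i = v" if "v \<in> {1..int n}" for v
    using permutes_image[OF A0] that by (metis imageE)
  \<comment> \<open>The keys left of \<open>l\<close> are exactly the values below \<open>p\<close>;
    comparing cardinalities locates \<open>l\<close>. The same argument with \<open>q\<close>
    locates \<open>g\<close>.\<close>
  have "A0 ` {1..<l} = {1..<p}"
  proof (intro set_eqI iffI)
    fix v assume "v \<in> A0 ` {1..<l}"
    then show "v \<in> {1..<p}" using lt in_range r(1-3) by fastforce
  next
    fix v assume v: "v \<in> {1..<p}"
    then obtain i where i: "i \<in> {1..int n}" "A0 i = v" using surj[of v] pq by auto
    then show "v \<in> A0 ` {1..<l}" using lt[of i] v by auto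
  qed
  then have "card {1..<l} = card {1..<p}"
    by (metis card_image inj inj_onI)
  then show l: "l = p" using r(1) pq by simp
  have "A0 ` {1..<g} = {1..<q}"
  proof (intro set_eqI iffI)
    fix v assume "v \<in> A0 ` {1..<g}"
    then show "v \<in> {1..<q}" using lt' in_range r(1-3) by fastforce
  next
    fix v assume v: "v \<in> {1..<q}"
    then obtain i where i: "i \<in> {1..int n}" "A0 i = v" using surj[of v] pq by auto
    then show "v \<in> A0 ` {1..<g}" using lt'[of i] v by auto
  qed
  then have "card {1..<g} = card {1..<q}"
    by (metis card_image inj inj_onI)
  then show g: "g = q" using r(1,2) pq by simp
  have bij: "bij_betw A0 S S" if "finite S" "A0 ` S \<subseteq> S" for S
    using that endo_inj_surj[OF that] inj by (auto simp: bij_betw_def inj_on_def)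
  show "bij_betw A0 {1..p - 1} {1..p - 1}"
  proof (rule bij)
    show "A0 ` {1..p - 1} \<subseteq> {1..p - 1}"
      using lt in_range l r(1-3) by fastforce
  qed simp
  show "bij_betw A0 {p + 1..q - 1} {p + 1..q - 1}"
  proof (rule bij)
    show "A0 ` {p + 1..q - 1} \<subseteq> {p + 1..q - 1}"
    proof
      fix v assume "v \<in> A0 ` {p + 1..q - 1}"
      then obtain i where i: "i \<in> {p + 1..q - 1}" "v = A0 i" by auto
      then have "v \<noteq> p" using r(4) l inj[of i l] by auto
      then show "v \<in> {p + 1..q - 1}" using i lt[of i] lt'[of i] l g pq by auto
    qed
  qed simp
  show "bij_betw A0 {q + 1..int n} {q + 1..int n}"
  proof (rule bij)
    show "A0 ` {q + 1..int n} \<subseteq> {q + 1..int n}"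
    proof
      fix v assume "v \<in> A0 ` {q + 1..int n}"
      then obtain i where i: "i \<in> {q + 1..int n}" "v = A0 i" by auto
      then have "v \<noteq> q" using r(5) g inj[of i g] by auto
      then show "v \<in> {q + 1..int n}" using i lt'[of i] g pq in_range[of i] by auto
    qed
  qed simp
qed

section \<open>Uniform distribution of the subarrays\<close>

lemma shift_permutes:
  fixes l r d :: int
  assumes "\<pi> permutes {l..r}"
  shows "(\<lambda>i. \<pi> (i - d) + d) permutes {l + d..r + d}"
proof (rule bij_imp_permutes)
  have "bij_betw \<pi> {l..r} {l..r}" using assms by (rule permutes_imp_bij)
  moreover have "bij_betw (\<lambda>i. i - d) {l + d..r + d} {l..r}"
    by (rule bij_betw_byWitness[where f' = "\<lambda>i. i + d"]) auto
  moreover have "bij_betw (\<lambda>i. i + d) {l..r} {l + d..r + d}"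
    by (rule bij_betw_byWitness[where f' = "\<lambda>i. i - d"]) auto
  ultimately have "bij_betw ((\<lambda>i. i + d) \<circ> (\<pi> \<circ> (\<lambda>i. i - d))) {l + d..r + d} {l + d..r + d}"
    by (blast intro: bij_betw_trans)
  then show "bij_betw (\<lambda>i. \<pi> (i - d) + d) {l + d..r + d} {l + d..r + d}"
    by (simp add: comp_def)
next
  fix i assume "i \<notin> {l + d..r + d}"
  then have "i - d \<notin> {l..r}" by auto
  then show "\<pi> (i - d) + d = i" using assms by (simp add: permutes_not_in)
qed

lemma seg_cost_image:
  assumes "\<And>i. l \<le> i \<Longrightarrow> i \<le> r \<Longrightarrow> B (i + d) = A i + e" "M \<ge> 1"
  shows "seg_cost \<alpha> \<beta> M (l + d) (r + d) B = seg_cost \<alpha> \<beta> M l r A"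
proof -
  have "array_image (\<lambda>v. v + e) UNIV d l r A B" "strict_mono_on UNIV (\<lambda>v::int. v + e)"
    using assms(1) by (auto simp: array_image_def strict_mono_on_def)
  from quicksort_counts_image[OF this assms(2)] show ?thesis
    by (simp add: seg_cost_def)
qed

lemma seg_cost_cong:
  assumes "\<And>i. l \<le> i \<Longrightarrow> i \<le> r \<Longrightarrow> B i = A i" "M \<ge> 1"
  shows "seg_cost \<alpha> \<beta> M l r B = seg_cost \<alpha> \<beta> M l r A"
  using seg_cost_image[of l r B 0 A 0 M \<alpha> \<beta>] assms by simp

text \<open>Composing a uniform permutation of \<open>{l..r}\<close> with a fixed bijection and then
  moving positions and values by \<open>1 - l\<close> gives a uniform permutation of
  \<open>{1..m}\<close>; the cost does not notice the translation. The function
  \<open>\<psi>\<close> is arbitrary so that it can absorb the rest of an expression.\<close>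

lemma avg_segment:
  assumes "bij_betw B {l..r} {l..r}" "M \<ge> 1" "l \<le> r + 1"
  shows "avg {\<rho>. \<rho> permutes {l..r}} (\<lambda>\<rho>. \<psi> (seg_cost \<alpha> \<beta> M l r (\<rho> \<circ> B))) =
    avg (perms (nat (r - l + 1))) (\<lambda>\<sigma>. \<psi> (qs_cost \<alpha> \<beta> M (nat (r - l + 1)) \<sigma>))"
proof -
  \<comment> \<open>\<open>B\<close> is controlled only on the segment; extending it by the identity
    yields a permutation with which sums over permutations can be reindexed.\<close>
  define B' where "B' = (\<lambda>i. if i \<in> {l..r} then B i else i)"
  have "bij_betw B' {l..r} {l..r}"
    using assms(1) by (subst bij_betw_cong[of _ _ B]) (auto simp: B'_def)
  then have B': "B' permutes {l..r}"
    by (rule bij_imp_permutes) (auto simp: B'_def)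
  define m where "m = nat (r - l + 1)"
  define d where "d = 1 - l"
  have m: "int m = r + d" "l + d = 1" using assms(3) by (auto simp: m_def d_def)
  have bij: "bij_betw (\<lambda>\<rho> i. \<rho> (i - d) + d) {\<rho>. \<rho> permutes {l..r}} (perms m)"
  proof (rule bij_betw_byWitness[where f' = "\<lambda>\<sigma> i. \<sigma> (i + d) - d"])
    show "(\<lambda>\<rho> i. \<rho> (i - d) + d) ` {\<rho>. \<rho> permutes {l..r}} \<subseteq> perms m"
      using shift_permutes[of _ l r d] m by auto
    have "{1 + - d..int m + - d} = {l..r}" using m by simp
    then show "(\<lambda>\<sigma> i. \<sigma> (i + d) - d) ` perms m \<subseteq> {\<rho>. \<rho> permutes {l..r}}"
      using shift_permutes[of _ 1 "int m" "- d"] by auto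
  qed auto
  have "(\<Sum>\<rho> | \<rho> permutes {l..r}. \<psi> (seg_cost \<alpha> \<beta> M l r (\<rho> \<circ> B))) =
    (\<Sum>\<rho> | \<rho> permutes {l..r}. \<psi> (seg_cost \<alpha> \<beta> M l r (\<rho> \<circ> B')))"
    by (intro sum.cong refl arg_cong[of _ _ \<psi>] seg_cost_cong assms(2)) (simp add: B'_def)
  also have "\<dots> = (\<Sum>\<rho> | \<rho> permutes {l..r}. \<psi> (seg_cost \<alpha> \<beta> M l r \<rho>))"
    using sum_permutations_compose_right[OF B', of "\<lambda>\<rho>. \<psi> (seg_cost \<alpha> \<beta> M l r \<rho>)"] by simp
  also have "\<dots> = (\<Sum>\<rho> | \<rho> permutes {l..r}. \<psi> (qs_cost \<alpha> \<beta> M m (\<lambda>i. \<rho> (i - d) + d)))"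
    by (intro sum.cong refl arg_cong[of _ _ \<psi>])
       (use seg_cost_image[of l r "\<lambda>i. _ (i - d) + d" d _ d M \<alpha> \<beta>] m assms(2) in simp)
  also have "\<dots> = (\<Sum>\<sigma>\<in>perms m. \<psi> (qs_cost \<alpha> \<beta> M m \<sigma>))"
    by (rule sum.reindex_bij_betw[OF bij, of "\<lambda>\<sigma>. \<psi> (qs_cost \<alpha> \<beta> M m \<sigma>)"])
  finally show ?thesis
    using bij_betw_same_card[OF bij] by (simp add: avg_def m_def)
qed

text \<open>Relabelling inside the blocks leaves the course of the step unchanged, so the toll is
  that of \<open>A\<close> itself. After the step the keys are relabelled by the composite, of which
  only one factor acts on each segment.\<close>

lemma qs_cost_rec:
  assumes A: "A permutes {1..int n}" and n: "n > M" "M \<ge> 1"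
    and step: "partition_step A 1 (int n) = (A0, l, g, c, s)"
  defines "p \<equiv> small_pivot n A" and "q \<equiv> large_pivot n A"
  assumes \<rho>: "\<rho>1 permutes {1..p - 1}" "\<rho>2 permutes {p + 1..q - 1}" "\<rho>3 permutes {q + 1..int n}"
  shows "qs_cost \<alpha> \<beta> M n (\<rho>1 \<circ> \<rho>2 \<circ> \<rho>3 \<circ> A) = toll \<alpha> \<beta> n A + seg_cost \<alpha> \<beta> M 1 (p - 1) (\<rho>1 \<circ> A0) +
    seg_cost \<alpha> \<beta> M (p + 1) (q - 1) (\<rho>2 \<circ> A0) + seg_cost \<alpha> \<beta> M (q + 1) (int n) (\<rho>3 \<circ> A0)"
proof -
  have n2: "n \<ge> 2" using n by simp
  have pq: "1 \<le> p" "p < q" "q \<le> int n" using pivots_bounds[OF A n2] by (simp_all add: p_def q_def)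
  define \<rho> where "\<rho> = \<rho>1 \<circ> \<rho>2 \<circ> \<rho>3"
  have \<rho>_in: "\<rho>1 v \<in> {1..p - 1} \<longleftrightarrow> v \<in> {1..p - 1}" "\<rho>2 v \<in> {p + 1..q - 1} \<longleftrightarrow> v \<in> {p + 1..q - 1}"
    "\<rho>3 v \<in> {q + 1..int n} \<longleftrightarrow> v \<in> {q + 1..int n}" for v
    using \<rho> by (simp_all add: permutes_in_image del: atLeastAtMost_iff)
  have \<rho>_out: "v \<notin> {1..p - 1} \<Longrightarrow> \<rho>1 v = v" "v \<notin> {p + 1..q - 1} \<Longrightarrow> \<rho>2 v = v"
    "v \<notin> {q + 1..int n} \<Longrightarrow> \<rho>3 v = v" for v
    using \<rho> by (simp_all add: permutes_not_in)
  have s1: "\<rho> v = \<rho>1 v" if "v \<in> {1..p - 1}" for v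
    using that pq by (simp add: \<rho>_def \<rho>_out)
  have s2: "\<rho> v = \<rho>2 v" if "v \<in> {p + 1..q - 1}" for v
    using that pq \<rho>_in(2)[of v] by (simp add: \<rho>_def \<rho>_out)
  have s3: "\<rho> v = \<rho>3 v" if "v \<in> {q + 1..int n}" for v
    using that pq \<rho>_in(3)[of v] by (simp add: \<rho>_def \<rho>_out)
  have \<rho>p: "\<rho> p = p" "\<rho> q = q" using pq by (auto simp: \<rho>_def \<rho>_out)
  have cmp: "(\<rho> v < \<rho> x \<longleftrightarrow> v < x) \<and> (\<rho> x < \<rho> v \<longleftrightarrow> x < v)" if "v \<in> {1..int n}" "x \<in> {A 1, A (int n)}" for v x
  proof -
    have "x = p \<or> x = q" using that by (auto simp: p_def q_def)
    moreover have "v \<in> {1..p - 1} \<or> v = p \<or> v \<in> {p + 1..q - 1} \<or> v = q \<or> v \<in> {q + 1..int n}"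
      using that(1) unfolding atLeastAtMost_iff by linarith
    then have "(\<rho> v < p \<longleftrightarrow> v < p) \<and> (p < \<rho> v \<longleftrightarrow> p < v) \<and> (\<rho> v < q \<longleftrightarrow> v < q) \<and> (q < \<rho> v \<longleftrightarrow> q < v)"
    proof (elim disjE)
      assume "v \<in> {1..p - 1}"
      then show ?thesis using s1[of v] \<rho>_in(1)[of v] pq by auto
    next
      assume "v \<in> {p + 1..q - 1}"
      then show ?thesis using s2[of v] \<rho>_in(2)[of v] pq by auto
    next
      assume "v \<in> {q + 1..int n}"
      then show ?thesis using s3[of v] \<rho>_in(3)[of v] pq by auto
    qed (use \<rho>p in auto)
    ultimately show ?thesis using \<rho>p by auto
  qed
  have "array_image \<rho> {1..int n} 0 1 (int n) A (\<rho> \<circ> A)"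
    using permutes_in_image[OF A] by (auto simp: array_image_def)
  from partition_step_image[OF this _ cmp step] n2 obtain B where
    B: "partition_step (\<rho> \<circ> A) 1 (int n) = (B, l, g, c, s)" "array_image \<rho> {1..int n} 0 1 (int n) A0 B"
    by auto
  have lg: "l = p" "g = q" and bij: "bij_betw A0 {1..p - 1} {1..p - 1}"
    "bij_betw A0 {p + 1..q - 1} {p + 1..q - 1}" "bij_betw A0 {q + 1..int n} {q + 1..int n}"
    using partition_step_perm[OF A n2 step] by (simp_all add: p_def q_def)
  have Bi: "B i = \<rho> (A0 i)" if "1 \<le> i" "i \<le> int n" for i
    using array_imageD(2)[OF B(2), of i] that by simp
  have c1: "seg_cost \<alpha> \<beta> M 1 (p - 1) B = seg_cost \<alpha> \<beta> M 1 (p - 1) (\<rho>1 \<circ> A0)"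
  proof (rule seg_cost_cong[OF _ n(2)])
    fix i assume "1 \<le> i" "i \<le> p - 1"
    then show "B i = (\<rho>1 \<circ> A0) i"
      using bij_betwE[OF bij(1)] Bi[of i] pq s1 by simp
  qed
  have c2: "seg_cost \<alpha> \<beta> M (p + 1) (q - 1) B = seg_cost \<alpha> \<beta> M (p + 1) (q - 1) (\<rho>2 \<circ> A0)"
  proof (rule seg_cost_cong[OF _ n(2)])
    fix i assume "p + 1 \<le> i" "i \<le> q - 1"
    then show "B i = (\<rho>2 \<circ> A0) i"
      using bij_betwE[OF bij(2)] Bi[of i] pq s2 by simp
  qed
  have c3: "seg_cost \<alpha> \<beta> M (q + 1) (int n) B = seg_cost \<alpha> \<beta> M (q + 1) (int n) (\<rho>3 \<circ> A0)"
  proof (rule seg_cost_cong[OF _ n(2)])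
    fix i assume "q + 1 \<le> i" "i \<le> int n"
    then show "B i = (\<rho>3 \<circ> A0) i"
      using bij_betwE[OF bij(3)] Bi[of i] pq s3 by simp
  qed
  have "snd (quicksort M (\<rho> \<circ> A) 1 (int n)) =
    (c + fst (snd (quicksort M B 1 (l - 1))) + fst (snd (quicksort M B (l + 1) (g - 1))) +
       fst (snd (quicksort M B (g + 1) (int n))),
     s + snd (snd (quicksort M B 1 (l - 1))) + snd (snd (quicksort M B (l + 1) (g - 1))) +
       snd (snd (quicksort M B (g + 1) (int n))))"
    by (rule quicksort_counts_rec[OF B(1) n(2)]) (use n in auto)
  then have "qs_cost \<alpha> \<beta> M n (\<rho> \<circ> A) = (\<alpha> * real c + \<beta> * real s) + seg_cost \<alpha> \<beta> M 1 (p - 1) B +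
    seg_cost \<alpha> \<beta> M (p + 1) (q - 1) B + seg_cost \<alpha> \<beta> M (q + 1) (int n) B"
    by (simp add: seg_cost_def lg algebra_simps)
  then show ?thesis
    using step by (simp add: c1 c2 c3 toll_def \<rho>_def comp_assoc)
qed

text \<open>
  On the permutations with given pivots act the permutations \<open>\<rho>1 \<circ> \<rho>2 \<circ> \<rho>3\<close>
  of the values that preserve the three blocks of keys. Averaging over this action makes the three
  subarrays independent uniformly random permutations.
\<close>

theorem avg_qs_cost_rec:
  assumes n: "n > M" "M \<ge> 1"
  shows "avg (perms n) (\<lambda>A. F (qs_cost \<alpha> \<beta> M n A)) =
    avg (perms n) (\<lambda>A. avg (perms (small_size n A)) (\<lambda>\<sigma>1. avg (perms (medium_size n A)) (\<lambda>\<sigma>2.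
      avg (perms (large_size n A)) (\<lambda>\<sigma>3. F (toll \<alpha> \<beta> n A + qs_cost \<alpha> \<beta> M (small_size n A) \<sigma>1 +
        qs_cost \<alpha> \<beta> M (medium_size n A) \<sigma>2 + qs_cost \<alpha> \<beta> M (large_size n A) \<sigma>3)))))"
    (is "_ = avg _ ?R")
proof -
  have n2: "n \<ge> 2" using n by simp
  \<comment> \<open>Fixing the pair of end keys fixes the three blocks, so one group of relabellings
    acts on the whole class.\<close>
  define G where "G z = {A \<in> perms n. (A 1, A (int n)) = z}" for z
  define Z where "Z = (\<lambda>A::int \<Rightarrow> int. (A 1, A (int n))) ` perms n"
  have fin: "finite Z" by (simp add: Z_def finite_perms)
  have group: "(\<Sum>A\<in>perms n. f A) = (\<Sum>z\<in>Z. \<Sum>A\<in>G z. f A)" for f :: "(int \<Rightarrow> int) \<Rightarrow> real"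
    unfolding G_def Z_def by (rule sum.group[symmetric]) (simp_all add: finite_perms)
  have "(\<Sum>A\<in>G z. F (qs_cost \<alpha> \<beta> M n A)) = (\<Sum>A\<in>G z. ?R A)" if "z \<in> Z" for z
  proof -
    obtain x y where z: "z = (x, y)" by fastforce
    have xy: "x \<in> {1..int n}" "y \<in> {1..int n}"
      using that z n2 permutes_in_image[of _ "{1..int n}" 1] permutes_in_image[of _ "{1..int n}" "int n"]
      by (auto simp: Z_def)
    define p q where "p = min x y" and "q = max x y"
    have pq_bounds: "{1..p - 1} \<subseteq> {1..int n}" "{p + 1..q - 1} \<subseteq> {1..int n}" "{q + 1..int n} \<subseteq> {1..int n}"
      using xy by (auto simp: p_def q_def)
    have p_le_q: "p \<le> q" by (simp add: p_def q_def)
    have GA: "A permutes {1..int n}" "small_pivot n A = p" "large_pivot n A = q" if "A \<in> G z" for A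
      using that z by (auto simp: G_def p_def q_def)
    define S1 S2 S3 where "S1 = {\<rho>. \<rho> permutes {1..p - 1}}" and "S2 = {\<rho>. \<rho> permutes {p + 1..q - 1}}"
      and "S3 = {\<rho>. \<rho> permutes {q + 1..int n}}"
    have ne: "finite S1" "S1 \<noteq> {}" "finite S2" "S2 \<noteq> {}" "finite S3" "S3 \<noteq> {}"
      by (auto simp: S1_def S2_def S3_def intro!: finite_permutations exI[of _ id] permutes_id)
    have act: "(\<Sum>A\<in>G z. F (qs_cost \<alpha> \<beta> M n (\<rho>1 \<circ> \<rho>2 \<circ> \<rho>3 \<circ> A))) = (\<Sum>A\<in>G z. F (qs_cost \<alpha> \<beta> M n A))"
      if \<rho>: "\<rho>1 \<in> S1" "\<rho>2 \<in> S2" "\<rho>3 \<in> S3" for \<rho>1 \<rho>2 \<rho>3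
    proof -
      define \<rho> where "\<rho> = \<rho>1 \<circ> \<rho>2 \<circ> \<rho>3"
      have sub: "\<rho>1 permutes {1..int n}" "\<rho>2 permutes {1..int n}" "\<rho>3 permutes {1..int n}"
        using permutes_subset[OF _ pq_bounds(1), of \<rho>1] permutes_subset[OF _ pq_bounds(2), of \<rho>2]
          permutes_subset[OF _ pq_bounds(3), of \<rho>3] \<rho> by (simp_all add: S1_def S2_def S3_def)
      then have perm: "\<rho> permutes {1..int n}" by (auto simp: \<rho>_def intro!: permutes_compose)
      \<comment> \<open>Neither pivot lies in a block, so the end keys are fixed and the class
        \<open>G z\<close> is mapped onto itself; the sum over it is merely reordered.\<close>
      have fix_pq: "\<rho> p = p" "\<rho> q = q"
        using \<rho> permutes_not_in[of \<rho>1 _ p] permutes_not_in[of \<rho>2 _ p] permutes_not_in[of \<rho>3 _ p]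
          permutes_not_in[of \<rho>1 _ q] permutes_not_in[of \<rho>2 _ q] permutes_not_in[of \<rho>3 _ q] p_le_q
        by (simp_all add: \<rho>_def S1_def S2_def S3_def)
      then have fix_xy: "\<rho> x = x" "\<rho> y = y" by (auto simp: p_def q_def min_def max_def split: if_splits)
      have inv_fix: "inv \<rho> x = x" "inv \<rho> y = y"
        using fix_xy permutes_inverses(2)[OF perm] by (metis)+
      have "bij_betw (\<lambda>A. \<rho> \<circ> A) (G z) (G z)"
        by (rule bij_betw_byWitness[where f' = "\<lambda>A. inv \<rho> \<circ> A"])
           (use fix_xy inv_fix in \<open>auto simp: G_def z permutes_inv_o[OF perm] comp_assoc[symmetric]
             intro: permutes_compose perm permutes_inv\<close>)
      from sum.reindex_bij_betw[OF this, of "\<lambda>A. F (qs_cost \<alpha> \<beta> M n A)"] show ?thesis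
        by (simp add: \<rho>_def)
    qed
    have R: "avg S1 (\<lambda>\<rho>1. avg S2 (\<lambda>\<rho>2. avg S3 (\<lambda>\<rho>3. F (qs_cost \<alpha> \<beta> M n (\<rho>1 \<circ> \<rho>2 \<circ> \<rho>3 \<circ> A))))) = ?R A"
      if A: "A \<in> G z" for A
    proof -
      note GA = GA[OF A]
      obtain A0 l g c s where step: "partition_step A 1 (int n) = (A0, l, g, c, s)" by (metis prod_cases5)
      note bij = partition_step_perm(3-5)[OF GA(1) n2 step, unfolded GA(2,3)]
      have pq: "1 \<le> p" "p < q" "q \<le> int n" using pivots_bounds[OF GA(1) n2] GA(2,3) by simp_all
      have sz: "small_size n A = nat (p - 1)" "medium_size n A = nat (q - p - 1)" "large_size n A = nat (int n - q)"
        unfolding small_size_def medium_size_def large_size_def GA(2,3) by simp_all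
      have m: "nat (p - 1 - 1 + 1) = small_size n A" "nat (q - 1 - (p + 1) + 1) = medium_size n A"
        "nat (int n - (q + 1) + 1) = large_size n A"
        unfolding sz by simp_all
      have rec: "qs_cost \<alpha> \<beta> M n (\<rho>1 \<circ> \<rho>2 \<circ> \<rho>3 \<circ> A) = toll \<alpha> \<beta> n A + seg_cost \<alpha> \<beta> M 1 (p - 1) (\<rho>1 \<circ> A0) +
          seg_cost \<alpha> \<beta> M (p + 1) (q - 1) (\<rho>2 \<circ> A0) + seg_cost \<alpha> \<beta> M (q + 1) (int n) (\<rho>3 \<circ> A0)"
        if "\<rho>1 \<in> S1" "\<rho>2 \<in> S2" "\<rho>3 \<in> S3" for \<rho>1 \<rho>2 \<rho>3
        using qs_cost_rec[OF GA(1) n step, unfolded GA(2,3)] that by (simp add: S1_def S2_def S3_def)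
      have seg1: "avg S1 (\<lambda>\<rho>. \<psi> (seg_cost \<alpha> \<beta> M 1 (p - 1) (\<rho> \<circ> A0))) =
          avg (perms (small_size n A)) (\<lambda>\<sigma>. \<psi> (qs_cost \<alpha> \<beta> M (small_size n A) \<sigma>))" for \<psi>
        using avg_segment[OF bij(1) n(2), of \<psi> \<alpha> \<beta>] pq unfolding S1_def m by simp
      have seg2: "avg S2 (\<lambda>\<rho>. \<psi> (seg_cost \<alpha> \<beta> M (p + 1) (q - 1) (\<rho> \<circ> A0))) =
          avg (perms (medium_size n A)) (\<lambda>\<sigma>. \<psi> (qs_cost \<alpha> \<beta> M (medium_size n A) \<sigma>))" for \<psi>
        using avg_segment[OF bij(2) n(2), of \<psi> \<alpha> \<beta>] pq unfolding S2_def m by simp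
      have seg3: "avg S3 (\<lambda>\<rho>. \<psi> (seg_cost \<alpha> \<beta> M (q + 1) (int n) (\<rho> \<circ> A0))) =
          avg (perms (large_size n A)) (\<lambda>\<sigma>. \<psi> (qs_cost \<alpha> \<beta> M (large_size n A) \<sigma>))" for \<psi>
        using avg_segment[OF bij(3) n(2), of \<psi> \<alpha> \<beta>] pq unfolding S3_def m by simp
      have "avg S1 (\<lambda>\<rho>1. avg S2 (\<lambda>\<rho>2. avg S3 (\<lambda>\<rho>3. F (qs_cost \<alpha> \<beta> M n (\<rho>1 \<circ> \<rho>2 \<circ> \<rho>3 \<circ> A))))) =
        avg S1 (\<lambda>\<rho>1. avg S2 (\<lambda>\<rho>2. avg S3 (\<lambda>\<rho>3. F (toll \<alpha> \<beta> n A + seg_cost \<alpha> \<beta> M 1 (p - 1) (\<rho>1 \<circ> A0) +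
          seg_cost \<alpha> \<beta> M (p + 1) (q - 1) (\<rho>2 \<circ> A0) + seg_cost \<alpha> \<beta> M (q + 1) (int n) (\<rho>3 \<circ> A0)))))"
        by (intro avg_cong) (simp add: rec)
      \<comment> \<open>The segments are replaced one by one, from the innermost average outwards;
        each time the remaining expression, including averages already converted, serves as
        \<open>\<psi>\<close>.\<close>
      also have "\<dots> = avg S1 (\<lambda>\<rho>1. avg S2 (\<lambda>\<rho>2. avg (perms (large_size n A)) (\<lambda>\<sigma>3. F (toll \<alpha> \<beta> n A + seg_cost \<alpha> \<beta> M 1 (p - 1) (\<rho>1 \<circ> A0) +
          seg_cost \<alpha> \<beta> M (p + 1) (q - 1) (\<rho>2 \<circ> A0) + qs_cost \<alpha> \<beta> M (large_size n A) \<sigma>3))))"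
        by (intro avg_cong) (rule seg3[of "\<lambda>t. F (toll \<alpha> \<beta> n A + seg_cost \<alpha> \<beta> M 1 (p - 1) (_ \<circ> A0) +
              seg_cost \<alpha> \<beta> M (p + 1) (q - 1) (_ \<circ> A0) + t)"])
      also have "\<dots> = avg S1 (\<lambda>\<rho>1. avg (perms (medium_size n A)) (\<lambda>\<sigma>2. avg (perms (large_size n A)) (\<lambda>\<sigma>3. F (toll \<alpha> \<beta> n A + seg_cost \<alpha> \<beta> M 1 (p - 1) (\<rho>1 \<circ> A0) +
          qs_cost \<alpha> \<beta> M (medium_size n A) \<sigma>2 + qs_cost \<alpha> \<beta> M (large_size n A) \<sigma>3))))"
        by (intro avg_cong) (rule seg2[of "\<lambda>t. avg (perms (large_size n A)) (\<lambda>\<sigma>3. F (toll \<alpha> \<beta> n A +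
              seg_cost \<alpha> \<beta> M 1 (p - 1) (_ \<circ> A0) + t + qs_cost \<alpha> \<beta> M (large_size n A) \<sigma>3))"])
      also have "\<dots> = ?R A"
        by (rule seg1[of "\<lambda>t. avg (perms (medium_size n A)) (\<lambda>\<sigma>2. avg (perms (large_size n A)) (\<lambda>\<sigma>3.
              F (toll \<alpha> \<beta> n A + t + qs_cost \<alpha> \<beta> M (medium_size n A) \<sigma>2 + qs_cost \<alpha> \<beta> M (large_size n A) \<sigma>3)))"])
      finally show ?thesis .
    qed
    \<comment> \<open>By \<open>act\<close> the sum over the class is constant in the relabelling,
      so it may be averaged over all relabellings; exchanging sum and average then gives independent
      subarrays for every single \<open>A\<close>.\<close>
    have "(\<Sum>A\<in>G z. F (qs_cost \<alpha> \<beta> M n A)) =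
        avg S1 (\<lambda>\<rho>1. avg S2 (\<lambda>\<rho>2. avg S3 (\<lambda>\<rho>3. \<Sum>A\<in>G z. F (qs_cost \<alpha> \<beta> M n (\<rho>1 \<circ> \<rho>2 \<circ> \<rho>3 \<circ> A)))))"
    proof -
      have "avg S1 (\<lambda>\<rho>1. avg S2 (\<lambda>\<rho>2. avg S3 (\<lambda>\<rho>3. \<Sum>A\<in>G z. F (qs_cost \<alpha> \<beta> M n (\<rho>1 \<circ> \<rho>2 \<circ> \<rho>3 \<circ> A)))))
        = avg S1 (\<lambda>\<rho>1. avg S2 (\<lambda>\<rho>2. avg S3 (\<lambda>\<rho>3. \<Sum>A\<in>G z. F (qs_cost \<alpha> \<beta> M n A))))"
        by (intro avg_cong act)
      then show ?thesis by (simp add: avg_const ne)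
    qed
    also have "\<dots> = (\<Sum>A\<in>G z. avg S1 (\<lambda>\<rho>1. avg S2 (\<lambda>\<rho>2. avg S3 (\<lambda>\<rho>3. F (qs_cost \<alpha> \<beta> M n (\<rho>1 \<circ> \<rho>2 \<circ> \<rho>3 \<circ> A))))))"
      by (simp only: avg_sum)
    also have "\<dots> = (\<Sum>A\<in>G z. ?R A)"
      by (intro sum.cong refl R)
    finally show ?thesis .
  qed
  then show ?thesis unfolding avg_def[of "perms n"] group by simp
qed

definition mean_cost :: "real \<Rightarrow> real \<Rightarrow> nat \<Rightarrow> nat \<Rightarrow> real" where
  "mean_cost \<alpha> \<beta> M n = avg (perms n) (qs_cost \<alpha> \<beta> M n)"

definition var_cost :: "real \<Rightarrow> real \<Rightarrow> nat \<Rightarrow> nat \<Rightarrow> real" where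
  "var_cost \<alpha> \<beta> M n = variance_on (perms n) (qs_cost \<alpha> \<beta> M n)"

lemma mean_cost_rec:
  assumes "n > M" "M \<ge> 1"
  shows "mean_cost \<alpha> \<beta> M n = avg (perms n) (\<lambda>A. toll \<alpha> \<beta> n A + mean_cost \<alpha> \<beta> M (small_size n A) +
    mean_cost \<alpha> \<beta> M (medium_size n A) + mean_cost \<alpha> \<beta> M (large_size n A))"
proof -
  have "avg (perms a) (\<lambda>\<sigma>1. avg (perms b) (\<lambda>\<sigma>2. avg (perms c) (\<lambda>\<sigma>3. t + qs_cost \<alpha> \<beta> M a \<sigma>1 + qs_cost \<alpha> \<beta> M b \<sigma>2 + qs_cost \<alpha> \<beta> M c \<sigma>3)))
    = t + mean_cost \<alpha> \<beta> M a + mean_cost \<alpha> \<beta> M b + mean_cost \<alpha> \<beta> M c" for a b c t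
    by (simp only: avg_add avg_const finite_perms perms_nonempty mean_cost_def not_False_eq_True)
  then show ?thesis
    using avg_qs_cost_rec[OF assms, of "\<lambda>x. x" \<alpha> \<beta>] by (simp add: mean_cost_def)
qed

text \<open>The recurrence for the squared distance from the overall mean. Conditionally on the
  step, the cost is a constant plus three independent costs, whose variances add; the bias is the
  centred toll.\<close>

lemma var_cost_rec:
  assumes "n > M" "M \<ge> 1"
  shows "var_cost \<alpha> \<beta> M n = avg (perms n) (\<lambda>A.
    (toll \<alpha> \<beta> n A + mean_cost \<alpha> \<beta> M (small_size n A) + mean_cost \<alpha> \<beta> M (medium_size n A) +
      mean_cost \<alpha> \<beta> M (large_size n A) - mean_cost \<alpha> \<beta> M n)\<^sup>2 +
    var_cost \<alpha> \<beta> M (small_size n A) + var_cost \<alpha> \<beta> M (medium_size n A) + var_cost \<alpha> \<beta> M (large_size n A))"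
proof -
  have sq: "avg (perms a) (\<lambda>\<sigma>. (u + qs_cost \<alpha> \<beta> M a \<sigma>)\<^sup>2) = (u + mean_cost \<alpha> \<beta> M a)\<^sup>2 + var_cost \<alpha> \<beta> M a" for u a
    using avg_square_shift[OF finite_perms perms_nonempty] by (simp add: mean_cost_def var_cost_def)
  have sq1: "avg (perms a) (\<lambda>\<sigma>. (u + qs_cost \<alpha> \<beta> M a \<sigma> - m)\<^sup>2) = (u + mean_cost \<alpha> \<beta> M a - m)\<^sup>2 + var_cost \<alpha> \<beta> M a"
    for u m a
    using sq[of a "u - m"] by (simp add: algebra_simps)
  have sq2: "avg (perms a) (\<lambda>\<sigma>. (u + qs_cost \<alpha> \<beta> M a \<sigma> + v - m)\<^sup>2) = (u + mean_cost \<alpha> \<beta> M a + v - m)\<^sup>2 + var_cost \<alpha> \<beta> M a"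
    for u v m a
    using sq[of a "u + v - m"] by (simp add: algebra_simps)
  have sq3: "avg (perms a) (\<lambda>\<sigma>. (u + qs_cost \<alpha> \<beta> M a \<sigma> + v + w - m)\<^sup>2) =
      (u + mean_cost \<alpha> \<beta> M a + v + w - m)\<^sup>2 + var_cost \<alpha> \<beta> M a"
    for u v w m a
    using sq[of a "u + v + w - m"] by (simp add: algebra_simps)
  have "avg (perms a) (\<lambda>\<sigma>1. avg (perms b) (\<lambda>\<sigma>2. avg (perms c) (\<lambda>\<sigma>3.
      (t + qs_cost \<alpha> \<beta> M a \<sigma>1 + qs_cost \<alpha> \<beta> M b \<sigma>2 + qs_cost \<alpha> \<beta> M c \<sigma>3 - m)\<^sup>2)))
    = (t + mean_cost \<alpha> \<beta> M a + mean_cost \<alpha> \<beta> M b + mean_cost \<alpha> \<beta> M c - m)\<^sup>2 +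
      var_cost \<alpha> \<beta> M a + var_cost \<alpha> \<beta> M b + var_cost \<alpha> \<beta> M c" for a b c t m
    by (simp only: sq1 sq2 sq3 avg_add avg_const finite_perms perms_nonempty not_False_eq_True)
  then show ?thesis
    using avg_qs_cost_rec[OF assms, of "\<lambda>x. (x - mean_cost \<alpha> \<beta> M n)\<^sup>2" \<alpha> \<beta>]
    by (simp add: var_cost_def variance_on_def mean_cost_def)
qed

section \<open>The toll of a partitioning step\<close>

text \<open>
  Since the sum over all of \<open>I\<close> vanishes, distinct terms of an exchangeable family are
  negatively correlated; the variance of a partial sum is at most the sum of the variances.
\<close>

lemma exchangeable_sum:
  fixes g :: "'b \<Rightarrow> real" and \<Omega> :: "('a \<Rightarrow> 'b) set"
  assumes fin: "finite \<Omega>" "finite I" and "J \<subseteq> I"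
    and closed: "\<And>\<omega> i j. \<omega> \<in> \<Omega> \<Longrightarrow> i \<in> I \<Longrightarrow> j \<in> I \<Longrightarrow> \<omega> \<circ> Transposition.transpose i j \<in> \<Omega>"
    and zero: "\<And>\<omega>. \<omega> \<in> \<Omega> \<Longrightarrow> (\<Sum>i\<in>I. g (\<omega> i)) = 0"
    and bound: "\<And>v. \<bar>g v\<bar> \<le> 1"
  shows "(\<Sum>\<omega>\<in>\<Omega>. \<Sum>i\<in>J. g (\<omega> i)) = 0"
    and "(\<Sum>\<omega>\<in>\<Omega>. (\<Sum>i\<in>J. g (\<omega> i))\<^sup>2) \<le> real (card J) * real (card \<Omega>)"
proof -
  have reindex: "(\<Sum>\<omega>\<in>\<Omega>. h (\<omega> \<circ> Transposition.transpose i j)) = (\<Sum>\<omega>\<in>\<Omega>. h \<omega>)"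
    if "i \<in> I" "j \<in> I" for i j and h :: "('a \<Rightarrow> 'b) \<Rightarrow> real"
    by (rule sum.reindex_bij_witness[where i = "\<lambda>\<omega>. \<omega> \<circ> Transposition.transpose i j"
          and j = "\<lambda>\<omega>. \<omega> \<circ> Transposition.transpose i j"]) (use closed that in \<open>auto simp: comp_assoc\<close>)
  have finJ: "finite J" using assms finite_subset by blast
  have one: "(\<Sum>\<omega>\<in>\<Omega>. g (\<omega> i)) = 0" if i: "i \<in> I" for i
  proof -
    have same: "(\<Sum>\<omega>\<in>\<Omega>. g (\<omega> j)) = (\<Sum>\<omega>\<in>\<Omega>. g (\<omega> i))" if "j \<in> I" for j
      using reindex[OF that i, of "\<lambda>\<omega>. g (\<omega> i)"] by simp
    have "real (card I) * (\<Sum>\<omega>\<in>\<Omega>. g (\<omega> i)) = (\<Sum>j\<in>I. \<Sum>\<omega>\<in>\<Omega>. g (\<omega> j))"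
      by (simp add: same)
    also have "\<dots> = 0" by (subst sum.swap) (simp add: zero)
    finally show ?thesis using i fin(2) by auto
  qed
  show "(\<Sum>\<omega>\<in>\<Omega>. \<Sum>i\<in>J. g (\<omega> i)) = 0"
    by (subst sum.swap) (use one assms(3) in \<open>simp add: subset_iff\<close>)
  define D where "D i j = (\<Sum>\<omega>\<in>\<Omega>. g (\<omega> i) * g (\<omega> j))" for i j
  have diag: "0 \<le> D i i" "D i i \<le> real (card \<Omega>)" for i
  proof -
    have "g v * g v \<le> 1" for v using bound[of v] by (simp add: abs_square_le_1[symmetric] power2_eq_square[symmetric])
    then show "D i i \<le> real (card \<Omega>)"
      using sum_bounded_above[of \<Omega> "\<lambda>\<omega>. g (\<omega> i) * g (\<omega> i)" 1] by (simp add: D_def)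
  qed (simp add: D_def sum_nonneg)
  \<comment> \<open>By exchangeability a row of \<open>D\<close> has one diagonal value and equal
    off-diagonal values, and it sums to 0; so the latter have the sign opposite to
    \<open>D i i\<close>.\<close>
  have off: "D i j \<le> 0" if ij: "i \<in> I" "j \<in> I" "i \<noteq> j" for i j
  proof -
    have same: "D i k = D i j" if "k \<in> I - {i}" for k
      using reindex[of k j "\<lambda>\<omega>. g (\<omega> i) * g (\<omega> j)"] that ij by (auto simp: D_def Transposition.transpose_def)
    have "(\<Sum>k\<in>I. D i k) = (\<Sum>\<omega>\<in>\<Omega>. g (\<omega> i) * (\<Sum>k\<in>I. g (\<omega> k)))"
      unfolding D_def sum_distrib_left by (rule sum.swap)
    also have "\<dots> = 0" by (simp add: zero)
    finally have "(\<Sum>k\<in>I. D i k) = 0" .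
    moreover have "(\<Sum>k\<in>I. D i k) = D i i + (\<Sum>k\<in>I - {i}. D i k)"
      by (rule sum.remove) (use ij fin in auto)
    moreover have "(\<Sum>k\<in>I - {i}. D i k) = (\<Sum>k\<in>I - {i}. D i j)"
      by (rule sum.cong[OF refl same])
    ultimately have "D i i + real (card (I - {i})) * D i j = 0"
      by simp
    moreover have "card (I - {i}) > 0"
      unfolding card_gt_0_iff using ij fin(2) by (intro conjI finite_Diff) (blast, assumption)
    moreover from calculation have "real (card (I - {i})) * D i j \<le> 0" using diag(1)[of i] by linarith
    ultimately show ?thesis by (simp add: mult_le_0_iff)
  qed
  have "(\<Sum>\<omega>\<in>\<Omega>. (\<Sum>i\<in>J. g (\<omega> i))\<^sup>2) = (\<Sum>i\<in>J. \<Sum>j\<in>J. D i j)"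
  proof -
    have "(\<Sum>\<omega>\<in>\<Omega>. (\<Sum>i\<in>J. g (\<omega> i))\<^sup>2) = (\<Sum>\<omega>\<in>\<Omega>. \<Sum>i\<in>J. \<Sum>j\<in>J. g (\<omega> i) * g (\<omega> j))"
      by (simp add: power2_eq_square sum_product)
    also have "\<dots> = (\<Sum>i\<in>J. \<Sum>\<omega>\<in>\<Omega>. \<Sum>j\<in>J. g (\<omega> i) * g (\<omega> j))"
      by (rule sum.swap)
    also have "\<dots> = (\<Sum>i\<in>J. \<Sum>j\<in>J. D i j)"
      unfolding D_def by (intro sum.cong refl sum.swap)
    finally show ?thesis .
  qed
  also have "\<dots> \<le> (\<Sum>i\<in>J. D i i)"
  proof (rule sum_mono)
    fix i assume i: "i \<in> J"
    have "(\<Sum>j\<in>J. D i j) = D i i + (\<Sum>j\<in>J - {i}. D i j)"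
      using i finJ by (rule sum.remove[rotated])
    also have "(\<Sum>j\<in>J - {i}. D i j) \<le> 0"
      using off i assms(3) by (intro sum_nonpos) auto
    finally show "(\<Sum>j\<in>J. D i j) \<le> D i i" by simp
  qed
  also have "\<dots> \<le> real (card J) * real (card \<Omega>)"
    using sum_bounded_above[of J "\<lambda>i. D i i" "real (card \<Omega>)"] diag(2) by simp
  finally show "(\<Sum>\<omega>\<in>\<Omega>. (\<Sum>i\<in>J. g (\<omega> i))\<^sup>2) \<le> real (card J) * real (card \<Omega>)" .
qed

section \<open>Distribution of the subproblem sizes\<close>

definition pivot_class :: "nat \<Rightarrow> int \<times> int \<Rightarrow> (int \<Rightarrow> int) set" where
  "pivot_class n z = {A \<in> perms n. (A 1, A (int n)) = z}"

definition pivot_pairs :: "nat \<Rightarrow> (int \<times> int) set" where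
  "pivot_pairs n = {(x, y). x \<in> {1..int n} \<and> y \<in> {1..int n} \<and> x \<noteq> y}"

lemma finite_pivot_pairs: "finite (pivot_pairs n)"
  by (rule finite_subset[of _ "{1..int n} \<times> {1..int n}"]) (auto simp: pivot_pairs_def)

lemma finite_pivot_class: "finite (pivot_class n z)"
  by (simp add: pivot_class_def finite_perms)

lemma sum_perms_pivots:
  assumes "n \<ge> 2"
  shows "(\<Sum>A\<in>perms n. f A) = (\<Sum>z\<in>pivot_pairs n. \<Sum>A\<in>pivot_class n z. (f A :: real))"
  unfolding pivot_class_def
proof (rule sum.group[symmetric])
  show "(\<lambda>A. (A 1, A (int n))) ` perms n \<subseteq> pivot_pairs n"
  proof
    fix z assume "z \<in> (\<lambda>A. (A 1, A (int n))) ` perms n"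
    then obtain A where A: "A permutes {1..int n}" and z: "z = (A 1, A (int n))" by auto
    have "A 1 \<in> {1..int n}" "A (int n) \<in> {1..int n}" "A 1 \<noteq> A (int n)"
      using permutes_in_image[OF A, of 1] permutes_in_image[OF A, of "int n"]
        injD[OF permutes_inj[OF A], of 1 "int n"] assms by auto
    then show "z \<in> pivot_pairs n" by (auto simp: z pivot_pairs_def)
  qed
qed (simp_all add: finite_perms finite_pivot_pairs)

text \<open>Composition on the left with a permutation of the values that carries one pair of end
  keys to the other.\<close>

lemma card_pivot_class_eq:
  assumes "(x, y) \<in> pivot_pairs n" "(x', y') \<in> pivot_pairs n"
  shows "card (pivot_class n (x, y)) = card (pivot_class n (x', y'))"
proof -
  \<comment> \<open>\<open>t\<close> carries \<open>x\<close> to \<open>x'\<close>; the second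
    transposition then carries the image of \<open>y\<close> to \<open>y'\<close> and leaves
    \<open>x'\<close> alone, as \<open>x'\<close> differs from both.\<close>
  define t where "t = Transposition.transpose x x'"
  define \<rho> where "\<rho> = Transposition.transpose (t y) y' \<circ> t"
  have in_range: "x \<in> {1..int n}" "y \<in> {1..int n}" "x' \<in> {1..int n}" "y' \<in> {1..int n}" "x \<noteq> y" "x' \<noteq> y'"
    using assms by (auto simp: pivot_pairs_def)
  have ty: "t y \<in> {1..int n}" "t y \<noteq> x'" using in_range by (auto simp: t_def Transposition.transpose_def)
  have perm: "\<rho> permutes {1..int n}"
    unfolding \<rho>_def t_def using in_range ty by (intro permutes_compose permutes_swap_id) (auto simp: t_def)
  have im: "\<rho> x = x'" "\<rho> y = y'"
    using in_range ty by (auto simp: \<rho>_def t_def Transposition.transpose_def)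
  then have inv: "inv \<rho> x' = x" "inv \<rho> y' = y"
    using permutes_inverses(2)[OF perm] by metis+
  have "bij_betw (\<lambda>A. \<rho> \<circ> A) (pivot_class n (x, y)) (pivot_class n (x', y'))"
    by (rule bij_betw_byWitness[where f' = "\<lambda>A. inv \<rho> \<circ> A"])
       (use im inv in \<open>auto simp: pivot_class_def permutes_inv_o[OF perm] comp_assoc[symmetric]
         intro: permutes_compose perm permutes_inv\<close>)
  then show ?thesis by (rule bij_betw_same_card)
qed

definition lattice :: "nat \<Rightarrow> (nat \<times> nat \<times> nat) set" where
  "lattice N = {(a, b, c). a + b + c = N}"

lemma lattice_eq: "lattice N = (\<lambda>(a, b). (a, b, N - a - b)) ` (SIGMA a:{..N}. {..N - a})"
proof (intro set_eqI iffI)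
  fix z assume "z \<in> lattice N"
  then obtain a b c where "z = (a, b, c)" "a + b + c = N" by (auto simp: lattice_def)
  then show "z \<in> (\<lambda>(a, b). (a, b, N - a - b)) ` (SIGMA a:{..N}. {..N - a})"
    by (intro image_eqI[of _ _ "(a, b)"]) auto
qed (auto simp: lattice_def)

lemma finite_lattice: "finite (lattice N)" and lattice_nonempty: "lattice N \<noteq> {}"
  by (auto simp: lattice_eq)

lemma sum_lattice: "(\<Sum>z\<in>lattice N. f z) = (\<Sum>a\<le>N. \<Sum>b\<le>N - a. f (a, b, N - a - b))"
proof -
  have "inj_on (\<lambda>(a, b). (a, b, N - a - b)) (SIGMA a:{..N}. {..N - a})"
    by (auto simp: inj_on_def)
  then show ?thesis
    unfolding lattice_eq by (subst sum.reindex) (simp_all add: sum.Sigma comp_def split_def)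
qed

text \<open>A triple of sizes determines the pivots, hence exactly two ordered pairs of end keys,
  and all such pairs are equally frequent. So the sizes are uniform on the lattice; the common class
  size \<open>k\<close> cancels in the average.\<close>

lemma avg_perms_lattice:
  assumes n: "n \<ge> 2"
  shows "avg (perms n) (\<lambda>A. h (small_size n A, medium_size n A, large_size n A)) = avg (lattice (n - 2)) h"
proof -
  define sz where "sz z = (case z of (x, y) \<Rightarrow> (nat (min x y - 1), nat (max x y - min x y - 1), nat (int n - max x y)))" for z
  define k where "k = card (pivot_class n (1, 2))"
  have "(1, 2) \<in> pivot_pairs n" using n by (auto simp: pivot_pairs_def)
  then have k: "card (pivot_class n z) = k" if "z \<in> pivot_pairs n" for z
    using card_pivot_class_eq[of "fst z" "snd z" n 1 2] that by (simp add: k_def)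
  have gen: "(\<Sum>A\<in>perms n. f (small_size n A, medium_size n A, large_size n A)) =
      real (2 * k) * (\<Sum>z\<in>lattice (n - 2). f z)" for f :: "_ \<Rightarrow> real"
  proof -
    have "(\<Sum>A\<in>perms n. f (small_size n A, medium_size n A, large_size n A)) =
        (\<Sum>z\<in>pivot_pairs n. \<Sum>A\<in>pivot_class n z. f (sz z))"
      unfolding sum_perms_pivots[OF n]
      by (intro sum.cong refl) (auto simp: pivot_class_def sz_def small_size_def medium_size_def large_size_def)
    also have "\<dots> = real k * (\<Sum>z\<in>pivot_pairs n. f (sz z))"
      by (simp add: k sum_distrib_left)
    also have "(\<Sum>z\<in>pivot_pairs n. f (sz z)) = (\<Sum>z\<in>{z \<in> pivot_pairs n. fst z < snd z} \<union> {z \<in> pivot_pairs n. snd z < fst z}. f (sz z))"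
      by (rule sum.cong) (auto simp: pivot_pairs_def)
    also have "\<dots> = (\<Sum>z | z \<in> pivot_pairs n \<and> fst z < snd z. f (sz z)) +
        (\<Sum>z | z \<in> pivot_pairs n \<and> snd z < fst z. f (sz z))"
      by (rule sum.union_disjoint) (use finite_pivot_pairs in auto)
    also have "(\<Sum>z | z \<in> pivot_pairs n \<and> snd z < fst z. f (sz z)) =
        (\<Sum>z | z \<in> pivot_pairs n \<and> fst z < snd z. f (sz z))"
      by (rule sum.reindex_bij_witness[where i = prod.swap and j = prod.swap])
         (auto simp: pivot_pairs_def sz_def min.commute max.commute)
    also have "(\<Sum>z | z \<in> pivot_pairs n \<and> fst z < snd z. f (sz z)) = (\<Sum>z\<in>lattice (n - 2). f z)"
    proof (rule sum.reindex_bij_witness[where j = sz and i = "\<lambda>(a, b, c). (int a + 1, int a + int b + 2)"])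
      fix z assume "z \<in> {z. z \<in> pivot_pairs n \<and> fst z < snd z}"
      then obtain x y where z: "z = (x, y)" "1 \<le> x" "x < y" "y \<le> int n" by (auto simp: pivot_pairs_def)
      then have s: "sz (x, y) = (nat (x - 1), nat (y - x - 1), nat (int n - y))" by (simp add: sz_def)
      show "(case sz z of (a, b, c) \<Rightarrow> (int a + 1, int a + int b + 2)) = z" using z by (simp add: s)
      show "sz z \<in> lattice (n - 2)" unfolding z(1) s lattice_def using z by auto
    next
      fix z assume "z \<in> lattice (n - 2)"
      then obtain a b c where z: "z = (a, b, c)" and abc: "int a + int b + int c + 2 = int n"
        using n by (auto simp: lattice_def)
      show "sz (case z of (a, b, c) \<Rightarrow> (int a + 1, int a + int b + 2)) = z"
        using abc by (simp add: z sz_def)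
      show "(case z of (a, b, c) \<Rightarrow> (int a + 1, int a + int b + 2)) \<in> {z. z \<in> pivot_pairs n \<and> fst z < snd z}"
        using abc by (simp add: z pivot_pairs_def)
    qed simp
    finally show ?thesis by simp
  qed
  from gen[of "\<lambda>_. 1"] have card: "real (card (perms n)) = real (2 * k) * real (card (lattice (n - 2)))"
    by simp
  moreover have "card (perms n) > 0" unfolding card_gt_0_iff using finite_perms perms_nonempty by blast
  ultimately have "k \<noteq> 0" by (intro notI) simp
  then show ?thesis
    using gen[of h] card by (simp add: avg_def)
qed

lemma size_sum:
  assumes "A permutes {1..int n}" "n \<ge> 2"
  shows "small_size n A + medium_size n A + large_size n A = n - 2"
proof -
  have "nat (p - 1) + nat (q - p - 1) + nat (int n - q) = n - 2" if "1 \<le> p" "p < q" "q \<le> int n" for p q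
    using that by auto
  from this[OF pivots_bounds[OF assms]] show ?thesis
    by (simp only: small_size_def medium_size_def large_size_def)
qed

text \<open>By \<open>partition_loop_cost\<close>, \<open>{2..1 + K}\<close> with \<open>K\<close>
  the number of small and medium keys besides the pivots is the range whose contents determine the
  cost. Given the pivots, the count is hypergeometric.\<close>

definition small_count :: "nat \<Rightarrow> (int \<Rightarrow> int) \<Rightarrow> nat" where
  "small_count n A = card {i\<in>{2..1 + int (small_size n A + medium_size n A)}. A i < small_pivot n A}"

definition large_count :: "nat \<Rightarrow> (int \<Rightarrow> int) \<Rightarrow> nat" where
  "large_count n A = card {i\<in>{2..1 + int (small_size n A + medium_size n A)}. A i > large_pivot n A}"

lemma card_inner_values:
  assumes A: "A permutes {1..int n}" and n: "n \<ge> 2"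
  shows "card {i\<in>{2..int n - 1}. P (A i)} = card {v\<in>{1..int n}. v \<noteq> small_pivot n A \<and> v \<noteq> large_pivot n A \<and> P v}"
proof (rule bij_betw_same_card)
  have inj: "A i = A j \<longleftrightarrow> i = j" for i j using permutes_inj[OF A] by (auto simp: inj_def)
  have piv: "v \<noteq> small_pivot n A \<and> v \<noteq> large_pivot n A \<and> P v \<longleftrightarrow> v \<noteq> A 1 \<and> v \<noteq> A (int n) \<and> P v" for v
    by (auto simp: min_def max_def)
  have "A ` {i\<in>{2..int n - 1}. P (A i)} = {v\<in>{1..int n}. v \<noteq> A 1 \<and> v \<noteq> A (int n) \<and> P v}"
  proof (intro set_eqI iffI)
    fix v assume "v \<in> A ` {i\<in>{2..int n - 1}. P (A i)}"
    then obtain i where i: "i \<in> {2..int n - 1}" "P (A i)" "v = A i" by auto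
    then show "v \<in> {v\<in>{1..int n}. v \<noteq> A 1 \<and> v \<noteq> A (int n) \<and> P v}"
      using permutes_in_image[OF A, of i] inj by auto
  next
    fix v assume v: "v \<in> {v\<in>{1..int n}. v \<noteq> A 1 \<and> v \<noteq> A (int n) \<and> P v}"
    then obtain i where i: "i \<in> {1..int n}" "A i = v" using permutes_image[OF A] by (metis (no_types, lifting) imageE mem_Collect_eq)
    then have "i \<noteq> 1" "i \<noteq> int n" using v by auto
    then show "v \<in> A ` {i\<in>{2..int n - 1}. P (A i)}" using i v by (intro image_eqI[of _ _ i]) auto
  qed
  then show "bij_betw A {i\<in>{2..int n - 1}. P (A i)}
      {v\<in>{1..int n}. v \<noteq> small_pivot n A \<and> v \<noteq> large_pivot n A \<and> P v}"
    using inj by (simp only: bij_betw_def inj_on_def piv simp_thms) auto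
qed

lemma card_inner:
  assumes A: "A permutes {1..int n}" and n: "n \<ge> 2"
  shows "card {i\<in>{2..int n - 1}. A i < small_pivot n A} = small_size n A"
    "card {i\<in>{2..int n - 1}. A i < large_pivot n A} = small_size n A + medium_size n A"
    "card {i\<in>{2..int n - 1}. A i > large_pivot n A} = large_size n A"
proof -
  define p q where "p = small_pivot n A" and "q = large_pivot n A"
  have pq: "1 \<le> p" "p < q" "q \<le> int n" using pivots_bounds[OF A n] by (simp_all add: p_def q_def)
  have "{v\<in>{1..int n}. v \<noteq> p \<and> v \<noteq> q \<and> v < p} = {1..p - 1}"
    "{v\<in>{1..int n}. v \<noteq> p \<and> v \<noteq> q \<and> v < q} = {1..q - 1} - {p}"
    "{v\<in>{1..int n}. v \<noteq> p \<and> v \<noteq> q \<and> v > q} = {q + 1..int n}"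
    using pq by auto
  then show "card {i\<in>{2..int n - 1}. A i < small_pivot n A} = small_size n A"
    "card {i\<in>{2..int n - 1}. A i < large_pivot n A} = small_size n A + medium_size n A"
    "card {i\<in>{2..int n - 1}. A i > large_pivot n A} = large_size n A"
    unfolding p_def[symmetric] q_def[symmetric]
    using pq card_inner_values[OF A n, of "\<lambda>v. v < p"] card_inner_values[OF A n, of "\<lambda>v. v < q"]
      card_inner_values[OF A n, of "\<lambda>v. v > q"] unfolding p_def[symmetric] q_def[symmetric]
    by (simp_all add: small_size_def medium_size_def large_size_def p_def[symmetric] q_def[symmetric] card_Diff_singleton)
qed

text \<open>The term \<open>n - 1\<close> collects the comparison of the two end keys and one test
  per inner position. Among the \<open>K\<close> counted positions, keys at least \<open>p\<close>
  are the complement of the small ones.\<close>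

lemma toll_eq:
  assumes A: "A permutes {1..int n}" and n: "n \<ge> 2"
  shows "\<exists>e\<in>{0..1}. toll \<alpha> \<beta> n A =
    \<alpha> * (real n - 1 + real (small_size n A + medium_size n A) - real (small_count n A) + real (large_count n A) + 3 * e) +
    \<beta> * (2 + real (small_size n A) + real (large_count n A) + e)"
proof -
  obtain A0 l g c s where step: "partition_step A 1 (int n) = (A0, l, g, c, s)" by (metis prod_cases5)
  define K where "K = small_size n A + medium_size n A"
  define J where "J = {2..1 + int K}"
  have inj: "inj_on A {1..int n}" using permutes_inj_on[OF A] .
  have cost: "\<exists>e\<le>1. c = 1 + nat (int n - 1 - 1) + card {i\<in>J. A i \<ge> small_pivot n A} + large_count n A + 3 * e \<and>
    s = 2 + small_size n A + large_count n A + e"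
    using partition_step_cost[OF step _ inj] n card_inner[OF A n]
    by (simp add: K_def J_def large_count_def)
  then obtain e :: nat where e: "e \<le> 1" "c = 1 + nat (int n - 1 - 1) + card {i\<in>J. A i \<ge> small_pivot n A} + large_count n A + 3 * e"
    "s = 2 + small_size n A + large_count n A + e" by blast
  have "card {i\<in>J. A i \<ge> small_pivot n A} + small_count n A = card ({i\<in>J. A i \<ge> small_pivot n A} \<union> {i\<in>J. A i < small_pivot n A})"
    unfolding small_count_def K_def[symmetric] J_def[symmetric]
    by (rule card_Un_disjoint[symmetric]) (auto intro: finite_subset[of _ J] simp: J_def)
  also have "{i\<in>J. A i \<ge> small_pivot n A} \<union> {i\<in>J. A i < small_pivot n A} = J" by auto
  finally have "card {i\<in>J. A i \<ge> small_pivot n A} + small_count n A = K" by (simp add: J_def)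
  then have "real (card {i\<in>J. A i \<ge> small_pivot n A}) = real K - real (small_count n A)" by linarith
  moreover have "real (nat (int n - 1 - 1)) = real n - 2" using n by simp
  ultimately have c: "real c = real n - 1 + real K - real (small_count n A) + real (large_count n A) + 3 * real e"
    using e(2) by simp
  have s: "real s = 2 + real (small_size n A) + real (large_count n A) + real e"
    using e(3) by simp
  have "toll \<alpha> \<beta> n A = \<alpha> * real c + \<beta> * real s"
    by (simp add: toll_def step)
  then show ?thesis
    unfolding c s K_def using e(1) by (intro bexI[of _ "real e"]) auto
qed

text \<open>The conditional expectation of the toll given the sizes, without the bounded term
  \<open>e\<close>: in \<open>toll_eq\<close> the two counts are replaced by their hypergeometric
  means. Here \<open>n = a + b + c + 2\<close>.\<close>

definition mean_toll :: "real \<Rightarrow> real \<Rightarrow> nat \<times> nat \<times> nat \<Rightarrow> real" where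
  "mean_toll \<alpha> \<beta> = (\<lambda>(a, b, c).
    \<alpha> * (real (a + b + c) + 1 + real (a + b) - real a * real (a + b) / real (a + b + c) +
      real c * real (a + b) / real (a + b + c)) +
    \<beta> * (2 + real a + real c * real (a + b) / real (a + b + c)))"

lemma inner_closed:
  assumes "A \<in> pivot_class n z" "i \<in> {2..int n - 1}" "j \<in> {2..int n - 1}"
  shows "A \<circ> Transposition.transpose i j \<in> pivot_class n z"
  using assms permutes_compose[OF permutes_swap_id[of i "{1..int n}" j], of A]
  by (auto simp: pivot_class_def Transposition.transpose_def)

text \<open>Subtracting \<open>m / (n - 2)\<close> from the indicator of \<open>P\<close> makes the
  terms sum to 0 over all inner positions, so \<open>exchangeable_sum\<close> applies. Its crude
  second-moment bound is linear in \<open>n\<close>, which is all that the scale \<open>n^2\<close>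
  requires.\<close>

lemma count_moments:
  assumes z: "z \<in> pivot_pairs n" and n: "n \<ge> 3"
    and cnt: "\<And>A. A \<in> pivot_class n z \<Longrightarrow> card {i\<in>{2..int n - 1}. P (A i)} = m"
    and K: "int K \<le> int n - 2"
  shows "(\<Sum>A\<in>pivot_class n z. real (card {i\<in>{2..1 + int K}. P (A i)}) - real m * real K / real (n - 2)) = 0"
    "(\<Sum>A\<in>pivot_class n z. (real (card {i\<in>{2..1 + int K}. P (A i)}) - real m * real K / real (n - 2))\<^sup>2) \<le>
      real n * real (card (pivot_class n z))"
proof -
  define g where "g v = of_bool (P v) - real m / real (n - 2)" for v
  have J: "{2..1 + int K} \<subseteq> {2..int n - 1}" using K by auto
  have sum_g: "(\<Sum>i\<in>{2..1 + int k}. g (A i)) = real (card {i\<in>{2..1 + int k}. P (A i)}) - real m * real k / real (n - 2)"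
    for A k
    by (simp add: g_def sum_subtractf sum_of_bool_eq Int_def)
  have n': "1 + int (n - 2) = int n - 1" using n by auto
  have zero: "(\<Sum>i\<in>{2..int n - 1}. g (A i)) = 0" if "A \<in> pivot_class n z" for A
    using sum_g[of A "n - 2"] cnt[OF that] n unfolding n' by simp
  \<comment> \<open>The inequality \<open>m \<le> n - 2\<close> is read off a member of the class,
    so an empty class is treated apart below.\<close>
  have bound: "\<bar>g v\<bar> \<le> 1" if "pivot_class n z \<noteq> {}" for v
  proof -
    from that obtain A where A: "A \<in> pivot_class n z" by auto
    have "card {i\<in>{2..int n - 1}. P (A i)} \<le> card {2..int n - 1}"
      by (rule card_mono) auto
    then have "m \<le> n - 2" using cnt[OF A] by simp
    then have "real m / real (n - 2) \<le> 1" "0 \<le> real m / real (n - 2)" using n by auto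
    then show ?thesis by (auto simp: g_def)
  qed
  let ?d = "\<lambda>A. real (card {i\<in>{2..1 + int K}. P (A i)}) - real m * real K / real (n - 2)"
  have ex: "(\<Sum>A\<in>pivot_class n z. ?d A) = 0"
    "(\<Sum>A\<in>pivot_class n z. (?d A)\<^sup>2) \<le> real K * real (card (pivot_class n z))"
    if ne: "pivot_class n z \<noteq> {}"
    using exchangeable_sum[of "pivot_class n z" "{2..int n - 1}", OF finite_pivot_class _ J inner_closed zero bound[OF ne]]
    by (simp_all add: sum_g)
  show "(\<Sum>A\<in>pivot_class n z. ?d A) = 0"
    using ex(1) by (cases "pivot_class n z = {}") auto
  have "(\<Sum>A\<in>pivot_class n z. (?d A)\<^sup>2) \<le> real K * real (card (pivot_class n z))"
    using ex(2) by (cases "pivot_class n z = {}") auto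
  also have "\<dots> \<le> real n * real (card (pivot_class n z))"
    using K by (intro mult_right_mono) auto
  finally show "(\<Sum>A\<in>pivot_class n z. (?d A)\<^sup>2) \<le> real n * real (card (pivot_class n z))" .
qed

definition sizes :: "nat \<Rightarrow> (int \<Rightarrow> int) \<Rightarrow> nat \<times> nat \<times> nat" where
  "sizes n A = (small_size n A, medium_size n A, large_size n A)"

lemma avg_perms_sizes: "n \<ge> 2 \<Longrightarrow> avg (perms n) (\<lambda>A. h (sizes n A)) = avg (lattice (n - 2)) h"
  unfolding sizes_def by (rule avg_perms_lattice)

definition small_dev :: "nat \<Rightarrow> (int \<Rightarrow> int) \<Rightarrow> real" where
  "small_dev n A = real (small_count n A) -
    real (small_size n A) * real (small_size n A + medium_size n A) / real (n - 2)"

definition large_dev :: "nat \<Rightarrow> (int \<Rightarrow> int) \<Rightarrow> real" where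
  "large_dev n A = real (large_count n A) -
    real (large_size n A) * real (small_size n A + medium_size n A) / real (n - 2)"

lemma avg_perms_from_classes:
  assumes n: "n \<ge> 2" and le: "\<And>z. z \<in> pivot_pairs n \<Longrightarrow> (\<Sum>A\<in>pivot_class n z. f A) \<le> k * real (card (pivot_class n z))"
  shows "avg (perms n) f \<le> k"
proof -
  have "(\<Sum>A\<in>perms n. f A) \<le> (\<Sum>z\<in>pivot_pairs n. k * real (card (pivot_class n z)))"
    unfolding sum_perms_pivots[OF n] by (rule sum_mono[OF le])
  also have "\<dots> = k * real (card (perms n))"
    using sum_perms_pivots[OF n, of "\<lambda>_. 1"] by (simp add: sum_distrib_left[symmetric])
  finally have "(\<Sum>A\<in>perms n. f A) \<le> k * real (card (perms n))" .
  moreover have "card (perms n) > 0" unfolding card_gt_0_iff using finite_perms perms_nonempty by blast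
  ultimately show ?thesis by (simp add: avg_def divide_le_eq)
qed

text \<open>The deviations are centred within each pivot class and of order \<open>sqrt n\<close> in
  mean square: the first fact serves the mean cost, the second makes them negligible in the
  variance.\<close>

lemma dev_moments:
  assumes n: "n \<ge> 3"
  shows "avg (perms n) (small_dev n) = 0" "avg (perms n) (\<lambda>A. (small_dev n A)\<^sup>2) \<le> real n"
    "avg (perms n) (large_dev n) = 0" "avg (perms n) (\<lambda>A. (large_dev n A)\<^sup>2) \<le> real n"
proof -
  have n2: "n \<ge> 2" using n by simp
  have cls: "(\<Sum>A\<in>pivot_class n z. small_dev n A) = 0"
      "(\<Sum>A\<in>pivot_class n z. (small_dev n A)\<^sup>2) \<le> real n * real (card (pivot_class n z))"
      "(\<Sum>A\<in>pivot_class n z. large_dev n A) = 0"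
      "(\<Sum>A\<in>pivot_class n z. (large_dev n A)\<^sup>2) \<le> real n * real (card (pivot_class n z))"
    if z: "z \<in> pivot_pairs n" for z
  proof -
    define p q where "p = min (fst z) (snd z)" and "q = max (fst z) (snd z)"
    define a b c where "a = nat (p - 1)" and "b = nat (q - p - 1)" and "c = nat (int n - q)"
    have A: "A permutes {1..int n}" "small_pivot n A = p" "large_pivot n A = q"
      "small_size n A = a" "medium_size n A = b" "large_size n A = c" if "A \<in> pivot_class n z" for A
      using that by (auto simp: pivot_class_def p_def q_def a_def b_def c_def small_size_def medium_size_def large_size_def)
    have pq: "1 \<le> p" "p < q" "q \<le> int n" using z by (auto simp: pivot_pairs_def p_def q_def)
    have K: "int (a + b) \<le> int n - 2" using pq by (simp add: a_def b_def)
    have sd: "small_dev n A = real (card {i\<in>{2..1 + int (a + b)}. A i < p}) - real a * real (a + b) / real (n - 2)"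
      "large_dev n A = real (card {i\<in>{2..1 + int (a + b)}. A i > q}) - real c * real (a + b) / real (n - 2)"
      if "A \<in> pivot_class n z" for A
      using A[OF that] by (simp_all only: small_dev_def large_dev_def small_count_def large_count_def)
    have c1: "card {i\<in>{2..int n - 1}. A i < p} = a" "card {i\<in>{2..int n - 1}. A i > q} = c"
      if "A \<in> pivot_class n z" for A
      using card_inner(1,3)[OF A(1)[OF that] n2] by (simp_all only: A[OF that])
    show "(\<Sum>A\<in>pivot_class n z. small_dev n A) = 0"
      "(\<Sum>A\<in>pivot_class n z. (small_dev n A)\<^sup>2) \<le> real n * real (card (pivot_class n z))"
      "(\<Sum>A\<in>pivot_class n z. large_dev n A) = 0"
      "(\<Sum>A\<in>pivot_class n z. (large_dev n A)\<^sup>2) \<le> real n * real (card (pivot_class n z))"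
      using count_moments[OF z n c1(1) K] count_moments[OF z n c1(2) K]
      by (simp_all only: sd cong: sum.cong)
  qed
  show "avg (perms n) (small_dev n) = 0" "avg (perms n) (large_dev n) = 0"
    unfolding avg_def sum_perms_pivots[OF n2] by (simp_all add: cls)
  show "avg (perms n) (\<lambda>A. (small_dev n A)\<^sup>2) \<le> real n" "avg (perms n) (\<lambda>A. (large_dev n A)\<^sup>2) \<le> real n"
    by (rule avg_perms_from_classes[OF n2 cls(2)] avg_perms_from_classes[OF n2 cls(4)], assumption)+
qed

lemma toll_decomp:
  assumes A: "A \<in> perms n" and n: "n \<ge> 3"
  shows "\<exists>e\<in>{0..1}. toll \<alpha> \<beta> n A - mean_toll \<alpha> \<beta> (sizes n A) =
    - \<alpha> * small_dev n A + (\<alpha> + \<beta>) * large_dev n A + (3 * \<alpha> + \<beta>) * e"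
proof -
  have n2: "n \<ge> 2" and A': "A permutes {1..int n}" using n A by auto
  have s: "small_size n A + medium_size n A + large_size n A = n - 2" using size_sum[OF A' n2] .
  obtain e where e: "e \<in> {0..1}" "toll \<alpha> \<beta> n A =
    \<alpha> * (real n - 1 + real (small_size n A + medium_size n A) - real (small_count n A) + real (large_count n A) + 3 * e) +
    \<beta> * (2 + real (small_size n A) + real (large_count n A) + e)"
    using toll_eq[OF A' n2] by blast
  have r: "real (n - 2) = real n - 2" using n by simp
  show ?thesis
    unfolding e(2) mean_toll_def sizes_def prod.case s small_dev_def large_dev_def r
    using e(1) by (intro bexI[of _ e]) (simp_all add: algebra_simps add_divide_distrib)
qed

text \<open>The two deviations average to 0, so only the term with \<open>e\<close> remains, and
  \<open>e\<close> lies between 0 and 1.\<close>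

lemma toll_mean:
  assumes n: "n \<ge> 3"
  shows "\<bar>avg (perms n) (toll \<alpha> \<beta> n) - avg (lattice (n - 2)) (mean_toll \<alpha> \<beta>)\<bar> \<le> \<bar>3 * \<alpha> + \<beta>\<bar>"
proof -
  let ?g = "\<lambda>A. - \<alpha> * small_dev n A + (\<alpha> + \<beta>) * large_dev n A"
  have g: "avg (perms n) ?g = 0"
    by (simp only: avg_add avg_cmult dev_moments[OF n])
  have dev: "\<bar>toll \<alpha> \<beta> n A - mean_toll \<alpha> \<beta> (sizes n A) - ?g A\<bar> \<le> \<bar>3 * \<alpha> + \<beta>\<bar>" if A: "A \<in> perms n" for A
  proof -
    obtain e where "e \<in> {0..1}" "toll \<alpha> \<beta> n A - mean_toll \<alpha> \<beta> (sizes n A) - ?g A = (3 * \<alpha> + \<beta>) * e"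
      using toll_decomp[OF A n, of \<alpha> \<beta>] by auto
    then show ?thesis by (simp add: abs_mult mult_left_le)
  qed
  have "avg (perms n) (toll \<alpha> \<beta> n) - avg (lattice (n - 2)) (mean_toll \<alpha> \<beta>) =
      avg (perms n) (\<lambda>A. toll \<alpha> \<beta> n A - mean_toll \<alpha> \<beta> (sizes n A) - ?g A)"
    unfolding avg_diff g using n by (simp add: avg_perms_sizes)
  moreover have "avg (perms n) (\<lambda>A. toll \<alpha> \<beta> n A - mean_toll \<alpha> \<beta> (sizes n A) - ?g A) \<le> avg (perms n) (\<lambda>_. \<bar>3 * \<alpha> + \<beta>\<bar>)"
    "avg (perms n) (\<lambda>_. - \<bar>3 * \<alpha> + \<beta>\<bar>) \<le> avg (perms n) (\<lambda>A. toll \<alpha> \<beta> n A - mean_toll \<alpha> \<beta> (sizes n A) - ?g A)"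
    using dev by (intro avg_mono; force simp: abs_le_iff)+
  ultimately show ?thesis
    by (simp add: avg_const[OF finite_perms perms_nonempty] abs_le_iff)
qed

lemma toll_variance:
  assumes n: "n \<ge> 3"
  shows "avg (perms n) (\<lambda>A. (toll \<alpha> \<beta> n A - mean_toll \<alpha> \<beta> (sizes n A))\<^sup>2) \<le>
    3 * (\<alpha>\<^sup>2 + (\<alpha> + \<beta>)\<^sup>2 + (3 * \<alpha> + \<beta>)\<^sup>2) * real n"
proof -
  have three: "(x + y + z)\<^sup>2 \<le> 3 * (x\<^sup>2 + y\<^sup>2 + z\<^sup>2)" for x y z :: real
    using sum_squares_ge_zero[of "x - y" "y - z"] zero_le_power2[of "x - z"]
    by (simp add: power2_eq_square algebra_simps)
  have "(toll \<alpha> \<beta> n A - mean_toll \<alpha> \<beta> (sizes n A))\<^sup>2 \<le>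
      3 * (\<alpha>\<^sup>2 * (small_dev n A)\<^sup>2 + (\<alpha> + \<beta>)\<^sup>2 * (large_dev n A)\<^sup>2 + (3 * \<alpha> + \<beta>)\<^sup>2)" if A: "A \<in> perms n" for A
  proof -
    obtain e where e: "e \<in> {0..1}" "toll \<alpha> \<beta> n A - mean_toll \<alpha> \<beta> (sizes n A) =
      - \<alpha> * small_dev n A + (\<alpha> + \<beta>) * large_dev n A + (3 * \<alpha> + \<beta>) * e"
      using toll_decomp[OF A n] by blast
    have "e\<^sup>2 \<le> 1" using e(1) by (simp add: power_le_one)
    then have w: "((3 * \<alpha> + \<beta>) * e)\<^sup>2 \<le> (3 * \<alpha> + \<beta>)\<^sup>2"
      by (simp add: power_mult_distrib mult_left_le)
    have "(- \<alpha> * small_dev n A + (\<alpha> + \<beta>) * large_dev n A + (3 * \<alpha> + \<beta>) * e)\<^sup>2 \<le>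
      3 * (\<alpha>\<^sup>2 * (small_dev n A)\<^sup>2 + (\<alpha> + \<beta>)\<^sup>2 * (large_dev n A)\<^sup>2 + ((3 * \<alpha> + \<beta>) * e)\<^sup>2)"
      using three[of "- \<alpha> * small_dev n A" "(\<alpha> + \<beta>) * large_dev n A" "(3 * \<alpha> + \<beta>) * e"]
      by (simp only: power_mult_distrib power2_minus)
    also have "\<dots> \<le> 3 * (\<alpha>\<^sup>2 * (small_dev n A)\<^sup>2 + (\<alpha> + \<beta>)\<^sup>2 * (large_dev n A)\<^sup>2 + (3 * \<alpha> + \<beta>)\<^sup>2)"
      by (intro mult_left_mono add_left_mono w) simp
    finally show ?thesis unfolding e(2) .
  qed
  then have "avg (perms n) (\<lambda>A. (toll \<alpha> \<beta> n A - mean_toll \<alpha> \<beta> (sizes n A))\<^sup>2) \<le>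
      avg (perms n) (\<lambda>A. 3 * (\<alpha>\<^sup>2 * (small_dev n A)\<^sup>2 + (\<alpha> + \<beta>)\<^sup>2 * (large_dev n A)\<^sup>2 + (3 * \<alpha> + \<beta>)\<^sup>2))"
    by (rule avg_mono)
  also have "\<dots> = 3 * (\<alpha>\<^sup>2 * avg (perms n) (\<lambda>A. (small_dev n A)\<^sup>2) + (\<alpha> + \<beta>)\<^sup>2 * avg (perms n) (\<lambda>A. (large_dev n A)\<^sup>2) +
      (3 * \<alpha> + \<beta>)\<^sup>2)"
    by (simp only: avg_add avg_cmult avg_const[OF finite_perms perms_nonempty])
  also have "\<dots> \<le> 3 * (\<alpha>\<^sup>2 * real n + (\<alpha> + \<beta>)\<^sup>2 * real n + (3 * \<alpha> + \<beta>)\<^sup>2 * real n)"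
    using dev_moments[OF n] n by (intro add_mono mult_left_mono) (auto simp: mult_le_cancel_left1)
  finally show ?thesis by (simp add: algebra_simps)
qed

section \<open>The recurrence of dual-pivot Quicksort\<close>

text \<open>The discrete form of l'Hospital's rule. It solves both first-order recurrences below to
  leading order.\<close>

lemma stolz_cesaro:
  fixes x w :: "nat \<Rightarrow> real"
  assumes mono: "eventually (\<lambda>n. w n < w (Suc n)) sequentially" and lim: "filterlim w at_top sequentially"
    and ratio: "(\<lambda>n. (x (Suc n) - x n) / (w (Suc n) - w n)) \<longlonglongrightarrow> L"
  shows "(\<lambda>n. x n / w n) \<longlonglongrightarrow> L"
proof (rule LIMSEQ_I)
  fix r :: real assume r: "0 < r"
  have "eventually (\<lambda>n. \<bar>(x (Suc n) - x n) / (w (Suc n) - w n) - L\<bar> < r / 2) sequentially"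
    using tendstoD[OF ratio, of "r / 2"] r by (simp add: dist_real_def)
  with mono have "eventually (\<lambda>n. \<bar>x (Suc n) - x n - L * (w (Suc n) - w n)\<bar> \<le> r / 2 * (w (Suc n) - w n)) sequentially"
  proof eventually_elim
    case (elim n)
    have "x (Suc n) - x n - L * (w (Suc n) - w n) = ((x (Suc n) - x n) / (w (Suc n) - w n) - L) * (w (Suc n) - w n)"
      using elim(1) by (simp add: field_simps)
    then show ?case using elim by (simp add: abs_mult)
  qed
  then obtain N where N: "\<And>n. n \<ge> N \<Longrightarrow> \<bar>x (Suc n) - x n - L * (w (Suc n) - w n)\<bar> \<le> r / 2 * (w (Suc n) - w n)"
    by (auto simp: eventually_sequentially)
  have tele: "\<bar>x n - x N - L * (w n - w N)\<bar> \<le> r / 2 * (w n - w N)" if "n \<ge> N" for n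
    using that
  proof (induction n rule: dec_induct)
    case (step n)
    have "x (Suc n) - x N - L * (w (Suc n) - w N) =
        (x n - x N - L * (w n - w N)) + (x (Suc n) - x n - L * (w (Suc n) - w n))"
      by (simp add: algebra_simps)
    also have "\<bar>\<dots>\<bar> \<le> r / 2 * (w n - w N) + r / 2 * (w (Suc n) - w n)"
      using step.IH N[OF step.hyps(1)] by (intro abs_triangle_ineq[THEN order_trans] add_mono)
    also have "\<dots> = r / 2 * (w (Suc n) - w N)" by (simp add: field_simps)
    finally show ?case .
  qed simp
  \<comment> \<open>\<open>C\<close> absorbs the values at the starting index \<open>N\<close>; half
    of \<open>r * w n\<close> eventually exceeds it.\<close>
  define C where "C = \<bar>x N - L * w N\<bar> + r / 2 * \<bar>w N\<bar>"
  have "eventually (\<lambda>n. w n > max 0 (2 * C / r)) sequentially"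
    by (rule filterlim_at_top_dense[THEN iffD1, OF lim, rule_format])
  then obtain N' where N': "\<And>n. n \<ge> N' \<Longrightarrow> w n > 0 \<and> w n > 2 * C / r"
    by (auto simp: eventually_sequentially)
  show "\<exists>no. \<forall>n\<ge>no. norm (x n / w n - L) < r"
  proof (intro exI allI impI)
    fix n assume n: "max N N' \<le> n"
    have w: "w n > 0" "r / 2 * w n > C" using N'[of n] n r by (auto simp: field_simps)
    have "\<bar>x n - L * w n\<bar> \<le> \<bar>x n - x N - L * (w n - w N)\<bar> + \<bar>x N - L * w N\<bar>"
      by (simp add: algebra_simps)
    also have "\<dots> \<le> r / 2 * (w n - w N) + \<bar>x N - L * w N\<bar>" using tele[of n] n by simp
    also have "\<dots> \<le> r / 2 * w n + C"
    proof -
      have "0 \<le> r / 2 * (w N + \<bar>w N\<bar>)" using r by (intro mult_nonneg_nonneg) linarith+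
      then show ?thesis by (simp add: C_def algebra_simps)
    qed
    also have "\<dots> < r * w n" using w by simp
    finally have "\<bar>x n - L * w n\<bar> < r * w n" .
    moreover have "x n / w n - L = (x n - L * w n) / w n" using w by (simp add: field_simps)
    ultimately show "norm (x n / w n - L) < r" using w by (simp add: divide_less_eq)
  qed
qed

lemma stolz_cesaro_power:
  fixes x :: "nat \<Rightarrow> real"
  assumes "k > 0" "(\<lambda>n. (x (Suc n) - x n) / (real (Suc n) ^ k - real n ^ k)) \<longlonglongrightarrow> L"
  shows "(\<lambda>n. x n / real n ^ k) \<longlonglongrightarrow> L"
proof (rule stolz_cesaro[OF _ _ assms(2)])
  show "eventually (\<lambda>n. real n ^ k < real (Suc n) ^ k) sequentially"
    using assms(1) by (intro always_eventually allI power_strict_mono) auto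
  show "filterlim (\<lambda>n. real n ^ k) at_top sequentially"
    using assms(1) by (intro filterlim_pow_at_top filterlim_real_sequentially) auto
qed

definition partial_sum :: "(nat \<Rightarrow> real) \<Rightarrow> nat \<Rightarrow> real" where
  "partial_sum r n = (\<Sum>i<n. r i)"

text \<open>The first term is the mean of \<open>r\<close> summed over three sizes uniform on the
  lattice: each size \<open>i\<close> has weight proportional to \<open>n - 1 - i\<close>, and the
  iterated partial sum produces this weight. In this form the recurrence is a difference equation of
  second order.\<close>

definition quicksort_recurrence :: "nat \<Rightarrow> (nat \<Rightarrow> real) \<Rightarrow> (nat \<Rightarrow> real) \<Rightarrow> bool" where
  "quicksort_recurrence n0 r \<epsilon> \<longleftrightarrow> n0 \<ge> 2 \<and>
    (\<forall>n\<ge>n0. r n = 6 * partial_sum (partial_sum r) n / (real n * (real n - 1)) + \<epsilon> n)"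

context
  fixes r \<epsilon> :: "nat \<Rightarrow> real" and n0 :: nat
  assumes rec: "quicksort_recurrence n0 r \<epsilon>"
begin

text \<open>
  The combination \<open>(n - 1) Z n + 2 Y n\<close> of \<open>Z n = (\<Sum>i<n. r i)\<close> and
  \<open>Y n = (\<Sum>i<n. Z i)\<close> satisfies a first-order recurrence, with integrating factor
  \<open>1 / ((n - 1) n (n + 1))\<close>; this is \<open>rec_u\<close>.
\<close>

definition "rec_Z n = partial_sum r n"
definition "rec_Y n = partial_sum (partial_sum r) n"
definition "rec_u n = ((real n - 1) * rec_Z n + 2 * rec_Y n) / ((real n - 1) * real n * (real n + 1))"

lemma rec_u_Suc:
  assumes n: "n \<ge> n0"
  shows "rec_u (Suc n) = rec_u n + \<epsilon> n / ((real n + 1) * (real n + 2))"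
proof -
  have n2: "real n \<ge> 2" using rec n by (auto simp: quicksort_recurrence_def)
  have r: "r n = 6 * rec_Y n / (real n * (real n - 1)) + \<epsilon> n"
    using rec n by (simp add: quicksort_recurrence_def rec_Y_def)
  have Z: "rec_Z (Suc n) = rec_Z n + r n" by (simp add: rec_Z_def partial_sum_def)
  have Y: "rec_Y (Suc n) = rec_Y n + rec_Z n" by (simp add: rec_Y_def rec_Z_def partial_sum_def)
  have gen: "(k * (z + (6 * y / (k * (k - 1)) + e)) + 2 * (y + z)) / (k * (k + 1) * (k + 2)) =
      ((k - 1) * z + 2 * y) / ((k - 1) * k * (k + 1)) + e / ((k + 1) * (k + 2))"
    if "k \<ge> 2" for k z y e :: real
  proof -
    have "k \<noteq> 0" "k - 1 \<noteq> 0" "k + 1 \<noteq> 0" "k + 2 \<noteq> 0" using that by auto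
    then show ?thesis by (simp add: divide_simps) algebra
  qed
  have "rec_u (Suc n) = (real n * (rec_Z n + r n) + 2 * (rec_Y n + rec_Z n)) / (real n * (real n + 1) * (real n + 2))"
    by (simp add: rec_u_def Z Y algebra_simps)
  also have "\<dots> = rec_u n + \<epsilon> n / ((real n + 1) * (real n + 2))"
    unfolding rec_u_def r using gen[OF n2] .
  finally show ?thesis .
qed

text \<open>The second first-order recurrence. With \<open>Z n = Y (n + 1) - Y n\<close>, the
  equation defining \<open>rec_u\<close> reads
  \<open>(n - 1) Y (n + 1) - (n - 3) Y n = (n - 1) n (n + 1) u n\<close>; multiplied by
  \<open>n - 2\<close>, its left side telescopes.\<close>

lemma rec_Y_Suc:
  assumes "n \<ge> 2"
  shows "rec_Y (Suc n) * (real (Suc n) - 2) * (real (Suc n) - 3) - rec_Y n * (real n - 2) * (real n - 3) =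
    (real n - 2) * (real n - 1) * real n * (real n + 1) * rec_u n"
proof -
  have Y: "rec_Y (Suc n) = rec_Y n + rec_Z n" by (simp add: rec_Y_def rec_Z_def partial_sum_def)
  have "(real n - 1) * real n * (real n + 1) \<noteq> 0" using assms by auto
  then have "(real n - 1) * real n * (real n + 1) * rec_u n = (real n - 1) * rec_Z n + 2 * rec_Y n"
    by (simp add: rec_u_def)
  then have "(real n - 2) * (real n - 1) * real n * (real n + 1) * rec_u n = (real n - 2) * ((real n - 1) * rec_Z n + 2 * rec_Y n)"
    by (simp only: mult.assoc)
  then show ?thesis unfolding Y by (simp add: algebra_simps)
qed

lemma eventually_rec: "eventually (\<lambda>n. r n = 6 * rec_Y n / (real n * (real n - 1)) + \<epsilon> n) sequentially"
  using eventually_ge_at_top[of n0]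
  by eventually_elim (use rec in \<open>simp add: quicksort_recurrence_def rec_Y_def\<close>)

text \<open>The increments of \<open>rec_u\<close> are of order \<open>1 / n^2\<close>, so
  \<open>rec_u\<close> has a limit \<open>L\<close>. Then \<open>Y n\<close> grows like
  \<open>L n^3 / 5\<close>, and \<open>r n / n\<close> tends to \<open>6 L / 5\<close>. The limit
  depends on all initial values, so only its existence is stated.\<close>

lemma quicksort_recurrence_bounded:
  assumes bound: "\<And>n. n \<ge> n0 \<Longrightarrow> \<bar>\<epsilon> n\<bar> \<le> K"
  shows "convergent (\<lambda>n. r n / real n)"
proof -
  define f where "f k = \<epsilon> (k + n0) / ((real (k + n0) + 1) * (real (k + n0) + 2))" for k
  have u: "rec_u (m + n0) = rec_u n0 + (\<Sum>k<m. f k)" for m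
    by (induction m) (simp_all add: rec_u_Suc f_def)
  have "summable f"
  proof (rule summable_comparison_test')
    show "summable (\<lambda>k. K * inverse ((real (Suc k))\<^sup>2))"
      using inverse_power_summable[of 2, where 'a = real] summable_Suc_iff[of "\<lambda>n. inverse ((real n)\<^sup>2)"]
      by (intro summable_mult) simp
    fix k :: nat assume "k \<ge> 0"
    have "norm (f k) \<le> K / ((real (k + n0) + 1) * (real (k + n0) + 2))"
      unfolding f_def using bound[of "k + n0"] by (simp add: abs_mult divide_right_mono)
    also have "\<dots> \<le> K / ((real (Suc k)) * (real (Suc k)))"
      using bound[of n0] by (intro divide_left_mono mult_mono) auto
    finally show "norm (f k) \<le> K * inverse ((real (Suc k))\<^sup>2)"
      by (simp add: power2_eq_square divide_inverse)
  qed
  then have "(\<lambda>m. rec_u (m + n0)) \<longlonglongrightarrow> rec_u n0 + suminf f"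
    unfolding u by (intro tendsto_intros summable_LIMSEQ)
  then obtain L where L: "rec_u \<longlonglongrightarrow> L"
    by (auto simp: LIMSEQ_offset dest: LIMSEQ_offset)
  have "(\<lambda>n. rec_u n * ((real n - 2) * (real n - 1) * real n * (real n + 1) / (real (Suc n) ^ 5 - real n ^ 5))) \<longlonglongrightarrow> L * (1 / 5)"
    by (intro tendsto_mult L) real_asymp
  then have "(\<lambda>n. (rec_Y (Suc n) * (real (Suc n) - 2) * (real (Suc n) - 3) - rec_Y n * (real n - 2) * (real n - 3)) /
      (real (Suc n) ^ 5 - real n ^ 5)) \<longlonglongrightarrow> L * (1 / 5)"
    by (rule Lim_transform_eventually)
       (use eventually_ge_at_top[of 2] in eventually_elim, simp only: rec_Y_Suc, simp)
  then have "(\<lambda>n. rec_Y n * (real n - 2) * (real n - 3) / real n ^ 5) \<longlonglongrightarrow> L * (1 / 5)"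
    by (rule stolz_cesaro_power[rotated]) simp
  moreover have "(\<lambda>n::nat. 6 * real n ^ 5 / ((real n - 2) * (real n - 3) * real n ^ 2 * (real n - 1))) \<longlonglongrightarrow> 6"
    by real_asymp
  ultimately have "(\<lambda>n. rec_Y n * (real n - 2) * (real n - 3) / real n ^ 5 *
      (6 * real n ^ 5 / ((real n - 2) * (real n - 3) * real n ^ 2 * (real n - 1)))) \<longlonglongrightarrow> L * (1 / 5) * 6"
    by (rule tendsto_mult)
  moreover have "(\<lambda>n. \<epsilon> n / real n) \<longlonglongrightarrow> 0"
  proof (rule Lim_null_comparison)
    show "eventually (\<lambda>n. norm (\<epsilon> n / real n) \<le> K / real n) sequentially"
      using eventually_ge_at_top[of n0] by eventually_elim (simp add: bound divide_right_mono)
  qed real_asymp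
  ultimately have "(\<lambda>n. rec_Y n * (real n - 2) * (real n - 3) / real n ^ 5 *
      (6 * real n ^ 5 / ((real n - 2) * (real n - 3) * real n ^ 2 * (real n - 1))) + \<epsilon> n / real n) \<longlonglongrightarrow> L * (1 / 5) * 6 + 0"
    by (rule tendsto_add)
  then have "(\<lambda>n. r n / real n) \<longlonglongrightarrow> L * (1 / 5) * 6 + 0"
  proof (rule Lim_transform_eventually)
    show "eventually (\<lambda>n. rec_Y n * (real n - 2) * (real n - 3) / real n ^ 5 *
      (6 * real n ^ 5 / ((real n - 2) * (real n - 3) * real n ^ 2 * (real n - 1))) + \<epsilon> n / real n = r n / real n) sequentially"
      using eventually_rec eventually_gt_at_top[of 3]
    proof eventually_elim
      case (elim n)
      then have "real n \<noteq> 0" "real n - 1 \<noteq> 0" "real n - 2 \<noteq> 0" "real n - 3 \<noteq> 0" by auto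
      then show ?case unfolding elim(1) by (simp add: divide_simps power2_eq_square) (simp add: algebra_simps)
    qed
  qed
  then show ?thesis by (rule convergentI)
qed

text \<open>Now \<open>rec_u\<close> grows like \<open>\<beta> n\<close> and \<open>Y n\<close> like
  \<open>\<beta> n^4 / 6\<close>; the sum contributes \<open>\<beta>\<close> and the toll another
  \<open>\<beta>\<close>.\<close>

lemma quicksort_recurrence_quadratic:
  assumes lim: "(\<lambda>n. \<epsilon> n / real n ^ 2) \<longlonglongrightarrow> \<beta>"
  shows "(\<lambda>n. r n / real n ^ 2) \<longlonglongrightarrow> 2 * \<beta>"
proof -
  have "(\<lambda>n. \<epsilon> n / real n ^ 2 * (real n ^ 2 / ((real n + 1) * (real n + 2)))) \<longlonglongrightarrow> \<beta> * 1"
    by (intro tendsto_mult lim) real_asymp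
  then have "(\<lambda>n. (rec_u (Suc n) - rec_u n) / (real (Suc n) - real n)) \<longlonglongrightarrow> \<beta> * 1"
    by (rule Lim_transform_eventually)
       (use eventually_ge_at_top[of "max 1 n0"] in eventually_elim, simp add: rec_u_Suc)
  then have L: "(\<lambda>n. rec_u n / real n) \<longlonglongrightarrow> \<beta>"
    by (intro stolz_cesaro[of real]) (auto simp: filterlim_real_sequentially)
  have "(\<lambda>n. rec_u n / real n * ((real n - 2) * (real n - 1) * real n ^ 2 * (real n + 1) / (real (Suc n) ^ 6 - real n ^ 6))) \<longlonglongrightarrow> \<beta> * (1 / 6)"
    by (intro tendsto_mult L) real_asymp
  then have "(\<lambda>n. (rec_Y (Suc n) * (real (Suc n) - 2) * (real (Suc n) - 3) - rec_Y n * (real n - 2) * (real n - 3)) /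
      (real (Suc n) ^ 6 - real n ^ 6)) \<longlonglongrightarrow> \<beta> * (1 / 6)"
    by (rule Lim_transform_eventually)
       (use eventually_ge_at_top[of 2] in eventually_elim, simp only: rec_Y_Suc, simp add: power2_eq_square)
  then have "(\<lambda>n. rec_Y n * (real n - 2) * (real n - 3) / real n ^ 6) \<longlonglongrightarrow> \<beta> * (1 / 6)"
    by (rule stolz_cesaro_power[rotated]) simp
  moreover have "(\<lambda>n::nat. 6 * real n ^ 6 / ((real n - 2) * (real n - 3) * real n ^ 3 * (real n - 1))) \<longlonglongrightarrow> 6"
    by real_asymp
  ultimately have "(\<lambda>n. rec_Y n * (real n - 2) * (real n - 3) / real n ^ 6 *
      (6 * real n ^ 6 / ((real n - 2) * (real n - 3) * real n ^ 3 * (real n - 1))) + \<epsilon> n / real n ^ 2) \<longlonglongrightarrow> \<beta> * (1 / 6) * 6 + \<beta>"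
    by (intro tendsto_add tendsto_mult lim)
  then have "(\<lambda>n. r n / real n ^ 2) \<longlonglongrightarrow> \<beta> * (1 / 6) * 6 + \<beta>"
  proof (rule Lim_transform_eventually)
    show "eventually (\<lambda>n. rec_Y n * (real n - 2) * (real n - 3) / real n ^ 6 *
      (6 * real n ^ 6 / ((real n - 2) * (real n - 3) * real n ^ 3 * (real n - 1))) + \<epsilon> n / real n ^ 2 = r n / real n ^ 2) sequentially"
      using eventually_rec eventually_gt_at_top[of 3]
    proof eventually_elim
      case (elim n)
      then have "real n \<noteq> 0" "real n - 1 \<noteq> 0" "real n - 2 \<noteq> 0" "real n - 3 \<noteq> 0" by auto
      then show ?case unfolding elim(1) by (simp add: divide_simps power2_eq_square power3_eq_cube) (simp add: algebra_simps)
    qed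
  qed
  then show ?thesis by (simp add: mult.commute)
qed

end

text \<open>An exact solution with a linear toll. Subtracting a multiple of it turns any toll that
  is linear up to a bounded error into a bounded one; the slope \<open>5 / 6\<close> is the source
  of the factor \<open>6 / 5\<close>.\<close>

lemma quicksort_recurrence_harm:
  "quicksort_recurrence 2 (\<lambda>n. (real n + 1) * harm (n + 1)) (\<lambda>n. 5 / 6 * (real n + 1))"
proof -
  let ?m = "\<lambda>n. (real n + 1) * harm (n + 1)"
  have Z: "partial_sum ?m n = real n * (real n + 1) / 2 * harm n - real n * (real n - 1) / 4" for n
  proof (induction n)
    case (Suc n)
    have "harm (Suc n) = harm n + 1 / (real n + 1)" by (simp add: harm_Suc inverse_eq_divide add.commute)
    then show ?case using Suc by (simp add: partial_sum_def) (simp add: field_simps)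
  qed (simp add: partial_sum_def)
  have Y: "partial_sum (partial_sum ?m) n = (real n + 1) * real n * (real n - 1) / 6 * harm n - ((real n)\<^sup>2 - 1) / 6 -
      ((real n - 1) * real n * (2 * real n - 1) / 6 - (real n - 1)) / 6 - real n * (real n - 1) * (real n - 2) / 12" for n
  proof (induction n)
    case (Suc n)
    have h: "harm (Suc n) = harm n + 1 / (real n + 1)" by (simp add: harm_Suc inverse_eq_divide add.commute)
    have "partial_sum (partial_sum ?m) (Suc n) = partial_sum (partial_sum ?m) n + partial_sum ?m n"
      by (simp add: partial_sum_def)
    also have "\<dots> = (real n + 1) * real n * (real n - 1) / 6 * harm n - ((real n)\<^sup>2 - 1) / 6 -
      ((real n - 1) * real n * (2 * real n - 1) / 6 - (real n - 1)) / 6 - real n * (real n - 1) * (real n - 2) / 12 +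
      (real n * (real n + 1) / 2 * harm n - real n * (real n - 1) / 4)"
      by (subst Suc.IH, subst Z) (rule refl)
    also have "\<dots> = (real (Suc n) + 1) * real (Suc n) * (real (Suc n) - 1) / 6 * harm (Suc n) - ((real (Suc n))\<^sup>2 - 1) / 6 -
      ((real (Suc n) - 1) * real (Suc n) * (2 * real (Suc n) - 1) / 6 - (real (Suc n) - 1)) / 6 -
      real (Suc n) * (real (Suc n) - 1) * (real (Suc n) - 2) / 12"
      unfolding h by (simp add: field_simps power2_eq_square)
    finally show ?case .
  qed (simp add: partial_sum_def)
  show ?thesis
    unfolding quicksort_recurrence_def
  proof (intro conjI allI impI)
    fix n :: nat assume n: "n \<ge> 2"
    have h: "harm (n + 1) = harm n + 1 / (real n + 1)" by (simp add: harm_Suc inverse_eq_divide add.commute)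
    have "real n \<noteq> 0" "real n - 1 \<noteq> 0" "real n + 1 \<noteq> 0" using n by auto
    then show "?m n = 6 * partial_sum (partial_sum ?m) n / (real n * (real n - 1)) + 5 / 6 * (real n + 1)"
      unfolding Y h by (simp add: field_simps power2_eq_square)
  qed simp
qed

text \<open>Replaces the harmonic number by a logarithm; Euler's constant is absorbed into the
  linear coefficient.\<close>

lemma harm_asymp: "(\<lambda>n. ((real n + 1) * harm (n + 1) - real n * ln (real n)) / real n) \<longlonglongrightarrow> euler_mascheroni"
proof -
  have e: "(\<lambda>n. harm (Suc n) - ln (real (Suc n))) \<longlonglongrightarrow> (euler_mascheroni::real)"
    using LIMSEQ_Suc[OF euler_mascheroni_LIMSEQ] by simp
  have "(\<lambda>n. (harm (Suc n) - ln (real (Suc n))) * ((real n + 1) / real n) +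
      ((real n + 1) * ln (real (Suc n)) - real n * ln (real n)) / real n - ln (real n) * 0) \<longlonglongrightarrow> euler_mascheroni * 1 + 0 - 0"
    by (intro tendsto_intros e) real_asymp+
  then have "(\<lambda>n. (harm (Suc n) - ln (real (Suc n))) * ((real n + 1) / real n) +
      ((real n + 1) * ln (real (Suc n)) - real n * ln (real n)) / real n) \<longlonglongrightarrow> euler_mascheroni"
    by simp
  then show ?thesis
    by (rule Lim_transform_eventually)
       (use eventually_gt_at_top[of 0] in eventually_elim, simp add: field_simps)
qed

theorem quicksort_recurrence_linear:
  assumes rec: "quicksort_recurrence n0 \<mu> t" and t: "\<And>n. n \<ge> n0 \<Longrightarrow> \<bar>t n - \<tau> * real n\<bar> \<le> K"
  shows "convergent (\<lambda>n. (\<mu> n - 6 / 5 * \<tau> * (real n * ln (real n))) / real n)"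
proof -
  define m where "m n = (real n + 1) * harm (n + 1)" for n
  define r where "r n = \<mu> n - 6 / 5 * \<tau> * m n" for n
  have ps: "partial_sum (\<lambda>n. f n - c * g n) = (\<lambda>n. partial_sum f n - c * partial_sum g n)" for f g c
    by (simp add: partial_sum_def sum_subtractf sum_distrib_left fun_eq_iff)
  have "quicksort_recurrence n0 r (\<lambda>n. t n - \<tau> * (real n + 1))"
    using rec quicksort_recurrence_harm unfolding quicksort_recurrence_def r_def m_def[symmetric] ps
    by (auto simp: algebra_simps diff_divide_distrib)
  from quicksort_recurrence_bounded[OF this, of "K + \<bar>\<tau>\<bar>"] have "convergent (\<lambda>n. r n / real n)"
    using t by (simp add: algebra_simps) (smt (verit, best))
  then obtain L where "(\<lambda>n. r n / real n) \<longlonglongrightarrow> L" by (auto simp: convergent_def)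
  then have "(\<lambda>n. r n / real n + 6 / 5 * \<tau> * ((m n - real n * ln (real n)) / real n)) \<longlonglongrightarrow> L + 6 / 5 * \<tau> * euler_mascheroni"
    unfolding m_def by (intro tendsto_intros harm_asymp)
  moreover have "r n / real n + 6 / 5 * \<tau> * ((m n - real n * ln (real n)) / real n) =
      (\<mu> n - 6 / 5 * \<tau> * (real n * ln (real n))) / real n" for n
    by (simp add: r_def diff_divide_distrib right_diff_distrib)
  ultimately show ?thesis by (auto simp: convergent_def)
qed

section \<open>Averages over the lattice simplex\<close>

text \<open>A first coordinate \<open>a\<close> has \<open>N - a + 1\<close> completions; summing
  these weights by steps gives the iterated sum of \<open>quicksort_recurrence\<close>, with
  \<open>n = N + 2\<close>.\<close>

lemma sum_lattice_fst: "(\<Sum>z\<in>lattice N. r (fst z)) = (\<Sum>i<N + 2. \<Sum>j<i. r j :: real)"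
proof -
  have "(\<Sum>z\<in>lattice N. r (fst z)) = (\<Sum>a\<le>N. (real N - real a + 1) * r a)"
    by (simp add: sum_lattice of_nat_diff algebra_simps)
  also have "\<dots> = (\<Sum>i<N + 2. \<Sum>j<i. r j)"
  proof (induction N)
    case (Suc N)
    have "(\<Sum>a\<le>Suc N. (real (Suc N) - real a + 1) * r a) =
        (\<Sum>a\<le>N. ((real N - real a + 1) * r a + r a)) + r (Suc N)"
      by (simp add: algebra_simps)
    also have "\<dots> = (\<Sum>a\<le>N. (real N - real a + 1) * r a) + (\<Sum>a\<le>Suc N. r a)"
      by (simp add: sum.distrib)
    also have "\<dots> = (\<Sum>i<N + 2. \<Sum>j<i. r j) + (\<Sum>j<N + 2. r j)"
      using Suc by (simp add: lessThan_Suc_atMost)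
    finally show ?case by (simp add: numeral_2_eq_2)
  qed (simp add: numeral_2_eq_2)
  finally show ?thesis .
qed

lemma card_lattice: "real (card (lattice N)) = (real N + 1) * (real N + 2) / 2"
proof -
  have "(\<Sum>i<n. \<Sum>j<i. (1::real)) = real n * (real n - 1) / 2" for n
    by (induction n) (simp_all add: field_simps)
  then show ?thesis using sum_lattice_fst[of "\<lambda>_. 1" N] by (simp add: field_simps)
qed

lemma sum_lattice_permute:
  "(\<Sum>(a, b, c)\<in>lattice N. h b a c) = (\<Sum>(a, b, c)\<in>lattice N. h a b c)"
  "(\<Sum>(a, b, c)\<in>lattice N. h c b a) = (\<Sum>(a, b, c)\<in>lattice N. h a b c)"
  by (rule sum.reindex_bij_witness[where i = "\<lambda>(a, b, c). (b, a, c)" and j = "\<lambda>(a, b, c). (b, a, c)"]; auto simp: lattice_def)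
     (rule sum.reindex_bij_witness[where i = "\<lambda>(a, b, c). (c, b, a)" and j = "\<lambda>(a, b, c). (c, b, a)"]; auto simp: lattice_def)

lemma avg_lattice_permute:
  "avg (lattice N) (\<lambda>(a, b, c). h b a c) = avg (lattice N) (\<lambda>(a, b, c). h a b c)"
  "avg (lattice N) (\<lambda>(a, b, c). h c b a) = avg (lattice N) (\<lambda>(a, b, c). h a b c)"
  unfolding avg_def sum_lattice_permute(1)[where h = h and N = N] sum_lattice_permute(2)[where h = h and N = N]
  by (rule refl)+

lemma avg_lattice_three:
  "avg (lattice N) (\<lambda>(a, b, c). r a + r b + r c) = 6 * (\<Sum>i<N + 2. \<Sum>j<i. r j) / ((real N + 2) * (real N + 1))"
proof -
  have "avg (lattice N) (\<lambda>(a, b, c). r a + r b + r c) =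
    avg (lattice N) (\<lambda>(a, b, c). r a) + avg (lattice N) (\<lambda>(a, b, c). r b) + avg (lattice N) (\<lambda>(a, b, c). r c)"
    by (simp add: avg_add[symmetric] split_def)
  also have "\<dots> = 3 * avg (lattice N) (\<lambda>z. r (fst z))"
    using avg_lattice_permute[of N "\<lambda>a b c. r a"] by (simp add: split_def)
  finally show ?thesis
    by (simp add: avg_def sum_lattice_fst card_lattice mult.commute)
qed

definition scaled :: "nat \<Rightarrow> (real \<Rightarrow> real \<Rightarrow> real \<Rightarrow> real) \<Rightarrow> nat \<times> nat \<times> nat \<Rightarrow> real" where
  "scaled n f = (\<lambda>(a, b, c). f (real a / real n) (real b / real n) (real c / real n))"

text \<open>Coordinates are divided by \<open>n\<close> although they add up to
  \<open>n - 2\<close>, so the sample points lie slightly off the simplex. This is why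
  \<open>f\<close> has three arguments, with continuity later required in all of them. The limit is
  the mean under the uniform law on the simplex.\<close>

definition lattice_limit :: "(real \<Rightarrow> real \<Rightarrow> real \<Rightarrow> real) \<Rightarrow> real \<Rightarrow> bool" where
  "lattice_limit f L \<longleftrightarrow> (\<lambda>n. avg (lattice (n - 2)) (scaled n f)) \<longlonglongrightarrow> L"

lemma lattice_limit_add:
  "lattice_limit f K \<Longrightarrow> lattice_limit g L \<Longrightarrow> lattice_limit (\<lambda>x y z. f x y z + g x y z) (K + L)"
  unfolding lattice_limit_def scaled_def split_def avg_add by (rule tendsto_add)

lemma lattice_limit_cmult:
  "lattice_limit f L \<Longrightarrow> lattice_limit (\<lambda>x y z. c * f x y z) (c * L)"
  unfolding lattice_limit_def scaled_def split_def avg_cmult by (rule tendsto_mult_left)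

text \<open>The symmetry of the lattice allows the integration variables to be renamed, so that in
  the products below the factor with a logarithm can be taken in \<open>x\<close>.\<close>

lemma lattice_limit_permute:
  "lattice_limit (\<lambda>x y z. f y x z) L \<longleftrightarrow> lattice_limit f L"
  "lattice_limit (\<lambda>x y z. f z y x) L \<longleftrightarrow> lattice_limit f L"
proof -
  have "avg (lattice (n - 2)) (scaled n (\<lambda>x y z. f y x z)) = avg (lattice (n - 2)) (scaled n f)"
    "avg (lattice (n - 2)) (scaled n (\<lambda>x y z. f z y x)) = avg (lattice (n - 2)) (scaled n f)" for n
    unfolding scaled_def
    by (rule avg_lattice_permute[of _ "\<lambda>a b c. f (real a / real n) (real b / real n) (real c / real n)"])+
  then show "lattice_limit (\<lambda>x y z. f y x z) L \<longleftrightarrow> lattice_limit f L"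
    "lattice_limit (\<lambda>x y z. f z y x) L \<longleftrightarrow> lattice_limit f L"
    unfolding lattice_limit_def by (simp_all only:)
qed

text \<open>
  The lattice sums are integrals over the plane of functions constant on squares of side \<open>1 / n\<close>,
  so that dominated convergence applies.
\<close>

definition cell_step :: "(real \<Rightarrow> real \<Rightarrow> real \<Rightarrow> real) \<Rightarrow> nat \<Rightarrow> real \<times> real \<Rightarrow> real" where
  "cell_step f n z = (\<Sum>(a, b, c)\<in>lattice (n - 2). f (real a / real n) (real b / real n) (real c / real n) *
    indicator ({real a / real n..<(real a + 1) / real n} \<times> {real b / real n..<(real b + 1) / real n}) z)"

lemma mem_cell:
  assumes "n > 0"
  shows "x \<in> {real a / real n..<(real a + 1) / real n} \<longleftrightarrow> 0 \<le> x \<and> nat \<lfloor>real n * x\<rfloor> = a"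
proof -
  have "x \<in> {real a / real n..<(real a + 1) / real n} \<longleftrightarrow> real a \<le> real n * x \<and> real n * x < real a + 1"
    using assms by (simp add: field_simps)
  also have "\<dots> \<longleftrightarrow> \<lfloor>real n * x\<rfloor> = int a"
    by (simp add: floor_eq_iff)
  also have "\<dots> \<longleftrightarrow> 0 \<le> x \<and> nat \<lfloor>real n * x\<rfloor> = a"
  proof -
    have "0 \<le> real n * x \<longleftrightarrow> 0 \<le> x" using assms by (simp add: zero_le_mult_iff)
    then have "0 \<le> \<lfloor>real n * x\<rfloor> \<longleftrightarrow> 0 \<le> x" by (simp only: zero_le_floor)
    moreover have "i = int a \<longleftrightarrow> 0 \<le> i \<and> nat i = a" for i by auto
    ultimately show ?thesis by simp
  qed
  finally show ?thesis .
qed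

text \<open>The squares are disjoint, so at most one term survives, indexed by the integer parts of
  \<open>n x\<close> and \<open>n y\<close>.\<close>

lemma cell_step_eq:
  fixes x y :: real
  assumes "n \<ge> 2"
  defines "a \<equiv> nat \<lfloor>real n * x\<rfloor>" and "b \<equiv> nat \<lfloor>real n * y\<rfloor>"
  shows "cell_step f n (x, y) = (if 0 \<le> x \<and> 0 \<le> y \<and> a + b \<le> n - 2
    then f (real a / real n) (real b / real n) (real (n - 2 - a - b) / real n) else 0)"
proof -
  let ?z = "(a, b, n - 2 - a - b)"
  let ?P = "0 \<le> x \<and> 0 \<le> y \<and> a + b \<le> n - 2"
  have "cell_step f n (x, y) = (\<Sum>w\<in>lattice (n - 2). if w = ?z then if ?P
    then f (real a / real n) (real b / real n) (real (n - 2 - a - b) / real n) else 0 else 0)"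
    unfolding cell_step_def
  proof (rule sum.cong[OF refl])
    fix w assume w: "w \<in> lattice (n - 2)"
    obtain i j k where ijk: "w = (i, j, k)" by (cases w)
    have sum: "i + j + k = n - 2" using w ijk by (simp add: lattice_def)
    have n: "n > 0" using assms by simp
    show "(case w of (a, b, c) \<Rightarrow> f (real a / real n) (real b / real n) (real c / real n) *
        indicator ({real a / real n..<(real a + 1) / real n} \<times> {real b / real n..<(real b + 1) / real n}) (x, y)) =
      (if w = ?z then if ?P
        then f (real a / real n) (real b / real n) (real (n - 2 - a - b) / real n) else 0 else 0)"
    proof (cases "0 \<le> x \<and> 0 \<le> y \<and> i = a \<and> j = b")
      case True
      then have "k = n - 2 - a - b" "a + b \<le> n - 2" using sum by auto
      moreover have "x \<in> {real i / real n..<(real i + 1) / real n}" "y \<in> {real j / real n..<(real j + 1) / real n}"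
        using mem_cell[OF n] True by (simp_all only: a_def b_def)
      then have "indicator ({real i / real n..<(real i + 1) / real n} \<times> {real j / real n..<(real j + 1) / real n}) (x, y) = (1::real)"
        by (simp only: indicator_eq_1_iff mem_Times_iff fst_conv snd_conv)
      ultimately show ?thesis using True by (simp only: ijk) simp
    next
      case False
      then have "indicator ({real i / real n..<(real i + 1) / real n} \<times> {real j / real n..<(real j + 1) / real n}) (x, y) = (0::real)"
        using mem_cell[OF n, of x i] mem_cell[OF n, of y j] False
        by (simp only: indicator_eq_0_iff mem_Times_iff fst_conv snd_conv a_def b_def) blast
      moreover have "\<not> (w = ?z \<and> ?P)" using False unfolding ijk prod.inject by blast
      ultimately show ?thesis by (auto simp: ijk)
    qed
  qed
  also have "\<dots> = (if ?P then f (real a / real n) (real b / real n) (real (n - 2 - a - b) / real n) else 0)"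
    by (subst sum.delta[OF finite_lattice]) (auto simp: lattice_def)
  finally show ?thesis .
qed

lemma measure_cell:
  "emeasure (lborel \<Otimes>\<^sub>M lborel) ({a..<b} \<times> {c..<d}) = ennreal ((b - a) * (d - c))" if "a \<le> b" "c \<le> d" for a b c d :: real
  using that by (simp add: lborel.emeasure_pair_measure_Times ennreal_mult)

lemma integral_cell_step:
  assumes n: "n \<ge> 2"
  shows "integrable (lborel \<Otimes>\<^sub>M lborel) (cell_step f n)"
    "integral\<^sup>L (lborel \<Otimes>\<^sub>M lborel) (cell_step f n) = (\<Sum>z\<in>lattice (n - 2). scaled n f z) / (real n)\<^sup>2"
proof -
  define Q where "Q a b = {real a / real n..<(real a + 1) / real n} \<times> {real b / real n..<(real b + 1) / real n}" for a b
  have em: "emeasure (lborel \<Otimes>\<^sub>M lborel) (Q a b) = ennreal (1 / (real n)\<^sup>2)" for a b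
  proof -
    have "((real a + 1) / real n - real a / real n) * ((real b + 1) / real n - real b / real n) = 1 / (real n)\<^sup>2"
      by (simp add: diff_divide_distrib[symmetric] power2_eq_square)
    then show ?thesis unfolding Q_def by (subst measure_cell) (auto simp: divide_right_mono)
  qed
  have sets: "Q a b \<in> sets (lborel \<Otimes>\<^sub>M lborel)" for a b by (simp add: Q_def)
  have int: "integrable (lborel \<Otimes>\<^sub>M lborel) (\<lambda>z. k * indicator (Q a b) z)" for a b and k :: real
    using em sets by (intro integrable_mult_right integrable_real_indicator) auto
  have val: "integral\<^sup>L (lborel \<Otimes>\<^sub>M lborel) (\<lambda>z. k * indicator (Q a b) z) = k / (real n)\<^sup>2" for a b and k :: real
  proof -
    have "measure (lborel \<Otimes>\<^sub>M lborel) (Q a b) = 1 / (real n)\<^sup>2"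
      by (simp add: measure_def em)
    then show ?thesis using sets.Int_space_eq2[OF sets[of a b]] by simp
  qed
  have eq: "cell_step f n = (\<lambda>z. \<Sum>w\<in>lattice (n - 2). scaled n f w * indicator (Q (fst w) (fst (snd w))) z)"
    by (simp add: cell_step_def Q_def fun_eq_iff split_def scaled_def)
  show "integrable (lborel \<Otimes>\<^sub>M lborel) (cell_step f n)"
    unfolding eq by (intro Bochner_Integration.integrable_sum int)
  show "integral\<^sup>L (lborel \<Otimes>\<^sub>M lborel) (cell_step f n) = (\<Sum>z\<in>lattice (n - 2). scaled n f z) / (real n)\<^sup>2"
    unfolding eq by (subst Bochner_Integration.integral_sum, rule int) (simp only: val sum_divide_distrib)
qed

lemma floor_div_tendsto:
  assumes "0 \<le> x"
  shows "(\<lambda>n. real (nat \<lfloor>real n * x\<rfloor>) / real n) \<longlonglongrightarrow> x"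
proof (rule tendsto_sandwich)
  show "eventually (\<lambda>n. x - 1 / real n \<le> real (nat \<lfloor>real n * x\<rfloor>) / real n) sequentially"
    using eventually_gt_at_top[of 0]
  proof eventually_elim
    case (elim n)
    have "real n * x - 1 \<le> real (nat \<lfloor>real n * x\<rfloor>)"
      using assms by (simp add: of_nat_nat)
    then have "(real n * x - 1) / real n \<le> real (nat \<lfloor>real n * x\<rfloor>) / real n"
      by (rule divide_right_mono) simp
    then show ?case using elim by (simp add: diff_divide_distrib)
  qed
  show "eventually (\<lambda>n. real (nat \<lfloor>real n * x\<rfloor>) / real n \<le> x) sequentially"
    using eventually_gt_at_top[of 0]
  proof eventually_elim
    case (elim n)
    have "real (nat \<lfloor>real n * x\<rfloor>) \<le> real n * x"
      using assms by (simp add: of_nat_nat)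
    then show ?case using elim by (simp add: field_simps)
  qed
  show "(\<lambda>n. x - 1 / real n) \<longlonglongrightarrow> x" by real_asymp
qed simp

text \<open>The factor 2 is the reciprocal of the area of the triangle. Dominated convergence and
  Fubini's theorem use the Lebesgue integral, while \<open>inner\<close> and \<open>outer\<close>
  are gauge integrals, to which the fundamental theorem of calculus applies directly.\<close>

theorem lattice_limit_integral:
  fixes f :: "real \<Rightarrow> real \<Rightarrow> real \<Rightarrow> real"
  assumes bound: "\<And>x y z. x \<in> {0..1} \<Longrightarrow> y \<in> {0..1} \<Longrightarrow> z \<in> {0..1} \<Longrightarrow> \<bar>f x y z\<bar> \<le> B"
    and cont: "\<And>x y. x > 0 \<Longrightarrow> y > 0 \<Longrightarrow> x + y < 1 \<Longrightarrow>
      isCont (\<lambda>w. f (fst w) (fst (snd w)) (snd (snd w))) (x, y, 1 - x - y)"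
    and meas [measurable]: "(\<lambda>w. f (fst w) (snd w) (1 - fst w - snd w)) \<in> borel_measurable (lborel \<Otimes>\<^sub>M lborel)"
    and inner: "\<And>x. 0 < x \<Longrightarrow> x < 1 \<Longrightarrow> ((\<lambda>y. f x y (1 - x - y)) has_integral G x) {0<..<1 - x}"
    and outer: "(G has_integral I) {0<..<1}"
  shows "lattice_limit f (2 * I)"
proof -
  let ?M = "lborel \<Otimes>\<^sub>M lborel :: (real \<times> real) measure"
  define g where "g w = (if fst w > 0 \<and> snd w > 0 \<and> fst w + snd w < 1 then f (fst w) (snd w) (1 - fst w - snd w) else 0)" for w
  define W where "W w = B * indicator ({0..1} \<times> {0..1}) w" for w :: "real \<times> real"
  have B: "0 \<le> B" using bound[of 0 0 0] by auto
  have g_meas [measurable]: "g \<in> borel_measurable ?M" unfolding g_def by measurable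
  have W_int: "integrable ?M W"
    unfolding W_def by (intro integrable_mult_right integrable_real_indicator)
      (simp_all add: lborel.emeasure_pair_measure_Times)
  have conv: "AE w in ?M. (\<lambda>m. cell_step f (m + 2) w) \<longlonglongrightarrow> g w"
  proof (rule lborel_pair.AE_pair_measure)
    show "{w \<in> space ?M. (\<lambda>m. cell_step f (m + 2) w) \<longlonglongrightarrow> g w} \<in> sets ?M"
      using integral_cell_step(1) by measurable
    show "AE x in lborel. AE y in lborel. (\<lambda>m. cell_step f (m + 2) (x, y)) \<longlonglongrightarrow> g (x, y)"
      \<comment> \<open>The axes are discarded as null sets: \<open>g\<close> vanishes there,
        whereas the half-open squares meet them.\<close>
      using AE_lborel_singleton[of 0]
    proof eventually_elim
      case (elim x)
      show ?case using AE_lborel_singleton[of 0]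
      proof eventually_elim
        case (elim y)
        show "(\<lambda>m. cell_step f (m + 2) (x, y)) \<longlonglongrightarrow> g (x, y)"
        proof (cases "x > 0 \<and> y > 0 \<and> x + y < 1")
          case False
          have zero: "cell_step f n (x, y) = 0" if n: "n \<ge> 2" for n
          proof -
            \<comment> \<open>From \<open>a + b \<le> n - 2\<close> follows
              \<open>n (x + y) < a + b + 2 \<le> n\<close>. So the squares stay strictly below the
              line \<open>x + y = 1\<close>, and outside the open triangle there is equality with 0
              and not just convergence.\<close>
            have "\<not> (0 \<le> x \<and> 0 \<le> y \<and> nat \<lfloor>real n * x\<rfloor> + nat \<lfloor>real n * y\<rfloor> \<le> n - 2)"
            proof
              assume *: "0 \<le> x \<and> 0 \<le> y \<and> nat \<lfloor>real n * x\<rfloor> + nat \<lfloor>real n * y\<rfloor> \<le> n - 2"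
              then have xy: "x + y \<ge> 1" using False \<open>x \<noteq> 0\<close> \<open>y \<noteq> 0\<close> by auto
              have "real n * (x + y) \<ge> real n" using mult_left_mono[OF xy, of "real n"] by simp
              moreover have "real n * x < real (nat \<lfloor>real n * x\<rfloor>) + 1" "real n * y < real (nat \<lfloor>real n * y\<rfloor>) + 1"
                using * by (simp_all add: of_nat_nat)
              moreover have "real (nat \<lfloor>real n * x\<rfloor>) + real (nat \<lfloor>real n * y\<rfloor>) \<le> real n - 2"
                using * n by (simp only: of_nat_add[symmetric] of_nat_le_iff[where 'a = real, symmetric] of_nat_diff of_nat_numeral)
              ultimately show False by (simp add: distrib_left)
            qed
            then show ?thesis by (simp only: cell_step_eq[OF n] if_False)
          qed
          have "g (x, y) = 0" using False unfolding g_def fst_conv snd_conv by (simp only: if_False)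
          then show ?thesis by (simp add: zero)
        next
          case True
          define a b where "a n = nat \<lfloor>real n * x\<rfloor>" and "b n = nat \<lfloor>real n * y\<rfloor>" for n
          have lim: "(\<lambda>n. real (a n) / real n) \<longlonglongrightarrow> x" "(\<lambda>n. real (b n) / real n) \<longlonglongrightarrow> y"
            unfolding a_def b_def using True by (intro floor_div_tendsto; simp)+
          have pos: "1 - x - y > 0" using True by simp
          \<comment> \<open>Squares near the line \<open>x + y = 1\<close> are missing because of
            the two pivots; an interior point is covered once
            \<open>n (1 - x - y) \<ge> 2\<close>.\<close>
          have "eventually (\<lambda>n. 2 / (1 - x - y) \<le> real n) sequentially"
            using filterlim_real_sequentially by (simp only: filterlim_at_top)
          then have "eventually (\<lambda>n. real n * (1 - x - y) \<ge> 2) sequentially"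
            by eventually_elim (use pos in \<open>simp only: pos_divide_le_eq\<close>)
          then have ev: "eventually (\<lambda>n. n \<ge> 2 \<and> a n + b n \<le> n - 2) sequentially"
            using eventually_ge_at_top[of 2]
          proof eventually_elim
            case (elim n)
            have "real (a n) \<le> real n * x" "real (b n) \<le> real n * y"
              unfolding a_def b_def using True by (simp_all add: of_nat_nat)
            then have "real (a n + b n + 2) \<le> real n" using elim by (simp add: algebra_simps)
            then have "a n + b n + 2 \<le> n" unfolding of_nat_le_iff .
            then show ?case by simp
          qed
          have "(\<lambda>n. 1 - real (a n) / real n - real (b n) / real n - 2 / real n) \<longlonglongrightarrow> 1 - x - y - 0"
          proof (intro tendsto_diff tendsto_const lim)
            show "(\<lambda>n. 2 / real n) \<longlonglongrightarrow> 0" by real_asymp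
          qed
          then have "(\<lambda>n. real (n - 2 - a n - b n) / real n) \<longlonglongrightarrow> 1 - x - y - 0"
          proof (rule Lim_transform_eventually)
            show "eventually (\<lambda>n. 1 - real (a n) / real n - real (b n) / real n - 2 / real n = real (n - 2 - a n - b n) / real n) sequentially"
              using ev by eventually_elim (auto simp: of_nat_diff field_simps)
          qed
          then have "(\<lambda>n. (real (a n) / real n, real (b n) / real n, real (n - 2 - a n - b n) / real n)) \<longlonglongrightarrow> (x, y, 1 - x - y)"
            by (intro tendsto_Pair lim) simp
          from isCont_tendsto_compose[OF cont this] True
          have "(\<lambda>n. f (real (a n) / real n) (real (b n) / real n) (real (n - 2 - a n - b n) / real n)) \<longlonglongrightarrow> f x y (1 - x - y)"
            by simp
          then have "(\<lambda>n. cell_step f n (x, y)) \<longlonglongrightarrow> f x y (1 - x - y)"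
          proof (rule Lim_transform_eventually)
            show "eventually (\<lambda>n. f (real (a n) / real n) (real (b n) / real n) (real (n - 2 - a n - b n) / real n) = cell_step f n (x, y)) sequentially"
              using ev by eventually_elim (use True in \<open>auto simp: cell_step_eq a_def b_def\<close>)
          qed
          from LIMSEQ_ignore_initial_segment[OF this, of 2] show ?thesis using True by (simp add: g_def)
        qed
      qed
    qed
  qed
  have dom: "AE w in ?M. norm (cell_step f (m + 2) w) \<le> W w" for m
  proof (rule AE_I2)
    fix w :: "real \<times> real"
    obtain x y where w: "w = (x, y)" by (cases w)
    define n where "n = m + 2"
    have n: "n > 0" "n \<ge> 2" by (simp_all add: n_def)
    define a b where "a = nat \<lfloor>real n * x\<rfloor>" and "b = nat \<lfloor>real n * y\<rfloor>"
    have cs: "cell_step f n (x, y) = (if 0 \<le> x \<and> 0 \<le> y \<and> a + b \<le> n - 2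
      then f (real a / real n) (real b / real n) (real (n - 2 - a - b) / real n) else 0)"
      unfolding a_def b_def by (rule cell_step_eq[OF n(2)])
    have "norm (cell_step f n (x, y)) \<le> W (x, y)"
    proof (cases "0 \<le> x \<and> 0 \<le> y \<and> a + b \<le> n - 2")
      case True
      have "real n * x < real a + 1" "real n * y < real b + 1"
        using True by (simp_all add: a_def b_def of_nat_nat)
      moreover have "real a + 1 \<le> real n" "real b + 1 \<le> real n" using True n by linarith+
      ultimately have "real n * x < real n * 1" "real n * y < real n * 1" by linarith+
      then have "x \<le> 1" "y \<le> 1" using n by (simp_all del: mult_1_right add: mult_less_cancel_left)
      moreover have "\<bar>f (real a / real n) (real b / real n) (real (n - 2 - a - b) / real n)\<bar> \<le> B"
        using True n by (intro bound) auto
      ultimately show ?thesis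
        using True by (simp add: cs W_def)
    next
      case False
      then have "cell_step f n (x, y) = 0" unfolding cs by (simp only: if_False)
      then show ?thesis using B by (simp add: W_def)
    qed
    then show "norm (cell_step f (m + 2) w) \<le> W w" by (simp only: w n_def)
  qed
  have cs_meas: "cell_step f (m + 2) \<in> borel_measurable ?M" for m
    using integral_cell_step(1)[of "m + 2" f] by (intro borel_measurable_integrable) simp
  have lim: "(\<lambda>m. integral\<^sup>L ?M (cell_step f (m + 2))) \<longlonglongrightarrow> integral\<^sup>L ?M g"
    by (rule integral_dominated_convergence[OF g_meas cs_meas W_int conv dom])
  have g_int: "integrable ?M g"
    by (rule integrable_dominated_convergence[OF g_meas cs_meas W_int conv dom])
  have in_eq: "(LINT y|lborel. g (x, y)) = (if x \<in> {0<..<1} then G x else 0)"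
    if int: "integrable lborel (\<lambda>y. g (x, y))" for x
  proof (cases "x \<in> {0<..<1}")
    case True
    have "g (x, y) = (if y \<in> {0<..<1 - x} then f x y (1 - x - y) else 0)" for y
    proof -
      have "0 < x \<and> 0 < y \<and> x + y < 1 \<longleftrightarrow> y \<in> {0<..<1 - x}" using True by auto
      then show ?thesis by (simp only: g_def fst_conv snd_conv)
    qed
    moreover have "((\<lambda>y. if y \<in> {0<..<1 - x} then f x y (1 - x - y) else 0) has_integral G x) UNIV"
      using inner[of x] True by (simp only: has_integral_restrict_UNIV) simp
    ultimately have "((\<lambda>y. g (x, y)) has_integral G x) UNIV" by simp
    from has_integral_unique[OF has_integral_integral_lborel[OF int] this] show ?thesis
      using True by (simp only: if_True)
  next
    case False
    then have "g (x, y) = 0" for y by (auto simp: g_def)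
    then show ?thesis using False by (simp only: if_False) simp
  qed
  have "integral\<^sup>L ?M g = I"
  proof -
    have "integral\<^sup>L ?M g = (LINT x|lborel. LINT y|lborel. g (x, y))"
      by (rule lborel_pair.integral_fst'[OF g_int, symmetric])
    moreover have h1: "((\<lambda>x. LINT y|lborel. g (x, y)) has_integral (LINT x|lborel. LINT y|lborel. g (x, y))) UNIV"
      by (rule has_integral_integral_lborel[OF lborel_pair.integrable_fst'[OF g_int]])
    moreover have h2: "((\<lambda>x. LINT y|lborel. g (x, y)) has_integral I) UNIV"
    proof -
      have "integrable lborel (\<lambda>y. g (x, y))" for x
      proof (rule Bochner_Integration.integrable_bound[where f = "\<lambda>y. B * indicator {0..1} y"])
        show "integrable lborel (\<lambda>y. B * indicator {0..1::real} y)"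
          by (intro integrable_mult_right integrable_real_indicator) auto
        show "(\<lambda>y. g (x, y)) \<in> borel_measurable lborel" by measurable
        show "AE y in lborel. norm (g (x, y)) \<le> norm (B * indicator {0..1} y)"
          using bound B by (intro AE_I2) (auto simp: g_def)
      qed
      then have "(\<lambda>x. LINT y|lborel. g (x, y)) = (\<lambda>x. if x \<in> {0<..<1} then G x else 0)"
        using in_eq by blast
      then show ?thesis using outer by (simp only: has_integral_restrict_UNIV)
    qed
    ultimately show ?thesis using has_integral_unique[OF h1 h2] by simp
  qed
  with lim have "(\<lambda>m. integral\<^sup>L ?M (cell_step f (m + 2))) \<longlonglongrightarrow> I" by simp
  \<comment> \<open>With \<open>n = m + 2\<close>, this converts the integral, a sum divided by
    \<open>n^2\<close>, into an average over \<open>n (n - 1) / 2\<close> lattice points.\<close>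
  moreover have "(\<lambda>m::nat. 2 * (real m + 2)\<^sup>2 / ((real m + 1) * (real m + 2))) \<longlonglongrightarrow> 2" by real_asymp
  ultimately have "(\<lambda>m. 2 * (real m + 2)\<^sup>2 / ((real m + 1) * (real m + 2)) * integral\<^sup>L ?M (cell_step f (m + 2))) \<longlonglongrightarrow> 2 * I"
    by (intro tendsto_mult)
  moreover have "2 * (real m + 2)\<^sup>2 / ((real m + 1) * (real m + 2)) * integral\<^sup>L ?M (cell_step f (m + 2)) =
      avg (lattice (m + 2 - 2)) (scaled (m + 2) f)" for m
  proof -
    have gen: "2 * k\<^sup>2 / (j * k) * (S / k\<^sup>2) = S / (j * k / 2)" if "k \<noteq> 0" "j \<noteq> 0" for j k S :: real
      using that by (simp add: field_simps power2_eq_square)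
    have r: "real (m + 2) = real m + 2" "m + 2 - 2 = m" by simp_all
    have "real m + 2 \<noteq> 0" "real m + 1 \<noteq> 0" by linarith+
    from gen[OF this] show ?thesis
      using integral_cell_step(2)[of "m + 2" f] unfolding avg_def r card_lattice by simp
  qed
  ultimately have "(\<lambda>m. avg (lattice (m + 2 - 2)) (scaled (m + 2) f)) \<longlonglongrightarrow> 2 * I" by simp
  then show ?thesis unfolding lattice_limit_def
    by (rule LIMSEQ_offset[where k = 2 and f = "\<lambda>n. avg (lattice (n - 2)) (scaled n f)"])
qed

lemma lattice_limit_continuous:
  fixes f :: "real \<Rightarrow> real \<Rightarrow> real \<Rightarrow> real"
  assumes cont: "continuous_on ({0..1} \<times> {0..1} \<times> {0..1}) (\<lambda>w. f (fst w) (fst (snd w)) (snd (snd w)))"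
    and meas: "(\<lambda>w. f (fst w) (snd w) (1 - fst w - snd w)) \<in> borel_measurable (lborel \<Otimes>\<^sub>M lborel)"
    and inner: "\<And>x. 0 < x \<Longrightarrow> x < 1 \<Longrightarrow> ((\<lambda>y. f x y (1 - x - y)) has_integral G x) {0<..<1 - x}"
    and outer: "(G has_integral I) {0<..<1}"
  shows "lattice_limit f (2 * I)"
proof -
  let ?C = "{0..1} \<times> {0..1} \<times> {0..1} :: (real \<times> real \<times> real) set"
  have "compact ?C" by (intro compact_Times compact_Icc)
  then have "bounded ((\<lambda>w. f (fst w) (fst (snd w)) (snd (snd w))) ` ?C)"
    by (intro compact_imp_bounded compact_continuous_image cont)
  then obtain B where B: "\<forall>v\<in>(\<lambda>w. f (fst w) (fst (snd w)) (snd (snd w))) ` ?C. norm v \<le> B"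
    unfolding bounded_iff by blast
  show ?thesis
  proof (rule lattice_limit_integral[where f = f and G = G and I = I, OF _ _ meas inner outer])
    show "\<bar>f x y z\<bar> \<le> B" if "x \<in> {0..1}" "y \<in> {0..1}" "z \<in> {0..1}" for x y z
      using bspec[OF B imageI[of "(x, y, z)"]] that by simp
    show "isCont (\<lambda>w. f (fst w) (fst (snd w)) (snd (snd w))) (x, y, 1 - x - y)"
      if "x > 0" "y > 0" "x + y < 1" for x y
    proof (rule continuous_on_interior[OF cont])
      have "open ({0<..<1} \<times> {0<..<1} \<times> {0<..<1} :: (real \<times> real \<times> real) set)"
        by (intro open_Times open_greaterThanLessThan)
      moreover have "(x, y, 1 - x - y) \<in> {0<..<1} \<times> {0<..<1} \<times> {0<..<1}" using that by auto
      moreover have "{0<..<1} \<times> {0<..<1} \<times> {0<..<1} \<subseteq> ?C" by auto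
      ultimately show "(x, y, 1 - x - y) \<in> interior ?C" by (rule interiorI)
    qed
  qed
qed

section \<open>Logarithmic integrals and numerical bounds\<close>

definition arctan_poly :: "nat \<Rightarrow> real \<Rightarrow> real" where
  "arctan_poly m x = (\<Sum>k<m. (-1) ^ k * x ^ (2 * k + 1) / real (2 * k + 1))"

text \<open>The derivatives of the Taylor terms form a geometric sum, so the derivative of the error
  has a sign that depends only on the parity of \<open>m\<close>. This turns the polynomials into
  rigorous upper and lower bounds.\<close>

lemma arctan_poly_deriv:
  "((\<lambda>x. arctan_poly m x - arctan x) has_real_derivative - ((- (x\<^sup>2)) ^ m) / (1 + x\<^sup>2)) (at x)"
proof -
  have "((\<lambda>x. (-1) ^ k * x ^ (2 * k + 1) / real (2 * k + 1)) has_real_derivative (- (x\<^sup>2)) ^ k) (at x)" for k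
    by (rule derivative_eq_intros refl | simp)+ (simp add: power_mult power_minus[of "x\<^sup>2"])
  then have "((\<lambda>x. arctan_poly m x - arctan x) has_real_derivative (\<Sum>k<m. (- (x\<^sup>2)) ^ k) - inverse (1 + x\<^sup>2)) (at x)"
    unfolding arctan_poly_def by (intro DERIV_diff DERIV_sum DERIV_arctan)
  moreover have "1 + x\<^sup>2 \<noteq> 0" by (smt (verit) zero_le_power2)
  then have "(\<Sum>k<m. (- (x\<^sup>2)) ^ k) = (1 - (- (x\<^sup>2)) ^ m) / (1 + x\<^sup>2)"
    using one_diff_power_eq[of "- (x\<^sup>2)" m] by (simp add: eq_divide_eq mult.commute)
  then have "(\<Sum>k<m. (- (x\<^sup>2)) ^ k) - inverse (1 + x\<^sup>2) = - ((- (x\<^sup>2)) ^ m) / (1 + x\<^sup>2)"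
    by (simp add: diff_divide_distrib inverse_eq_divide)
  ultimately show ?thesis by simp
qed

lemma arctan_le_poly:
  assumes "odd m" "0 \<le> x"
  shows "arctan x \<le> arctan_poly m x"
proof -
  have "arctan_poly m 0 - arctan 0 \<le> arctan_poly m x - arctan x"
  proof (rule DERIV_nonneg_imp_nondecreasing[OF assms(2)])
    fix t :: real
    have "0 \<le> - ((- (t\<^sup>2)) ^ m) / (1 + t\<^sup>2)"
      using assms(1) by (simp add: power_minus_odd add_nonneg_nonneg)
    then show "\<exists>y. ((\<lambda>x. arctan_poly m x - arctan x) has_real_derivative y) (at t) \<and> 0 \<le> y"
      using arctan_poly_deriv by blast
  qed
  then show ?thesis by (simp add: arctan_poly_def)
qed

lemma arctan_ge_poly:
  assumes "even m" "0 \<le> x"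
  shows "arctan_poly m x \<le> arctan x"
proof -
  have "arctan_poly m x - arctan x \<le> arctan_poly m 0 - arctan 0"
  proof (rule DERIV_nonpos_imp_nonincreasing[OF assms(2)])
    fix t :: real
    have "- ((- (t\<^sup>2)) ^ m) / (1 + t\<^sup>2) \<le> 0"
      using assms(1) by (simp add: add_nonneg_nonneg divide_nonneg_nonneg)
    then show "\<exists>y. ((\<lambda>x. arctan_poly m x - arctan x) has_real_derivative y) (at t) \<and> y \<le> 0"
      using arctan_poly_deriv by blast
  qed
  then show ?thesis by (simp add: arctan_poly_def)
qed

text \<open>Machin's formula with truncated arctangent series. Many digits are required because
  \<open>28 / 15\<close> and \<open>19 / 100 * pi^2\<close> agree to within one hundredth, so the
  relative error grows by cancellation.\<close>

lemma pi_bounds: "3.1415926535 < pi" "pi < 3.1415926537"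
proof -
  have "arctan (1/5) \<le> arctan_poly 7 (1/5)" "arctan_poly 8 (1/5) \<le> arctan (1/5)"
    "arctan (1/239) \<le> arctan_poly 3 (1/239)" "arctan_poly 2 (1/239) \<le> arctan (1/239)"
    by (intro arctan_le_poly arctan_ge_poly; simp)+
  moreover have "arctan_poly 7 (1/5) < 0.197395559853" "0.197395559849 < arctan_poly 8 (1/5)"
    "arctan_poly 3 (1/239) < 0.00418407600208" "0.0041840760018 < arctan_poly 2 (1/239)"
    by (simp_all add: arctan_poly_def eval_nat_numeral)
  ultimately show "3.1415926535 < pi" "pi < 3.1415926537"
    using machin by auto
qed

section \<open>Integrals of powers times logarithms\<close>

lemma x_ln_continuous: "continuous_on {0..1} (\<lambda>x::real. x * ln x)"
  "continuous_on {0..1} (\<lambda>x::real. x * (ln x)\<^sup>2)"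
proof -
  have "isCont (\<lambda>x::real. x * ln x) x" "isCont (\<lambda>x::real. x * (ln x)\<^sup>2) x" if "x > 0" for x
    using that by (auto intro!: continuous_intros)
  moreover have "continuous (at 0 within {0..1}) (\<lambda>x::real. x * ln x)" "continuous (at 0 within {0..1}) (\<lambda>x::real. x * (ln x)\<^sup>2)"
  proof -
    have "at (0::real) within {0..1} = at_right 0"
      using at_within_Icc_at_right[of 0 "1::real"] by simp
    moreover have "((\<lambda>x::real. x * ln x) \<longlongrightarrow> 0) (at_right 0)" "((\<lambda>x::real. x * (ln x)\<^sup>2) \<longlongrightarrow> 0) (at_right 0)"
      by real_asymp+
    ultimately show "continuous (at 0 within {0..1}) (\<lambda>x::real. x * ln x)" "continuous (at 0 within {0..1}) (\<lambda>x::real. x * (ln x)\<^sup>2)"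
      by (simp_all add: continuous_within)
  qed
  ultimately show "continuous_on {0..1} (\<lambda>x::real. x * ln x)" "continuous_on {0..1} (\<lambda>x::real. x * (ln x)\<^sup>2)"
    unfolding continuous_on_eq_continuous_within
    by (metis atLeastAtMost_iff continuous_at_imp_continuous_at_within less_eq_real_def)+
qed

lemma has_integral_power_ln: "((\<lambda>x::real. x ^ k * ln x) has_integral - 1 / (real k + 1)\<^sup>2) {0..1}"
proof -
  define c where "c = real k + 1"
  have c: "c \<noteq> 0" by (simp add: c_def)
  \<comment> \<open>The antiderivative \<open>x ^ (k + 1) * (ln x / c - 1 / c ^ 2)\<close>, written
    with the factor \<open>x * ln x\<close> so that its continuity at 0 comes from
    \<open>x_ln_continuous\<close>.\<close>
  let ?F = "\<lambda>x::real. x ^ k * (x * ln x) / c - x ^ Suc k / c\<^sup>2"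
  have "((\<lambda>x. x ^ k * ln x) has_integral ?F 1 - ?F 0) {0..1}"
  proof (rule fundamental_theorem_of_calculus_interior)
    show "continuous_on {0..1} ?F"
      using c by (intro continuous_intros x_ln_continuous) auto
    fix x :: real assume x: "x \<in> {0<..<1}"
    have d: "((\<lambda>x. x ^ Suc k) has_real_derivative c * x ^ k) (at x)"
      using DERIV_pow[of "Suc k" x UNIV] by (simp add: c_def add.commute)
    have l: "((\<lambda>x. ln x / c - 1 / c\<^sup>2) has_real_derivative 1 / (x * c)) (at x)"
      using x c by (auto intro!: derivative_eq_intros)
    have "?F = (\<lambda>x. x ^ Suc k * (ln x / c - 1 / c\<^sup>2))"
      by (simp add: algebra_simps)
    moreover have "c * x ^ k * (ln x / c - 1 / c\<^sup>2) + 1 / (x * c) * x ^ Suc k = x ^ k * ln x"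
      using x c by (simp add: field_simps power2_eq_square)
    ultimately have "(?F has_real_derivative x ^ k * ln x) (at x)"
      using DERIV_mult[OF d l] by simp
    then show "(?F has_vector_derivative x ^ k * ln x) (at x)"
      by (simp add: has_real_derivative_iff_has_vector_derivative)
  qed simp
  then show ?thesis by (simp add: c_def)
qed

lemma has_integral_power_ln2: "((\<lambda>x::real. x ^ k * (ln x)\<^sup>2) has_integral 2 / (real k + 1) ^ 3) {0..1}"
proof -
  define c where "c = real k + 1"
  have c: "c \<noteq> 0" by (simp add: c_def)
  let ?F = "\<lambda>x::real. x ^ k * (x * (ln x)\<^sup>2) / c - 2 * (x ^ k * (x * ln x)) / c\<^sup>2 + 2 * x ^ Suc k / c ^ 3"
  have "((\<lambda>x. x ^ k * (ln x)\<^sup>2) has_integral ?F 1 - ?F 0) {0..1}"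
  proof (rule fundamental_theorem_of_calculus_interior)
    show "continuous_on {0..1} ?F"
      using c by (intro continuous_intros x_ln_continuous) auto
    fix x :: real assume x: "x \<in> {0<..<1}"
    have d: "((\<lambda>x. x ^ Suc k) has_real_derivative c * x ^ k) (at x)"
      using DERIV_pow[of "Suc k" x UNIV] by (simp add: c_def add.commute)
    have l: "((\<lambda>x. (ln x)\<^sup>2 / c - 2 * ln x / c\<^sup>2 + 2 / c ^ 3) has_real_derivative 2 * ln x / (x * c) - 2 / (x * c\<^sup>2)) (at x)"
      using x c by (auto intro!: derivative_eq_intros simp: field_simps)
    have "?F = (\<lambda>x. x ^ Suc k * ((ln x)\<^sup>2 / c - 2 * ln x / c\<^sup>2 + 2 / c ^ 3))"
      by (simp add: algebra_simps)
    moreover have "c * x ^ k * ((ln x)\<^sup>2 / c - 2 * ln x / c\<^sup>2 + 2 / c ^ 3) + (2 * ln x / (x * c) - 2 / (x * c\<^sup>2)) * x ^ Suc k =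
        x ^ k * (ln x)\<^sup>2"
      using x c by (simp add: field_simps power2_eq_square power3_eq_cube)
    ultimately have "(?F has_real_derivative x ^ k * (ln x)\<^sup>2) (at x)"
      using DERIV_mult[OF d l] by simp
    then show "(?F has_vector_derivative x ^ k * (ln x)\<^sup>2) (at x)"
      by (simp add: has_real_derivative_iff_has_vector_derivative)
  qed simp
  then show ?thesis by (simp add: c_def)
qed

lemma ln_one_minus_sums:
  fixes x :: real
  assumes "0 < x" "x < 1"
  shows "(\<lambda>k. x ^ Suc k / real (Suc k)) sums - ln (1 - x)"
proof -
  have "(\<lambda>n. - (x ^ n) / real n) sums ln (1 - x)"
    using ln_series'[of "- x"] assms by simp
  then have "(\<lambda>n. x ^ n / real n) sums - ln (1 - x)"
    using sums_minus by fastforce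
  then show ?thesis
    using sums_Suc_iff[of "\<lambda>n. x ^ n / real n"] by simp
qed

text \<open>The power series of \<open>ln (1 - x)\<close> is integrated term by term. Both
  logarithms are negative, so the terms are nonnegative and monotone convergence justifies the
  exchange.\<close>

lemma has_integral_power_ln_ln:
  assumes S: "(\<lambda>k. 1 / (real (Suc k) * (real (Suc k) + real m + 1)\<^sup>2)) sums S"
  shows "((\<lambda>x::real. x ^ m * ln x * ln (1 - x)) has_integral S) {0<..<1}"
proof -
  define f where "f n x = (\<Sum>k<n. x ^ m * (- ln x) * (x ^ Suc k / real (Suc k)))" for n and x :: real
  define I where "I n = (\<Sum>k<n. 1 / (real (Suc k) * (real (Suc k) + real m + 1)\<^sup>2))" for n
  have f: "(f n has_integral I n) {0<..<1}" for n
  proof -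
    have "((\<lambda>x::real. x ^ m * (- ln x) * (x ^ Suc k / real (Suc k))) has_integral
        1 / (real (Suc k) * (real (Suc k) + real m + 1)\<^sup>2)) {0..1}" for k
    proof -
      have "((\<lambda>x. (- 1 / real (Suc k)) * (x ^ (m + Suc k) * ln x)) has_integral
          (- 1 / real (Suc k)) * (- 1 / (real (m + Suc k) + 1)\<^sup>2)) {0..1}"
        by (rule has_integral_mult_right[OF has_integral_power_ln])
      moreover have "(\<lambda>x. (- 1 / real (Suc k)) * (x ^ (m + Suc k) * ln x)) = (\<lambda>x. x ^ m * (- ln x) * (x ^ Suc k / real (Suc k)))"
        by (simp add: power_add fun_eq_iff del: of_nat_Suc)
      ultimately show ?thesis by (simp add: add_ac del: power_Suc)
    qed
    then have "(f n has_integral I n) {0..1}"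
      unfolding f_def I_def by (intro has_integral_sum) auto
    then show ?thesis by (simp add: has_integral_Icc_iff_Ioo)
  qed
  have "(\<lambda>x::real. x ^ m * ln x * ln (1 - x)) integrable_on {0<..<1} \<and>
      (\<lambda>n. integral {0<..<1} (f n)) \<longlonglongrightarrow> integral {0<..<1} (\<lambda>x::real. x ^ m * ln x * ln (1 - x))"
  proof (rule monotone_convergence_increasing)
    show "f n integrable_on {0<..<1}" for n using f by blast
    show "f n x \<le> f (Suc n) x" if "x \<in> {0<..<1}" for n x
      using that mult_nonneg_nonneg[of "x ^ m * (- ln x)" "x ^ Suc n / real (Suc n)"] mult_nonneg_nonneg[of "x ^ m" "- ln x"]
      by (simp add: f_def)
    show "(\<lambda>n. f n x) \<longlonglongrightarrow> x ^ m * ln x * ln (1 - x)" if "x \<in> {0<..<1}" for x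
    proof -
      have "(\<lambda>k. x ^ m * (- ln x) * (x ^ Suc k / real (Suc k))) sums (x ^ m * (- ln x) * - ln (1 - x))"
        using ln_one_minus_sums[of x] that by (intro sums_mult) auto
      then show ?thesis by (simp add: sums_def f_def)
    qed
    have "(\<lambda>n. integral {0<..<1} (f n)) = I" using f by (auto simp: integral_unique)
    moreover have "I \<longlonglongrightarrow> S" using S by (simp add: sums_def I_def[abs_def])
    then have "Bseq I" by (intro convergent_imp_Bseq convergentI)
    ultimately show "bounded (range (\<lambda>n. integral {0<..<1} (f n)))"
      by (simp only: Bseq_eq_bounded)
  qed
  moreover have "(\<lambda>n. integral {0<..<1} (f n)) \<longlonglongrightarrow> S"
  proof -
    have "(\<lambda>n. integral {0<..<1} (f n)) = I" using f by (auto simp: integral_unique)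
    then show ?thesis using S by (simp only:) (simp add: sums_def I_def[abs_def])
  qed
  ultimately show ?thesis
    using LIMSEQ_unique by (metis has_integral_integral)
qed

lemma sums_shifted_squares:
  "(\<lambda>k. 1 / (real (Suc k) + real c)\<^sup>2) sums (pi\<^sup>2 / 6 - (\<Sum>k<c. 1 / (real (Suc k))\<^sup>2))"
proof -
  have "(\<lambda>k. 1 / (real (Suc k))\<^sup>2) sums (pi\<^sup>2 / 6)"
    using inverse_squares_sums by (simp add: add.commute)
  from sums_split_initial_segment[OF this, of c] show ?thesis
    by (simp add: add_ac)
qed

lemma sums_shifted_difference:
  "(\<lambda>k. 1 / real (Suc k) - 1 / (real (Suc k) + real c)) sums (\<Sum>k<c. 1 / real (Suc k))"
proof (induction c)
  case (Suc c)
  have "(\<lambda>k. 1 / (real (k + c) + 1)) \<longlonglongrightarrow> 0" by real_asymp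
  then have "(\<lambda>k. 1 / (real (k + c) + 1) - 1 / (real (Suc k + c) + 1)) sums (1 / (real (0 + c) + 1) - 0)"
    by (rule telescope_sums')
  from sums_add[OF Suc this] show ?case by (simp add: add_ac)
qed simp

text \<open>Partial fractions: one part telescopes to a harmonic number, the other is a tail of the
  Basel series. This is how the square of pi enters.\<close>

lemma sums_reciprocal_square:
  assumes "c > 0"
  shows "(\<lambda>k. 1 / (real (Suc k) * (real (Suc k) + real c)\<^sup>2)) sums
    ((\<Sum>k<c. 1 / real (Suc k)) / (real c)\<^sup>2 - (pi\<^sup>2 / 6 - (\<Sum>k<c. 1 / (real (Suc k))\<^sup>2)) / real c)"
proof -
  have "(\<lambda>k. (1 / real (Suc k) - 1 / (real (Suc k) + real c)) / (real c)\<^sup>2 - 1 / (real (Suc k) + real c)\<^sup>2 / real c) sums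
    ((\<Sum>k<c. 1 / real (Suc k)) / (real c)\<^sup>2 - (pi\<^sup>2 / 6 - (\<Sum>k<c. 1 / (real (Suc k))\<^sup>2)) / real c)"
    by (intro sums_diff sums_divide sums_shifted_difference sums_shifted_squares)
  moreover have "(1 / x - 1 / (x + d)) / d\<^sup>2 - 1 / (x + d)\<^sup>2 / d = 1 / (x * (x + d)\<^sup>2)" if "x > 0" "d > 0" for x d :: real
  proof -
    have "x \<noteq> 0" "d \<noteq> 0" "x + d \<noteq> 0" using that by auto
    then show ?thesis by (simp add: divide_simps power2_eq_square)
  qed
  ultimately show ?thesis using assms by (simp del: of_nat_Suc)
qed

lemma correlation_bounds:
  assumes "x = pi\<^sup>2"
  defines "s \<equiv> 28 / 15 - 19 / 100 * x" and "v \<equiv> 2231 / 360 - 361 / 600 * x" and "w \<equiv> 7 / 10 - 3 / 50 * x"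
  shows "\<bar>s - (-0.00855817)\<bar> < 0.000000005" "v > 0" "w > 0" "\<bar>s / (sqrt v * sqrt w) - (-0.0512112)\<bar> < 0.00000005"
proof -
  have "3.1415926535\<^sup>2 < pi\<^sup>2" "pi\<^sup>2 < 3.1415926537\<^sup>2"
    using pi_bounds by (intro power_strict_mono; simp)+
  then have x: "9.86960440052 < x" "x < 9.86960440179" by (simp_all add: assms(1) power2_eq_square)
  show s: "\<bar>s - (-0.00855817)\<bar> < 0.000000005" using x by (simp add: s_def abs_less_iff)
  have v: "0.2590102403 < v" "v < 0.2590102418" using x by (simp_all add: v_def)
  have w: "0.10782373589 < w" "w < 0.10782373597" using x by (simp_all add: w_def)
  have t: "0.00855816943 < - s" "- s < 0.00855816968" using x by (simp_all add: s_def)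
  show "v > 0" "w > 0" using v w by auto
  have vw: "0.2590102403 * 0.10782373589 < v * w" "v * w < 0.2590102418 * 0.10782373597"
    using v w by (intro mult_strict_mono; simp)+
  \<comment> \<open>The two decimals are the ends of the tolerance interval for the absolute value
    of the quotient. All quantities are positive, so it suffices to compare squares, that is,
    rational numbers; as \<open>s < 0\<close>, the lower estimate of \<open>- s\<close> bounds the
    quotient from above.\<close>
  have lo: "0.05121115 * sqrt (v * w) < - s"
  proof -
    have "0.05121115 * sqrt (v * w) = sqrt (0.05121115\<^sup>2 * (v * w))" by (simp add: real_sqrt_mult)
    also have "\<dots> < sqrt (0.00855816943\<^sup>2)"
      using vw by (intro real_sqrt_less_mono) (simp add: power2_eq_square)
    finally show ?thesis using t by simp
  qed
  have hi: "- s < 0.05121125 * sqrt (v * w)"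
  proof -
    have "- s < sqrt (0.00855816968\<^sup>2)" using t by simp
    also have "\<dots> < sqrt (0.05121125\<^sup>2 * (v * w))"
      using vw by (intro real_sqrt_less_mono) (simp add: power2_eq_square)
    also have "\<dots> = 0.05121125 * sqrt (v * w)" by (simp add: real_sqrt_mult)
    finally show ?thesis .
  qed
  have pos: "sqrt (v * w) > 0" using v w by simp
  have "s / sqrt (v * w) < -0.05121115" "-0.05121125 < s / sqrt (v * w)"
    using lo hi pos by (simp_all add: field_simps)
  moreover have "\<bar>r - (-0.0512112)\<bar> < 0.00000005" if "r < -0.05121115" "-0.05121125 < r" for r :: real
    by (rule abs_less_iff[THEN iffD2]) (use that in simp)
  ultimately show "\<bar>s / (sqrt v * sqrt w) - (-0.0512112)\<bar> < 0.00000005"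
    unfolding real_sqrt_mult[symmetric] by blast
qed

section \<open>The limit of the centred toll\<close>

text \<open>\<open>PC\<close> and \<open>PS\<close> are the limits of \<open>mean_toll\<close> per
  key for comparisons and swaps; on the simplex, \<open>(x + y) - x * (x + y)\<close> becomes
  \<open>(x + y) * (y + z)\<close>.\<close>

definition PC :: "real \<Rightarrow> real \<Rightarrow> real \<Rightarrow> real" where
  "PC x y z = 1 + (x + y) * (y + z) + (x + y) * z"

definition PS :: "real \<Rightarrow> real \<Rightarrow> real \<Rightarrow> real" where
  "PS x y z = x + (x + y) * z"

definition u_ln :: "real \<Rightarrow> real" where
  "u_ln x = x * ln x"

lemma continuous_on_u_ln:
  "continuous_on A g \<Longrightarrow> g ` A \<subseteq> {0..1} \<Longrightarrow> continuous_on A (\<lambda>w. u_ln (g w))"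
  unfolding u_ln_def by (rule continuous_on_compose2[OF x_ln_continuous(1)])

lemma measurable_u_ln [measurable]: "u_ln \<in> borel_measurable borel"
  unfolding u_ln_def by measurable

section \<open>Integrals of products of \<open>PC\<close>, \<open>PS\<close> and \<open>u_ln\<close>
  over the simplex\<close>

lemma has_integral_power_Ioo: "((\<lambda>x::real. x ^ k) has_integral 1 / (real k + 1)) {0<..<1}"
proof -
  have "((\<lambda>x::real. x ^ k) has_integral 1 ^ Suc k / (real k + 1) - 0 ^ Suc k / (real k + 1)) {0..1}"
  proof (rule fundamental_theorem_of_calculus)
    fix x :: real
    have "real k + 1 \<noteq> 0" by linarith
    then have "((\<lambda>x. x ^ Suc k / (real k + 1)) has_real_derivative x ^ k) (at x within {0..1})"
      using DERIV_cdivide[OF DERIV_pow[of "Suc k" x "{0..1}"], of "real k + 1"] by (simp add: add.commute)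
    then show "((\<lambda>x. x ^ Suc k / (real k + 1)) has_vector_derivative x ^ k) (at x within {0..1})"
      by (simp add: has_real_derivative_iff_has_vector_derivative)
  qed simp
  then show ?thesis by (simp add: has_integral_Icc_iff_Ioo)
qed

lemma has_integral_power_ln_Ioo: "((\<lambda>x::real. x ^ k * ln x) has_integral - 1 / (real k + 1)\<^sup>2) {0<..<1}"
  using has_integral_power_ln by (simp only: has_integral_Icc_iff_Ioo)

text \<open>Inner integrals in \<open>y\<close>. The factor \<open>k\<close> carries what does not
  depend on \<open>y\<close>, and the coefficients may depend on the outer variable.\<close>

lemma has_integral_poly4:
  fixes b :: real
  assumes "0 \<le> b"
  shows "((\<lambda>y. k * (a0 + a1 * y + a2 * y ^ 2 + a3 * y ^ 3 + a4 * y ^ 4)) has_integral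
    k * (a0 * b + a1 * b ^ 2 / 2 + a2 * b ^ 3 / 3 + a3 * b ^ 4 / 4 + a4 * b ^ 5 / 5)) {0<..<b}"
proof -
  let ?F = "\<lambda>y. k * (a0 * y + a1 * y ^ 2 / 2 + a2 * y ^ 3 / 3 + a3 * y ^ 4 / 4 + a4 * y ^ 5 / 5)"
  have "((\<lambda>y. k * (a0 + a1 * y + a2 * y ^ 2 + a3 * y ^ 3 + a4 * y ^ 4)) has_integral ?F b - ?F 0) {0..b}"
  proof (rule fundamental_theorem_of_calculus[OF assms])
    fix y :: real
    have "(?F has_real_derivative k * (a0 + a1 * y + a2 * y ^ 2 + a3 * y ^ 3 + a4 * y ^ 4)) (at y within {0..b})"
      by (auto intro!: derivative_eq_intros)
    then show "(?F has_vector_derivative k * (a0 + a1 * y + a2 * y ^ 2 + a3 * y ^ 3 + a4 * y ^ 4)) (at y within {0..b})"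
      by (simp add: has_real_derivative_iff_has_vector_derivative)
  qed
  then show ?thesis by (simp add: has_integral_Icc_iff_Ioo)
qed

text \<open>The pattern of the following lemmas: \<open>?f\<close> with \<open>z = 1 - x - y\<close>
  is expanded in powers of \<open>y\<close>, whose coefficients in \<open>x\<close> are the
  arguments of \<open>has_integral_poly4\<close>; \<open>?G\<close> is the result of integrating
  \<open>y\<close> over \<open>{0<..<1 - x}\<close>, and the limit is twice its integral.\<close>

lemma limit_PC_PC: "lattice_limit (\<lambda>x y z. PC x y z * PC x y z) ((229 / 90))"
proof -
  let ?f = "\<lambda>x y z. PC x y z * PC x y z"
  let ?G = "\<lambda>x::real. (43 / 15) * x ^ 0 + (- (17 / 6)) * x ^ 1 + (- (5 / 3)) * x ^ 2 + (1 / 3) * x ^ 3 + (7 / 3) * x ^ 4 + (- (31 / 30)) * x ^ 5"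
  have outer: "(?G has_integral (229 / 180)) {0<..<1}"
    by (rule has_integral_eq_rhs, (rule has_integral_add has_integral_mult_right has_integral_power_Ioo)+) (simp add: power2_eq_square)
  have inner: "((\<lambda>y. ?f x y (1 - x - y)) has_integral ?G x) {0<..<1 - x}" if "0 < x" "x < 1" for x
    by (rule has_integral_eq_rhs[OF has_integral_eq[OF _ has_integral_poly4[of "1 - x" "1" "1 * x ^ 0 + 4 * x ^ 1 + (- 8) * x ^ 3 + 4 * x ^ 4" "4 * x ^ 0 + 2 * x ^ 1 + (- 20) * x ^ 2 + 12 * x ^ 3" "2 * x ^ 0 + (- 16) * x ^ 1 + 13 * x ^ 2" "(- 4) * x ^ 0 + 6 * x ^ 1" "1 * x ^ 0"]]])
       (use that in \<open>simp_all add: PC_def power_numeral_reduce, simp_all add: field_simps\<close>)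
  have "lattice_limit ?f (2 * ((229 / 180)))"
    by (rule lattice_limit_continuous[where f = ?f and G = ?G, OF _ _ inner outer])
       (auto intro!: continuous_intros continuous_on_u_ln simp: PC_def)
  then show ?thesis by simp
qed

lemma limit_PC_PS: "lattice_limit (\<lambda>x y z. PC x y z * PS x y z) ((23 / 30))"
proof -
  let ?f = "\<lambda>x y z. PC x y z * PS x y z"
  let ?G = "\<lambda>x::real. (17 / 60) * x ^ 0 + (19 / 12) * x ^ 1 + (- 2) * x ^ 2 + (- (4 / 3)) * x ^ 3 + (23 / 12) * x ^ 4 + (- (9 / 20)) * x ^ 5"
  have outer: "(?G has_integral (23 / 60)) {0<..<1}"
    by (rule has_integral_eq_rhs, (rule has_integral_add has_integral_mult_right has_integral_power_Ioo)+) (simp add: power2_eq_square)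
  have inner: "((\<lambda>y. ?f x y (1 - x - y)) has_integral ?G x) {0<..<1 - x}" if "0 < x" "x < 1" for x
    by (rule has_integral_eq_rhs[OF has_integral_eq[OF _ has_integral_poly4[of "1 - x" "1" "2 * x ^ 1 + 3 * x ^ 2 + (- 6) * x ^ 3 + 2 * x ^ 4" "1 * x ^ 0 + 4 * x ^ 1 + (- 14) * x ^ 2 + 7 * x ^ 3" "1 * x ^ 0 + (- 11) * x ^ 1 + 9 * x ^ 2" "(- 3) * x ^ 0 + 5 * x ^ 1" "1 * x ^ 0"]]])
       (use that in \<open>simp_all add: PC_def PS_def power_numeral_reduce, simp_all add: field_simps\<close>)
  have "lattice_limit ?f (2 * ((23 / 60)))"
    by (rule lattice_limit_continuous[where f = ?f and G = ?G, OF _ _ inner outer])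
       (auto intro!: continuous_intros continuous_on_u_ln simp: PC_def PS_def)
  then show ?thesis by simp
qed

lemma limit_PS_PS: "lattice_limit (\<lambda>x y z. PS x y z * PS x y z) ((3 / 10))"
proof -
  let ?f = "\<lambda>x y z. PS x y z * PS x y z"
  let ?G = "\<lambda>x::real. (1 / 30) * x ^ 0 + (1 / 3) * x ^ 1 + 1 * x ^ 2 + (- (7 / 3)) * x ^ 3 + (7 / 6) * x ^ 4 + (- (1 / 5)) * x ^ 5"
  have outer: "(?G has_integral (3 / 20)) {0<..<1}"
    by (rule has_integral_eq_rhs, (rule has_integral_add has_integral_mult_right has_integral_power_Ioo)+) (simp add: power2_eq_square)
  have inner: "((\<lambda>y. ?f x y (1 - x - y)) has_integral ?G x) {0<..<1 - x}" if "0 < x" "x < 1" for x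
    by (rule has_integral_eq_rhs[OF has_integral_eq[OF _ has_integral_poly4[of "1 - x" "1" "4 * x ^ 2 + (- 4) * x ^ 3 + 1 * x ^ 4" "4 * x ^ 1 + (- 10) * x ^ 2 + 4 * x ^ 3" "1 * x ^ 0 + (- 8) * x ^ 1 + 6 * x ^ 2" "(- 2) * x ^ 0 + 4 * x ^ 1" "1 * x ^ 0"]]])
       (use that in \<open>simp_all add: PS_def power_numeral_reduce, simp_all add: field_simps\<close>)
  have "lattice_limit ?f (2 * ((3 / 20)))"
    by (rule lattice_limit_continuous[where f = ?f and G = ?G, OF _ _ inner outer])
       (auto intro!: continuous_intros continuous_on_u_ln simp: PS_def)
  then show ?thesis by simp
qed

text \<open>The logarithm sits in the outer variable, so the inner integrand is a polynomial in
  \<open>y\<close> times the constant \<open>x * ln x\<close>.\<close>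

lemma limit_PC_ln1: "lattice_limit (\<lambda>x y z. PC x y z * u_ln x) (- (53 / 120))"
proof -
  let ?f = "\<lambda>x y z. PC x y z * u_ln x"
  let ?G = "\<lambda>x::real. (5 / 3) * (x ^ 1 * ln x) + (- (3 / 2)) * (x ^ 2 * ln x) + (- 1) * (x ^ 3 * ln x) + (5 / 6) * (x ^ 4 * ln x)"
  have outer: "(?G has_integral - (53 / 240)) {0<..<1}"
    by (rule has_integral_eq_rhs, (rule has_integral_add has_integral_mult_right has_integral_power_ln_Ioo)+) (simp add: power2_eq_square)
  have inner: "((\<lambda>y. ?f x y (1 - x - y)) has_integral ?G x) {0<..<1 - x}" if "0 < x" "x < 1" for x
    by (rule has_integral_eq_rhs[OF has_integral_eq[OF _ has_integral_poly4[of "1 - x" "x * ln x" "1 * x ^ 0 + 2 * x ^ 1 + (- 2) * x ^ 2" "2 * x ^ 0 + (- 3) * x ^ 1" "(- 1) * x ^ 0" "0" "0"]]])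
       (use that in \<open>simp_all add: PC_def u_ln_def power_numeral_reduce, simp_all add: field_simps\<close>)
  have "lattice_limit ?f (2 * (- (53 / 240)))"
    by (rule lattice_limit_continuous[where f = ?f and G = ?G, OF _ _ inner outer])
       (auto intro!: continuous_intros continuous_on_u_ln simp: PC_def)
  then show ?thesis by simp
qed

text \<open>Stands for the product of \<open>PC x y z\<close> with \<open>u_ln y\<close>: the
  coordinates are exchanged to keep the logarithm in the outer variable. The exchange of
  \<open>x\<close> and \<open>z\<close> treats \<open>u_ln z\<close> likewise.\<close>

lemma limit_PC_ln2: "lattice_limit (\<lambda>x y z. PC y x z * u_ln x) (- (799 / 1800))"
proof -
  let ?f = "\<lambda>x y z. PC y x z * u_ln x"
  let ?G = "\<lambda>x::real. (4 / 3) * (x ^ 1 * ln x) + (- (1 / 2)) * (x ^ 2 * ln x) + (- 1) * (x ^ 3 * ln x) + (1 / 6) * (x ^ 4 * ln x)"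
  have outer: "(?G has_integral - (799 / 3600)) {0<..<1}"
    by (rule has_integral_eq_rhs, (rule has_integral_add has_integral_mult_right has_integral_power_ln_Ioo)+) (simp add: power2_eq_square)
  have inner: "((\<lambda>y. ?f x y (1 - x - y)) has_integral ?G x) {0<..<1 - x}" if "0 < x" "x < 1" for x
    by (rule has_integral_eq_rhs[OF has_integral_eq[OF _ has_integral_poly4[of "1 - x" "x * ln x" "1 * x ^ 0 + 2 * x ^ 1 + (- 1) * x ^ 2" "2 * x ^ 0 + (- 3) * x ^ 1" "(- 2) * x ^ 0" "0" "0"]]])
       (use that in \<open>simp_all add: PC_def u_ln_def power_numeral_reduce, simp_all add: field_simps\<close>)
  have "lattice_limit ?f (2 * (- (799 / 3600)))"
    by (rule lattice_limit_continuous[where f = ?f and G = ?G, OF _ _ inner outer])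
       (auto intro!: continuous_intros continuous_on_u_ln simp: PC_def)
  then show ?thesis by simp
qed

lemma limit_PC_ln3: "lattice_limit (\<lambda>x y z. PC z y x * u_ln x) (- (1607 / 3600))"
proof -
  let ?f = "\<lambda>x y z. PC z y x * u_ln x"
  let ?G = "\<lambda>x::real. (3 / 2) * (x ^ 1 * ln x) + (- (1 / 2)) * (x ^ 2 * ln x) + (- (5 / 2)) * (x ^ 3 * ln x) + (3 / 2) * (x ^ 4 * ln x)"
  have outer: "(?G has_integral - (1607 / 7200)) {0<..<1}"
    by (rule has_integral_eq_rhs, (rule has_integral_add has_integral_mult_right has_integral_power_ln_Ioo)+) (simp add: power2_eq_square)
  have inner: "((\<lambda>y. ?f x y (1 - x - y)) has_integral ?G x) {0<..<1 - x}" if "0 < x" "x < 1" for x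
    by (rule has_integral_eq_rhs[OF has_integral_eq[OF _ has_integral_poly4[of "1 - x" "x * ln x" "1 * x ^ 0 + 2 * x ^ 1 + (- 2) * x ^ 2" "1 * x ^ 0 + (- 1) * x ^ 1" "0" "0" "0"]]])
       (use that in \<open>simp_all add: PC_def u_ln_def power_numeral_reduce, simp_all add: field_simps\<close>)
  have "lattice_limit ?f (2 * (- (1607 / 7200)))"
    by (rule lattice_limit_continuous[where f = ?f and G = ?G, OF _ _ inner outer])
       (auto intro!: continuous_intros continuous_on_u_ln simp: PC_def)
  then show ?thesis by simp
qed

lemma limit_PS_ln1: "lattice_limit (\<lambda>x y z. PS x y z * u_ln x) (- (521 / 3600))"
proof -
  let ?f = "\<lambda>x y z. PS x y z * u_ln x"
  let ?G = "\<lambda>x::real. (1 / 6) * (x ^ 1 * ln x) + 1 * (x ^ 2 * ln x) + (- (3 / 2)) * (x ^ 3 * ln x) + (1 / 3) * (x ^ 4 * ln x)"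
  have outer: "(?G has_integral - (521 / 7200)) {0<..<1}"
    by (rule has_integral_eq_rhs, (rule has_integral_add has_integral_mult_right has_integral_power_ln_Ioo)+) (simp add: power2_eq_square)
  have inner: "((\<lambda>y. ?f x y (1 - x - y)) has_integral ?G x) {0<..<1 - x}" if "0 < x" "x < 1" for x
    by (rule has_integral_eq_rhs[OF has_integral_eq[OF _ has_integral_poly4[of "1 - x" "x * ln x" "2 * x ^ 1 + (- 1) * x ^ 2" "1 * x ^ 0 + (- 2) * x ^ 1" "(- 1) * x ^ 0" "0" "0"]]])
       (use that in \<open>simp_all add: PS_def u_ln_def power_numeral_reduce, simp_all add: field_simps\<close>)
  have "lattice_limit ?f (2 * (- (521 / 7200)))"
    by (rule lattice_limit_continuous[where f = ?f and G = ?G, OF _ _ inner outer])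
       (auto intro!: continuous_intros continuous_on_u_ln simp: PS_def)
  then show ?thesis by simp
qed

lemma limit_PS_ln2: "lattice_limit (\<lambda>x y z. PS y x z * u_ln x) (- (31 / 225))"
proof -
  let ?f = "\<lambda>x y z. PS y x z * u_ln x"
  let ?G = "\<lambda>x::real. (2 / 3) * (x ^ 1 * ln x) + (- 1) * (x ^ 2 * ln x) + (1 / 3) * (x ^ 4 * ln x)"
  have outer: "(?G has_integral - (31 / 450)) {0<..<1}"
    by (rule has_integral_eq_rhs, (rule has_integral_add has_integral_mult_right has_integral_power_ln_Ioo)+) (simp add: power2_eq_square)
  have inner: "((\<lambda>y. ?f x y (1 - x - y)) has_integral ?G x) {0<..<1 - x}" if "0 < x" "x < 1" for x
    by (rule has_integral_eq_rhs[OF has_integral_eq[OF _ has_integral_poly4[of "1 - x" "x * ln x" "1 * x ^ 1 + (- 1) * x ^ 2" "2 * x ^ 0 + (- 2) * x ^ 1" "(- 1) * x ^ 0" "0" "0"]]])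
       (use that in \<open>simp_all add: PS_def u_ln_def power_numeral_reduce, simp_all add: field_simps\<close>)
  have "lattice_limit ?f (2 * (- (31 / 450)))"
    by (rule lattice_limit_continuous[where f = ?f and G = ?G, OF _ _ inner outer])
       (auto intro!: continuous_intros continuous_on_u_ln simp: PS_def)
  then show ?thesis by simp
qed

lemma limit_PS_ln3: "lattice_limit (\<lambda>x y z. PS z y x * u_ln x) (- (57 / 400))"
proof -
  let ?f = "\<lambda>x y z. PS z y x * u_ln x"
  let ?G = "\<lambda>x::real. (1 / 2) * (x ^ 1 * ln x) + (- (3 / 2)) * (x ^ 3 * ln x) + 1 * (x ^ 4 * ln x)"
  have outer: "(?G has_integral - (57 / 800)) {0<..<1}"
    by (rule has_integral_eq_rhs, (rule has_integral_add has_integral_mult_right has_integral_power_ln_Ioo)+) (simp add: power2_eq_square)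
  have inner: "((\<lambda>y. ?f x y (1 - x - y)) has_integral ?G x) {0<..<1 - x}" if "0 < x" "x < 1" for x
    by (rule has_integral_eq_rhs[OF has_integral_eq[OF _ has_integral_poly4[of "1 - x" "x * ln x" "1 * x ^ 0 + (- 1) * x ^ 2" "(- 1) * x ^ 0" "0" "0" "0"]]])
       (use that in \<open>simp_all add: PS_def u_ln_def power_numeral_reduce, simp_all add: field_simps\<close>)
  have "lattice_limit ?f (2 * (- (57 / 800)))"
    by (rule lattice_limit_continuous[where f = ?f and G = ?G, OF _ _ inner outer])
       (auto intro!: continuous_intros continuous_on_u_ln simp: PS_def)
  then show ?thesis by simp
qed

lemma limit_u_ln_sq: "lattice_limit (\<lambda>x y z. u_ln x * u_ln x) (4 / 27 - 1 / 16)"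
proof -
  let ?G = "\<lambda>x::real. x ^ 2 * (ln x)\<^sup>2 - x ^ 3 * (ln x)\<^sup>2"
  have "(?G has_integral 2 / (real 2 + 1) ^ 3 - 2 / (real 3 + 1) ^ 3) {0..1}"
    by (intro has_integral_diff has_integral_power_ln2)
  then have outer: "(?G has_integral 2 / 27 - 1 / 32) {0<..<1}"
    by (simp add: has_integral_Icc_iff_Ioo)
  have inner: "((\<lambda>y. u_ln x * u_ln x) has_integral ?G x) {0<..<1 - x}" if "0 < x" "x < 1" for x
    by (rule has_integral_eq_rhs[OF has_integral_eq[OF _ has_integral_poly4[of "1 - x" "u_ln x * u_ln x" 1 0 0 0 0]]])
       (use that in \<open>simp_all add: u_ln_def power2_eq_square power3_eq_cube algebra_simps\<close>)
  have "lattice_limit (\<lambda>x y z. u_ln x * u_ln x) (2 * (2 / 27 - 1 / 32))"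
    by (rule lattice_limit_continuous[where f = "\<lambda>x y z. u_ln x * u_ln x" and G = ?G, OF _ _ inner outer])
       (auto intro!: continuous_intros continuous_on_u_ln)
  then show ?thesis by simp
qed

lemma has_integral_u_ln:
  assumes "0 < w" "w < 1"
  shows "(u_ln has_integral w\<^sup>2 / 2 * ln w - w\<^sup>2 / 4) {0<..<w}"
proof -
  let ?F = "\<lambda>y::real. y * (y * ln y) / 2 - y\<^sup>2 / 4"
  have "(u_ln has_integral ?F w - ?F 0) {0..w}"
  proof (rule fundamental_theorem_of_calculus_interior)
    show "continuous_on {0..w} ?F"
      using assms by (intro continuous_intros continuous_on_subset[OF x_ln_continuous(1)]) auto
    fix y assume y: "y \<in> {0<..<w}"
    have "(?F has_real_derivative u_ln y) (at y)"
      using y by (auto intro!: derivative_eq_intros simp: u_ln_def field_simps)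
    then show "(?F has_vector_derivative u_ln y) (at y)"
      by (simp add: has_real_derivative_iff_has_vector_derivative)
  qed (use assms in simp)
  then show ?thesis by (simp add: has_integral_Icc_iff_Ioo power2_eq_square mult_ac)
qed

lemma limit_u_ln_u_ln: "lattice_limit (\<lambda>x y z. u_ln x * u_ln y) (187 / 864 - pi\<^sup>2 / 72)"
proof -
  \<comment> \<open>The inner integral of \<open>u_ln\<close> up to \<open>1 - x\<close> is
    \<open>(1 - x)^2 / 2 * ln (1 - x) - (1 - x)^2 / 4\<close>; multiplied by \<open>x * ln x\<close>
    and expanded in powers of \<open>x\<close>, it gives the coefficients of
    \<open>?G\<close>.\<close>
  let ?L = "\<lambda>k x::real. x ^ k * ln x * ln (1 - x)"
  let ?G = "\<lambda>x::real. ((1 / 2) * ?L 1 x + - 1 * ?L 2 x + (1 / 2) * ?L 3 x) +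
    (- (1 / 4) * (x ^ 1 * ln x) + (1 / 2) * (x ^ 2 * ln x) + - (1 / 4) * (x ^ 3 * ln x))"
  have "(?L 1 has_integral 1 - pi\<^sup>2 / 12) {0<..<1}"
  proof (rule has_integral_power_ln_ln)
    have "(\<Sum>k<2. 1 / real (Suc k)) / (real 2)\<^sup>2 - (pi\<^sup>2 / 6 - (\<Sum>k<2. 1 / (real (Suc k))\<^sup>2)) / real 2 = 1 - pi\<^sup>2 / 12"
      by (simp add: eval_nat_numeral field_simps)
    then show "(\<lambda>k. 1 / (real (Suc k) * (real (Suc k) + real 1 + 1)\<^sup>2)) sums (1 - pi\<^sup>2 / 12)"
      using sums_reciprocal_square[of 2] by (simp add: add_ac)
  qed
  moreover have "(?L 2 has_integral 71 / 108 - pi\<^sup>2 / 18) {0<..<1}"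
  proof (rule has_integral_power_ln_ln)
    have "(\<Sum>k<3. 1 / real (Suc k)) / (real 3)\<^sup>2 - (pi\<^sup>2 / 6 - (\<Sum>k<3. 1 / (real (Suc k))\<^sup>2)) / real 3 = 71 / 108 - pi\<^sup>2 / 18"
      by (simp add: eval_nat_numeral field_simps)
    then show "(\<lambda>k. 1 / (real (Suc k) * (real (Suc k) + real 2 + 1)\<^sup>2)) sums (71 / 108 - pi\<^sup>2 / 18)"
      using sums_reciprocal_square[of 3] by (simp add: add_ac)
  qed
  moreover have "(?L 3 has_integral 35 / 72 - pi\<^sup>2 / 24) {0<..<1}"
  proof (rule has_integral_power_ln_ln)
    have "(\<Sum>k<4. 1 / real (Suc k)) / (real 4)\<^sup>2 - (pi\<^sup>2 / 6 - (\<Sum>k<4. 1 / (real (Suc k))\<^sup>2)) / real 4 = 35 / 72 - pi\<^sup>2 / 24"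
      by (simp add: eval_nat_numeral field_simps)
    then show "(\<lambda>k. 1 / (real (Suc k) * (real (Suc k) + real 3 + 1)\<^sup>2)) sums (35 / 72 - pi\<^sup>2 / 24)"
      using sums_reciprocal_square[of 4] by (simp add: add_ac)
  qed
  ultimately have "(?G has_integral ((1 / 2) * (1 - pi\<^sup>2 / 12) + - 1 * (71 / 108 - pi\<^sup>2 / 18) + (1 / 2) * (35 / 72 - pi\<^sup>2 / 24)) +
    (- (1 / 4) * (- 1 / (real 1 + 1)\<^sup>2) + (1 / 2) * (- 1 / (real 2 + 1)\<^sup>2) + - (1 / 4) * (- 1 / (real 3 + 1)\<^sup>2))) {0<..<1}"
    by (intro has_integral_add has_integral_mult_right has_integral_power_ln_Ioo)
  then have outer: "(?G has_integral (187 / 1728 - pi\<^sup>2 / 144)) {0<..<1}"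
    by (rule has_integral_eq_rhs) (simp add: power2_eq_square field_simps)
  have inner: "((\<lambda>y. u_ln x * u_ln y) has_integral ?G x) {0<..<1 - x}" if "0 < x" "x < 1" for x
    by (rule has_integral_eq_rhs[OF has_integral_mult_right[OF has_integral_u_ln]])
       (use that in \<open>simp_all add: u_ln_def power2_eq_square power3_eq_cube field_simps\<close>)
  have "lattice_limit (\<lambda>x y z. u_ln x * u_ln y) (2 * (187 / 1728 - pi\<^sup>2 / 144))"
    by (rule lattice_limit_continuous[where f = "\<lambda>x y z. u_ln x * u_ln y" and G = ?G, OF _ _ inner outer])
       (auto intro!: continuous_intros continuous_on_u_ln)
  then show ?thesis by simp
qed

text \<open>The negative of Shannon's entropy. It is what remains, per key, of the terms
  \<open>n ln n\<close> when the means at the sizes are compared with the mean at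
  \<open>n\<close>.\<close>

definition entropy :: "real \<Rightarrow> real \<Rightarrow> real \<Rightarrow> real" where
  "entropy x y z = u_ln x + u_ln y + u_ln z"

lemma limit_times_entropy:
  assumes "lattice_limit (\<lambda>x y z. f x y z * u_ln x) K1" "lattice_limit (\<lambda>x y z. f y x z * u_ln x) K2"
    "lattice_limit (\<lambda>x y z. f z y x * u_ln x) K3"
  shows "lattice_limit (\<lambda>x y z. f x y z * entropy x y z) (K1 + K2 + K3)"
proof -
  have "lattice_limit (\<lambda>x y z. f x y z * u_ln y) K2" "lattice_limit (\<lambda>x y z. f x y z * u_ln z) K3"
    using assms(2,3) lattice_limit_permute(1)[of "\<lambda>x y z. f x y z * u_ln y" K2]
      lattice_limit_permute(2)[of "\<lambda>x y z. f x y z * u_ln z" K3] by simp_all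
  from lattice_limit_add[OF lattice_limit_add[OF assms(1) this(1)] this(2)] show ?thesis
    by (simp add: entropy_def distrib_left)
qed

lemma limit_PC_entropy: "lattice_limit (\<lambda>x y z. PC x y z * entropy x y z) (- 959 / 720)"
  using limit_times_entropy[OF limit_PC_ln1 limit_PC_ln2 limit_PC_ln3] by simp

lemma limit_PS_entropy: "lattice_limit (\<lambda>x y z. PS x y z * entropy x y z) (- 17 / 40)"
  using limit_times_entropy[OF limit_PS_ln1 limit_PS_ln2 limit_PS_ln3] by simp

lemma limit_entropy_sq: "lattice_limit (\<lambda>x y z. entropy x y z * entropy x y z) (14 / 9 - pi\<^sup>2 / 12)"
proof -
  have xz: "lattice_limit (\<lambda>x y z. u_ln x * u_ln z) (187 / 864 - pi\<^sup>2 / 72)"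
  proof -
    have "lattice_limit (\<lambda>x y z. u_ln z * u_ln y) (187 / 864 - pi\<^sup>2 / 72)"
      using lattice_limit_permute(2)[of "\<lambda>x y z. u_ln x * u_ln y"] limit_u_ln_u_ln by simp
    then show ?thesis
      using lattice_limit_permute(1)[of "\<lambda>x y z. u_ln z * u_ln y"] by (simp add: mult.commute)
  qed
  have base: "lattice_limit (\<lambda>x y z. entropy x y z * u_ln x) (4 / 27 - 1 / 16 + (187 / 864 - pi\<^sup>2 / 72) + (187 / 864 - pi\<^sup>2 / 72))"
    using lattice_limit_add[OF lattice_limit_add[OF limit_u_ln_sq limit_u_ln_u_ln] xz]
    by (simp add: entropy_def algebra_simps)
  \<comment> \<open>Since \<open>entropy\<close> is symmetric, the three limits required by
    \<open>limit_times_entropy\<close> coincide.\<close>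
  have "(\<lambda>x y z. entropy y x z * u_ln x) = (\<lambda>x y z. entropy x y z * u_ln x)"
    "(\<lambda>x y z. entropy z y x * u_ln x) = (\<lambda>x y z. entropy x y z * u_ln x)"
    by (simp_all add: fun_eq_iff entropy_def)
  with base have "lattice_limit (\<lambda>x y z. entropy y x z * u_ln x) (4 / 27 - 1 / 16 + (187 / 864 - pi\<^sup>2 / 72) + (187 / 864 - pi\<^sup>2 / 72))"
    "lattice_limit (\<lambda>x y z. entropy z y x * u_ln x) (4 / 27 - 1 / 16 + (187 / 864 - pi\<^sup>2 / 72) + (187 / 864 - pi\<^sup>2 / 72))"
    by (simp_all only:)
  note limit_times_entropy[of entropy, OF base this]
  moreover have "4 / 27 - 1 / 16 + (187 / 864 - pi\<^sup>2 / 72) + (187 / 864 - pi\<^sup>2 / 72) +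
      (4 / 27 - 1 / 16 + (187 / 864 - pi\<^sup>2 / 72) + (187 / 864 - pi\<^sup>2 / 72)) +
      (4 / 27 - 1 / 16 + (187 / 864 - pi\<^sup>2 / 72) + (187 / 864 - pi\<^sup>2 / 72)) = 14 / 9 - pi\<^sup>2 / 12"
    by (simp add: field_simps)
  ultimately show ?thesis by (simp only:)
qed

text \<open>
  The coefficients \<open>19 / 10\<close> and \<open>3 / 5\<close> are \<open>6 / 5\<close> times the mean tolls
  \<open>19 / 12\<close> and \<open>1 / 2\<close> per key; they are the leading coefficients of the mean costs.
\<close>

definition limit_toll :: "real \<Rightarrow> real \<Rightarrow> real \<Rightarrow> real \<Rightarrow> real \<Rightarrow> real" where
  "limit_toll \<alpha> \<beta> x y z = \<alpha> * PC x y z + \<beta> * PS x y z + (19 / 10 * \<alpha> + 3 / 5 * \<beta>) * entropy x y z"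

text \<open>A quadratic form in the weights: its diagonal coefficients belong to the variances of
  comparisons and swaps, and half its mixed coefficient to their covariance.\<close>

definition var_const :: "real \<Rightarrow> real \<Rightarrow> real" where
  "var_const \<alpha> \<beta> = \<alpha>\<^sup>2 * (2231 / 360 - 361 / 600 * pi\<^sup>2) + 2 * \<alpha> * \<beta> * (28 / 15 - 19 / 100 * pi\<^sup>2) +
    \<beta>\<^sup>2 * (7 / 10 - 3 / 50 * pi\<^sup>2)"

theorem limit_limit_toll_sq: "lattice_limit (\<lambda>x y z. (limit_toll \<alpha> \<beta> x y z)\<^sup>2) (var_const \<alpha> \<beta> / 2)"
proof -
  define \<kappa> where "\<kappa> = 19 / 10 * \<alpha> + 3 / 5 * \<beta>"
  have "lattice_limit (\<lambda>x y z. \<alpha>\<^sup>2 * (PC x y z * PC x y z) + 2 * \<alpha> * \<beta> * (PC x y z * PS x y z) + \<beta>\<^sup>2 * (PS x y z * PS x y z) +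
      2 * \<alpha> * \<kappa> * (PC x y z * entropy x y z) + 2 * \<beta> * \<kappa> * (PS x y z * entropy x y z) + \<kappa>\<^sup>2 * (entropy x y z * entropy x y z))
    (\<alpha>\<^sup>2 * (229 / 90) + 2 * \<alpha> * \<beta> * (23 / 30) + \<beta>\<^sup>2 * (3 / 10) +
      2 * \<alpha> * \<kappa> * (- 959 / 720) + 2 * \<beta> * \<kappa> * (- 17 / 40) + \<kappa>\<^sup>2 * (14 / 9 - pi\<^sup>2 / 12))"
    by (intro lattice_limit_add lattice_limit_cmult limit_PC_PC limit_PC_PS limit_PS_PS limit_PC_entropy
        limit_PS_entropy limit_entropy_sq)
  moreover have "(\<lambda>x y z. \<alpha>\<^sup>2 * (PC x y z * PC x y z) + 2 * \<alpha> * \<beta> * (PC x y z * PS x y z) + \<beta>\<^sup>2 * (PS x y z * PS x y z) +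
      2 * \<alpha> * \<kappa> * (PC x y z * entropy x y z) + 2 * \<beta> * \<kappa> * (PS x y z * entropy x y z) + \<kappa>\<^sup>2 * (entropy x y z * entropy x y z)) =
    (\<lambda>x y z. (limit_toll \<alpha> \<beta> x y z)\<^sup>2)"
    unfolding limit_toll_def \<kappa>_def[symmetric] by (simp add: fun_eq_iff power2_eq_square algebra_simps)
  moreover have "\<alpha>\<^sup>2 * (229 / 90) + 2 * \<alpha> * \<beta> * (23 / 30) + \<beta>\<^sup>2 * (3 / 10) +
      2 * \<alpha> * \<kappa> * (- 959 / 720) + 2 * \<beta> * \<kappa> * (- 17 / 40) + \<kappa>\<^sup>2 * (14 / 9 - pi\<^sup>2 / 12) = var_const \<alpha> \<beta> / 2"
    unfolding var_const_def \<kappa>_def by (simp add: power2_eq_square field_simps)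
  ultimately show ?thesis by (simp only:)
qed

section \<open>Asymptotics of variance and covariance\<close>

lemma avg_sizes_three:
  assumes "n \<ge> 2"
  shows "avg (perms n) (\<lambda>A. r (small_size n A) + r (medium_size n A) + r (large_size n A)) =
    6 * partial_sum (partial_sum r) n / (real n * (real n - 1))"
proof -
  have n: "n - 2 + 2 = n" "real (n - 2) = real n - 2" using assms by auto
  have "avg (perms n) (\<lambda>A. r (small_size n A) + r (medium_size n A) + r (large_size n A)) =
      avg (lattice (n - 2)) (\<lambda>(a, b, c). r a + r b + r c)"
    using avg_perms_sizes[OF assms, of "\<lambda>(a, b, c). r a + r b + r c"] by (simp add: sizes_def)
  also have "\<dots> = 6 * partial_sum (partial_sum r) n / (real n * (real n - 1))"
    unfolding avg_lattice_three n by (simp add: partial_sum_def[abs_def])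
  finally show ?thesis .
qed

section \<open>The mean cost up to a linear term\<close>

lemma avg_lattice_moments:
  defines "f \<equiv> \<lambda>N. avg (lattice N)"
  shows "f N (\<lambda>(a, b, c). real a) = real N / 3" "f N (\<lambda>(a, b, c). (real a)\<^sup>2) = real N * (real N + 1) / 6"
    "f N (\<lambda>(a, b, c). real a * real b) = real N * (real N - 1) / 12"
proof -
  have s1: "(\<Sum>i<n. \<Sum>j<i. real j) = real n * (real n - 1) * (real n - 2) / 6" for n
  proof (induction n)
    case (Suc n)
    have "(\<Sum>j<n. real j) = real n * (real n - 1) / 2"
      by (induction n) (simp_all add: field_simps)
    then show ?case using Suc by (simp add: field_simps)
  qed simp
  have s2: "(\<Sum>i<n. \<Sum>j<i. (real j)\<^sup>2) = real n * (real n - 1)\<^sup>2 * (real n - 2) / 12" for n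
  proof (induction n)
    case (Suc n)
    have "(\<Sum>j<n. (real j)\<^sup>2) = real n * (real n - 1) * (2 * real n - 1) / 6"
      by (induction n) (simp_all add: field_simps power2_eq_square)
    then show ?case using Suc by (simp add: field_simps power2_eq_square)
  qed simp
  have fst: "f N (\<lambda>(a, b, c). r a) = (\<Sum>i<N + 2. \<Sum>j<i. r j) / ((real N + 1) * (real N + 2) / 2)" for r :: "nat \<Rightarrow> real"
    using sum_lattice_fst[of r N] by (simp add: f_def avg_def card_lattice split_def)
  have N: "real N + 1 \<noteq> 0" "real N + 2 \<noteq> 0" by linarith+
  have gen: "x * y * k / 6 / (y * x / 2) = k / 3" "x * y\<^sup>2 * k / 12 / (y * x / 2) = k * y / 6"
    if "x \<noteq> 0" "y \<noteq> 0" for x y k :: real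
    using that by (simp_all add: field_simps power2_eq_square)
  have N2: "real (N + 2) = real N + 2" "real N + 2 - 1 = real N + 1" "real N + 2 - 2 = real N" by simp_all
  show "f N (\<lambda>(a, b, c). real a) = real N / 3"
    unfolding fst s1 N2 by (rule gen[OF N(2,1)])
  show sq: "f N (\<lambda>(a, b, c). (real a)\<^sup>2) = real N * (real N + 1) / 6"
    unfolding fst[of "\<lambda>a. (real a)\<^sup>2"] s2 N2 by (rule gen[OF N(2,1)])
  have sqs: "f N (\<lambda>(a, b, c). (real b)\<^sup>2) = real N * (real N + 1) / 6" "f N (\<lambda>(a, b, c). (real c)\<^sup>2) = real N * (real N + 1) / 6"
    using avg_lattice_permute[of N "\<lambda>a b c. (real a)\<^sup>2"] sq by (simp_all add: f_def)
  define m where "m = f N (\<lambda>(a, b, c). real a * real b)"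
  have ac: "f N (\<lambda>(a, b, c). real c * real b) = m"
    using avg_lattice_permute(2)[of N "\<lambda>a b c. real a * real b"] by (simp add: f_def m_def)
  have bc: "f N (\<lambda>(a, b, c). real c * real a) = m"
    using avg_lattice_permute(1)[of N "\<lambda>a b c. real c * real b"] ac by (simp add: f_def)
  \<comment> \<open>The mixed moment needs no further summation: expanding the constant
    \<open>(a + b + c)^2\<close>, by symmetry three squares and six mixed products add up to
    \<open>N^2\<close>.\<close>
  have "(real N)\<^sup>2 = f N (\<lambda>(a, b, c). (real a + real b + real c)\<^sup>2)"
  proof -
    have "f N (\<lambda>(a, b, c). (real a + real b + real c)\<^sup>2) = f N (\<lambda>_. (real N)\<^sup>2)"
      unfolding f_def by (rule avg_cong) (auto simp: lattice_def simp flip: of_nat_add)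
    then show ?thesis using avg_const[OF finite_lattice lattice_nonempty] by (simp add: f_def)
  qed
  also have "\<dots> = f N (\<lambda>z. (case z of (a, b, c) \<Rightarrow> (real a)\<^sup>2) + ((case z of (a, b, c) \<Rightarrow> (real b)\<^sup>2) + ((case z of (a, b, c) \<Rightarrow> (real c)\<^sup>2) +
      2 * ((case z of (a, b, c) \<Rightarrow> real a * real b) + ((case z of (a, b, c) \<Rightarrow> real c * real b) + (case z of (a, b, c) \<Rightarrow> real c * real a))))))"
    unfolding f_def by (rule avg_cong) (auto simp: power2_eq_square algebra_simps)
  also have "\<dots> = 3 * (real N * (real N + 1) / 6) + 6 * m"
    by (simp only: avg_add avg_cmult sq[unfolded f_def] sqs[unfolded f_def] ac[unfolded f_def m_def] bc[unfolded f_def m_def]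
        m_def f_def) simp
  finally show "f N (\<lambda>(a, b, c). real a * real b) = real N * (real N - 1) / 12"
    unfolding m_def[symmetric] by (simp add: field_simps power2_eq_square)
qed

lemma avg_mean_toll:
  assumes "N > 0"
  shows "avg (lattice N) (mean_toll \<alpha> \<beta>) = \<alpha> * (19 / 12 * real N + 3 / 4) + \<beta> * (real N / 2 + 11 / 6)"
proof -
  note m = avg_lattice_moments[of N]
  have b: "avg (lattice N) (\<lambda>(a, b, c). real b) = real N / 3"
    using avg_lattice_permute(1)[of N "\<lambda>a b c. real a"] m(1) by simp
  have cb: "avg (lattice N) (\<lambda>(a, b, c). real c * real b) = real N * (real N - 1) / 12"
    using avg_lattice_permute(2)[of N "\<lambda>a b c. real a * real b"] m(3) by simp
  have ca: "avg (lattice N) (\<lambda>(a, b, c). real c * real a) = real N * (real N - 1) / 12"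
    using avg_lattice_permute(1)[of N "\<lambda>a b c. real c * real b"] cb by simp
  have "avg (lattice N) (mean_toll \<alpha> \<beta>) = avg (lattice N) (\<lambda>z. (\<alpha> * (real N + 1) + \<beta> * 2) +
      ((\<alpha> + \<beta>) * (case z of (a, b, c) \<Rightarrow> real a) + (\<alpha> * (case z of (a, b, c) \<Rightarrow> real b) +
      (- \<alpha> / real N * (case z of (a, b, c) \<Rightarrow> (real a)\<^sup>2) + (- \<alpha> / real N * (case z of (a, b, c) \<Rightarrow> real a * real b) +
      ((\<alpha> + \<beta>) / real N * (case z of (a, b, c) \<Rightarrow> real c * real a) + (\<alpha> + \<beta>) / real N * (case z of (a, b, c) \<Rightarrow> real c * real b)))))))"
  proof (rule avg_cong)
    fix z assume z: "z \<in> lattice N"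
    obtain a b c where abc: "z = (a, b, c)" "a + b + c = N" using z by (auto simp: lattice_def)
    show "mean_toll \<alpha> \<beta> z = (\<alpha> * (real N + 1) + \<beta> * 2) +
      ((\<alpha> + \<beta>) * (case z of (a, b, c) \<Rightarrow> real a) + (\<alpha> * (case z of (a, b, c) \<Rightarrow> real b) +
      (- \<alpha> / real N * (case z of (a, b, c) \<Rightarrow> (real a)\<^sup>2) + (- \<alpha> / real N * (case z of (a, b, c) \<Rightarrow> real a * real b) +
      ((\<alpha> + \<beta>) / real N * (case z of (a, b, c) \<Rightarrow> real c * real a) + (\<alpha> + \<beta>) / real N * (case z of (a, b, c) \<Rightarrow> real c * real b))))))"
      unfolding abc(1) mean_toll_def prod.case abc(2)
      by (simp add: algebra_simps add_divide_distrib diff_divide_distrib power2_eq_square)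
  qed
  also have "\<dots> = (\<alpha> * (real N + 1) + \<beta> * 2) + ((\<alpha> + \<beta>) * (real N / 3) + (\<alpha> * (real N / 3) +
      (- \<alpha> / real N * (real N * (real N + 1) / 6) + (- \<alpha> / real N * (real N * (real N - 1) / 12) +
      ((\<alpha> + \<beta>) / real N * (real N * (real N - 1) / 12) + (\<alpha> + \<beta>) / real N * (real N * (real N - 1) / 12))))))"
    by (simp only: avg_add avg_cmult avg_const[OF finite_lattice lattice_nonempty] m b ca cb)
  also have "\<dots> = \<alpha> * (19 / 12 * real N + 3 / 4) + \<beta> * (real N / 2 + 11 / 6)"
    using assms by (simp add: field_simps)
  finally show ?thesis .
qed

text \<open>The starting index \<open>M + 3\<close> secures both \<open>n > M\<close>, so that a
  partitioning step takes place, and \<open>n \<ge> 3\<close>, so that there are inner keys.\<close>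

lemma mean_cost_recurrence:
  assumes "M \<ge> 1"
  shows "quicksort_recurrence (M + 3) (mean_cost \<alpha> \<beta> M) (\<lambda>n. avg (perms n) (toll \<alpha> \<beta> n))"
  unfolding quicksort_recurrence_def
proof (intro conjI allI impI)
  fix n assume n: "n \<ge> M + 3"
  have "mean_cost \<alpha> \<beta> M n = avg (perms n) (\<lambda>A. toll \<alpha> \<beta> n A + (mean_cost \<alpha> \<beta> M (small_size n A) +
    mean_cost \<alpha> \<beta> M (medium_size n A) + mean_cost \<alpha> \<beta> M (large_size n A)))"
    using mean_cost_rec[of M n \<alpha> \<beta>] n assms by (simp add: add.assoc)
  also have "\<dots> = avg (perms n) (toll \<alpha> \<beta> n) + 6 * partial_sum (partial_sum (mean_cost \<alpha> \<beta> M)) n / (real n * (real n - 1))"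
    using n by (subst avg_add) (simp add: avg_sizes_three)
  finally show "mean_cost \<alpha> \<beta> M n = 6 * partial_sum (partial_sum (mean_cost \<alpha> \<beta> M)) n / (real n * (real n - 1)) +
      avg (perms n) (toll \<alpha> \<beta> n)" by simp
qed simp

text \<open>The toll is linear up to a bounded error with slope \<open>\<tau>\<close>, and
  \<open>6 / 5 * \<tau>\<close> is the stated leading coefficient. The limit itself may depend on
  \<open>M\<close>.\<close>

lemma mean_cost_asymp:
  assumes "M \<ge> 1"
  shows "convergent (\<lambda>n. (mean_cost \<alpha> \<beta> M n - (19 / 10 * \<alpha> + 3 / 5 * \<beta>) * (real n * ln (real n))) / real n)"
proof -
  define \<tau> where "\<tau> = 19 / 12 * \<alpha> + \<beta> / 2"
  have "\<bar>avg (perms n) (toll \<alpha> \<beta> n) - \<tau> * real n\<bar> \<le> \<bar>3 * \<alpha> + \<beta>\<bar> + \<bar>5 / 6 * \<beta> - 29 / 12 * \<alpha>\<bar>" if n: "n \<ge> M + 3" for n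
  proof -
    have n3: "n \<ge> 3" "n - 2 > 0" "real (n - 2) = real n - 2" using n by auto
    have "avg (lattice (n - 2)) (mean_toll \<alpha> \<beta>) = \<tau> * real n + (5 / 6 * \<beta> - 29 / 12 * \<alpha>)"
      unfolding avg_mean_toll[OF n3(2)] n3(3) by (simp add: \<tau>_def field_simps)
    then show ?thesis using toll_mean[OF n3(1), of \<alpha> \<beta>] by linarith
  qed
  from quicksort_recurrence_linear[OF mean_cost_recurrence[OF assms] this]
  show ?thesis by (simp add: \<tau>_def algebra_simps)
qed

text \<open>Perturbations that vanish in mean square do not change a limiting second moment. The
  cross term is controlled pointwise by the weighted inequality
  \<open>2 |a r| \<le> \<delta> a^2 + r^2 / \<delta>\<close>.\<close>

lemma avg_square_perturbation:
  fixes f R :: "nat \<Rightarrow> 'a \<Rightarrow> real"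
  assumes f: "(\<lambda>n. avg (S n) (\<lambda>x. (f n x)\<^sup>2)) \<longlonglongrightarrow> E" and R: "(\<lambda>n. avg (S n) (\<lambda>x. (R n x)\<^sup>2)) \<longlonglongrightarrow> 0"
  shows "(\<lambda>n. avg (S n) (\<lambda>x. (f n x + R n x)\<^sup>2)) \<longlonglongrightarrow> E"
proof -
  define F where "F n = avg (S n) (\<lambda>x. (f n x)\<^sup>2)" for n
  define Q where "Q n = avg (S n) (\<lambda>x. (R n x)\<^sup>2)" for n
  have nonneg: "0 \<le> F n" "0 \<le> Q n" for n
    by (auto simp: F_def Q_def avg_def intro!: divide_nonneg_nonneg sum_nonneg)
  have bound: "\<bar>avg (S n) (\<lambda>x. (f n x + R n x)\<^sup>2) - F n\<bar> \<le> \<delta> * F n + (1 + 1 / \<delta>) * Q n" if \<delta>: "\<delta> > 0" for n \<delta>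
  proof -
    have pt: "\<bar>(a + r)\<^sup>2 - a\<^sup>2\<bar> \<le> \<delta> * a\<^sup>2 + (1 + 1 / \<delta>) * r\<^sup>2" for a r :: real
    proof -
      have "0 \<le> (\<delta> * a - r)\<^sup>2 / \<delta>" "0 \<le> (\<delta> * a + r)\<^sup>2 / \<delta>" using \<delta> by simp_all
      moreover have "(\<delta> * a - r)\<^sup>2 / \<delta> = \<delta> * a\<^sup>2 - 2 * a * r + r\<^sup>2 / \<delta>" "(\<delta> * a + r)\<^sup>2 / \<delta> = \<delta> * a\<^sup>2 + 2 * a * r + r\<^sup>2 / \<delta>"
        using \<delta> by (simp_all add: power2_eq_square field_simps)
      moreover have "(a + r)\<^sup>2 - a\<^sup>2 = 2 * a * r + r\<^sup>2" by (simp add: power2_eq_square algebra_simps)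
      moreover have "(1 + 1 / \<delta>) * r\<^sup>2 = r\<^sup>2 + r\<^sup>2 / \<delta>" by (simp add: algebra_simps)
      ultimately show ?thesis using zero_le_power2[of r] by linarith
    qed
    have "avg (S n) (\<lambda>x. (f n x + R n x)\<^sup>2) - F n = avg (S n) (\<lambda>x. (f n x + R n x)\<^sup>2 - (f n x)\<^sup>2)"
      by (simp add: F_def avg_diff)
    moreover have "avg (S n) (\<lambda>x. (f n x + R n x)\<^sup>2 - (f n x)\<^sup>2) \<le> avg (S n) (\<lambda>x. \<delta> * (f n x)\<^sup>2 + (1 + 1 / \<delta>) * (R n x)\<^sup>2)"
      using pt by (intro avg_mono) (simp add: abs_le_iff)
    moreover have "avg (S n) (\<lambda>x. (f n x)\<^sup>2 - (f n x + R n x)\<^sup>2) \<le> avg (S n) (\<lambda>x. \<delta> * (f n x)\<^sup>2 + (1 + 1 / \<delta>) * (R n x)\<^sup>2)"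
      using pt by (intro avg_mono) (simp add: abs_le_iff)
    ultimately show ?thesis by (simp add: F_def Q_def avg_add avg_cmult avg_diff abs_le_iff)
  qed
  have "(\<lambda>n. avg (S n) (\<lambda>x. (f n x + R n x)\<^sup>2) - F n) \<longlonglongrightarrow> 0"
  proof (rule LIMSEQ_I)
    fix r :: real assume r: "0 < r"
    have E: "0 \<le> E" using LIMSEQ_le_const[OF f, of 0] nonneg(1) by (auto simp: F_def)
    \<comment> \<open>Chosen so that \<open>\<delta> * E < r\<close>; the summand 1 keeps the
      denominator positive when \<open>E = 0\<close>.\<close>
    define \<delta> where "\<delta> = r / 2 / (E + 1)"
    have \<delta>: "\<delta> > 0" using r E by (simp add: \<delta>_def)
    have "(\<lambda>n. \<delta> * F n + (1 + 1 / \<delta>) * Q n) \<longlonglongrightarrow> \<delta> * E + (1 + 1 / \<delta>) * 0"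
      unfolding F_def Q_def by (intro tendsto_intros f R)
    moreover have "\<delta> * E < r"
    proof -
      have "\<delta> * E \<le> \<delta> * (E + 1)" using \<delta> by simp
      also have "\<dots> = r / 2"
      proof -
        have "r / 2 / e * e = r / 2" if "e \<noteq> 0" for e using that by simp
        from this[of "E + 1"] show ?thesis using E by (simp only: \<delta>_def)
      qed
      finally show ?thesis using r by simp
    qed
    ultimately have "eventually (\<lambda>n. \<delta> * F n + (1 + 1 / \<delta>) * Q n < r) sequentially"
      by (intro order_tendstoD(2)) auto
    then have "eventually (\<lambda>n. norm (avg (S n) (\<lambda>x. (f n x + R n x)\<^sup>2) - F n - 0) < r) sequentially"
      by eventually_elim (use bound[OF \<delta>] in \<open>auto intro: le_less_trans\<close>)
    then show "\<exists>no. \<forall>n\<ge>no. norm (avg (S n) (\<lambda>x. (f n x + R n x)\<^sup>2) - F n - 0) < r"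
      by (simp add: eventually_sequentially)
  qed
  from tendsto_add[OF this f] show ?thesis by (simp add: F_def)
qed

text \<open>The remainder of the mean is evaluated at all sizes, also at small ones where
  \<open>\<theta> n / n\<close> is not yet small; the constant \<open>C\<close> covers
  those.\<close>

lemma sublinear_bound:
  fixes \<theta> :: "nat \<Rightarrow> real"
  assumes "(\<lambda>n. \<theta> n / real n) \<longlonglongrightarrow> 0" "\<delta> > 0"
  shows "\<exists>C. \<forall>n. \<bar>\<theta> n\<bar> \<le> \<delta> * real n + C"
proof -
  obtain N where N: "\<And>n. n \<ge> N \<Longrightarrow> \<bar>\<theta> n / real n\<bar> < \<delta>"
    using LIMSEQ_D[OF assms] by auto
  define C where "C = (\<Sum>k\<le>N. \<bar>\<theta> k\<bar>)"
  have "\<bar>\<theta> n\<bar> \<le> \<delta> * real n + C" for n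
  proof (cases "n \<le> N")
    case True
    then have "\<bar>\<theta> n\<bar> \<le> C" unfolding C_def by (intro member_le_sum) auto
    then show ?thesis using assms(2) by (simp add: add_increasing)
  next
    case False
    then have "\<bar>\<theta> n\<bar> < \<delta> * real n" using N[of n] by (simp add: divide_less_eq)
    moreover have "0 \<le> C" by (simp add: C_def sum_nonneg)
    ultimately show ?thesis by simp
  qed
  then show ?thesis by blast
qed

text \<open>The leading terms at the sizes differ from \<open>n\<close> times the entropy only by a
  multiple of \<open>ln n\<close>. A size 0 is harmless, as both products with the logarithm
  vanish.\<close>

lemma scaled_entropy:
  assumes "n > 0"
  shows "real n * entropy (real a / real n) (real b / real n) (real c / real n) =
    real a * ln (real a) + real b * ln (real b) + real c * ln (real c) - real (a + b + c) * ln (real n)"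
proof -
  have u: "real n * u_ln (real k / real n) = real k * ln (real k) - real k * ln (real n)" for k
    using assms by (cases "k = 0") (simp_all add: u_ln_def ln_div right_diff_distrib)
  show ?thesis unfolding entropy_def distrib_left u by (simp add: algebra_simps)
qed

text \<open>The only discrepancies are additive constants and the denominator \<open>n - 2\<close>
  in place of \<open>n\<close>; the latter changes products of two sizes divided by it by a bounded
  amount.\<close>

lemma mean_toll_approx:
  assumes n: "n \<ge> 3" and abc: "(a, b, c) \<in> lattice (n - 2)"
  shows "\<bar>mean_toll \<alpha> \<beta> (a, b, c) - real n * (\<alpha> * PC (real a / real n) (real b / real n) (real c / real n) +
    \<beta> * PS (real a / real n) (real b / real n) (real c / real n))\<bar> \<le> 5 * \<bar>\<alpha>\<bar> + 4 * \<bar>\<beta>\<bar>"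
proof -
  define x y z N m where "x = real a" and "y = real b" and "z = real c" and "N = x + y + z" and "m = real n"
  have N: "N = m - 2" "N > 0" "m > 0"
    using abc n by (auto simp: lattice_def x_def y_def z_def N_def m_def simp flip: of_nat_add)
  have pos: "0 \<le> x" "0 \<le> y" "0 \<le> z" by (auto simp: x_def y_def z_def)
  \<comment> \<open>\<open>e\<close> is the difference of the reciprocals of \<open>n - 2\<close>
    and \<open>n\<close>, of order \<open>1 / n^2\<close>, so it keeps quadratic terms
    bounded.\<close>
  define e where "e = 2 / (N * m)"
  have e: "1 / N - 1 / m = e" using N by (simp add: e_def field_simps)
  have small: "0 \<le> e * w" "e * w \<le> 2 * k" if "0 \<le> w" "w \<le> k * N\<^sup>2" "0 \<le> k" for w k
  proof -
    have e0: "0 \<le> e" using N by (simp add: e_def)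
    then show "0 \<le> e * w" using that by simp
    have "e * w \<le> e * (k * N\<^sup>2)" using that e0 by (intro mult_left_mono)
    also have "\<dots> = 2 * k * (N / m)" using N by (simp add: e_def power2_eq_square field_simps)
    also have "\<dots> \<le> 2 * k * 1" using N that by (intro mult_left_mono) auto
    finally show "e * w \<le> 2 * k" by simp
  qed
  have q1: "0 \<le> (x + y) * (y + 2 * z)" "(x + y) * (y + 2 * z) \<le> 2 * N\<^sup>2"
  proof -
    have "(x + y) * (y + 2 * z) \<le> N * (2 * N)" using pos by (intro mult_mono) (auto simp: N_def)
    then show "(x + y) * (y + 2 * z) \<le> 2 * N\<^sup>2" by (simp add: power2_eq_square)
  qed (use pos in simp)
  have q2: "0 \<le> (x + y) * z" "(x + y) * z \<le> 1 * N\<^sup>2"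
  proof -
    have "(x + y) * z \<le> N * N" using pos by (intro mult_mono) (auto simp: N_def)
    then show "(x + y) * z \<le> 1 * N\<^sup>2" by (simp add: power2_eq_square)
  qed (use pos in simp)
  have c: "N + 1 + (x + y) - x * (x + y) / N + z * (x + y) / N - m * PC (x / m) (y / m) (z / m) =
      - 1 + e * ((x + y) * (y + 2 * z))"
  proof -
    have "(x + y) - x * (x + y) / N = (x + y) * (y + z) / N" using N(2) by (simp add: N_def field_simps)
    moreover have "m * PC (x / m) (y / m) (z / m) = m + (x + y) * (y + 2 * z) / m"
      using N by (simp add: PC_def field_simps)
    moreover have "(x + y) * (y + z) / N + z * (x + y) / N = (x + y) * (y + 2 * z) / N"
      by (simp add: add_divide_distrib[symmetric] algebra_simps)
    moreover have "(x + y) * (y + 2 * z) / N - (x + y) * (y + 2 * z) / m = e * ((x + y) * (y + 2 * z))"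
      unfolding e[symmetric] by (simp add: left_diff_distrib)
    ultimately show ?thesis using N(1) by linarith
  qed
  have s: "2 + x + z * (x + y) / N - m * PS (x / m) (y / m) (z / m) = 2 + e * ((x + y) * z)"
  proof -
    have "m * PS (x / m) (y / m) (z / m) = x + (x + y) * z / m"
      using N by (simp add: PS_def field_simps)
    moreover have "(x + y) * z / N - (x + y) * z / m = e * ((x + y) * z)"
      unfolding e[symmetric] by (simp add: left_diff_distrib)
    ultimately show ?thesis by (simp add: mult.commute)
  qed
  have "mean_toll \<alpha> \<beta> (a, b, c) - m * (\<alpha> * PC (x / m) (y / m) (z / m) + \<beta> * PS (x / m) (y / m) (z / m)) =
      \<alpha> * (N + 1 + (x + y) - x * (x + y) / N + z * (x + y) / N - m * PC (x / m) (y / m) (z / m)) +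
      \<beta> * (2 + x + z * (x + y) / N - m * PS (x / m) (y / m) (z / m))"
    by (simp add: mean_toll_def x_def y_def z_def N_def algebra_simps)
  also have "\<dots> = \<alpha> * (- 1 + e * ((x + y) * (y + 2 * z))) + \<beta> * (2 + e * ((x + y) * z))"
    unfolding c s ..
  also have "\<bar>\<dots>\<bar> \<le> \<bar>\<alpha>\<bar> * 5 + \<bar>\<beta>\<bar> * 4"
    using small[OF q1] small[OF q2]
    by (intro abs_triangle_ineq[THEN order_trans] add_mono) (simp_all add: abs_mult mult_left_mono)
  finally show ?thesis by (simp add: x_def y_def z_def m_def mult.commute)
qed

text \<open>The centred toll per key is the limit toll \<open>F\<close> plus two errors:
  \<open>R1\<close>, the fluctuation of the toll around its conditional mean, small in mean square;
  and \<open>R2\<close>, the error of the asymptotic expansions, small uniformly in the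
  permutation.\<close>

theorem var_cost_limit:
  assumes M: "M \<ge> 1"
  shows "(\<lambda>n. var_cost \<alpha> \<beta> M n / (real n)\<^sup>2) \<longlonglongrightarrow> var_const \<alpha> \<beta>"
proof -
  define \<kappa> where "\<kappa> = 19 / 10 * \<alpha> + 3 / 5 * \<beta>"
  define \<mu> where "\<mu> = mean_cost \<alpha> \<beta> M"
  obtain l where l: "(\<lambda>n. (\<mu> n - \<kappa> * (real n * ln (real n))) / real n) \<longlonglongrightarrow> l"
    using mean_cost_asymp[OF M, of \<alpha> \<beta>] by (auto simp: convergent_def \<mu>_def \<kappa>_def)
  define \<theta> where "\<theta> n = \<mu> n - \<kappa> * (real n * ln (real n)) - l * real n" for n
  have \<theta>: "(\<lambda>n. \<theta> n / real n) \<longlonglongrightarrow> 0"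
  proof -
    have "(\<lambda>n. (\<mu> n - \<kappa> * (real n * ln (real n))) / real n - l) \<longlonglongrightarrow> l - l"
      by (intro tendsto_intros l)
    then have "(\<lambda>n. (\<mu> n - \<kappa> * (real n * ln (real n))) / real n - l) \<longlonglongrightarrow> 0" by simp
    then show ?thesis
      by (rule Lim_transform_eventually)
         (use eventually_gt_at_top[of 0] in eventually_elim, simp add: \<theta>_def diff_divide_distrib)
  qed
  define G where "G n A = toll \<alpha> \<beta> n A + \<mu> (small_size n A) + \<mu> (medium_size n A) + \<mu> (large_size n A) - \<mu> n" for n A
  define F where "F n A = scaled n (limit_toll \<alpha> \<beta>) (sizes n A)" for n A
  define R1 where "R1 n A = (toll \<alpha> \<beta> n A - mean_toll \<alpha> \<beta> (sizes n A)) / real n" for n A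
  define R2 where "R2 n A = (mean_toll \<alpha> \<beta> (sizes n A) + \<mu> (small_size n A) + \<mu> (medium_size n A) + \<mu> (large_size n A) - \<mu> n) / real n
    - F n A" for n A
  have G: "G n A / real n = F n A + (R1 n A + R2 n A)" for n A
    by (simp add: G_def R1_def R2_def add_divide_distrib[symmetric])
  have F: "(\<lambda>n. avg (perms n) (\<lambda>A. (F n A)\<^sup>2)) \<longlonglongrightarrow> var_const \<alpha> \<beta> / 2"
  proof -
    have "(\<lambda>n. avg (lattice (n - 2)) (scaled n (\<lambda>x y z. (limit_toll \<alpha> \<beta> x y z)\<^sup>2))) \<longlonglongrightarrow> var_const \<alpha> \<beta> / 2"
      using limit_limit_toll_sq by (simp add: lattice_limit_def)
    then show ?thesis
    proof (rule Lim_transform_eventually)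
      show "eventually (\<lambda>n. avg (lattice (n - 2)) (scaled n (\<lambda>x y z. (limit_toll \<alpha> \<beta> x y z)\<^sup>2)) = avg (perms n) (\<lambda>A. (F n A)\<^sup>2)) sequentially"
        using eventually_ge_at_top[of 2]
      proof eventually_elim
        case (elim n)
        show ?case
          unfolding avg_perms_sizes[OF elim, symmetric] F_def by (rule avg_cong) (simp add: scaled_def sizes_def)
      qed
    qed
  qed
  have R1: "(\<lambda>n. avg (perms n) (\<lambda>A. (R1 n A)\<^sup>2)) \<longlonglongrightarrow> 0"
  proof (rule Lim_null_comparison)
    let ?C = "3 * (\<alpha>\<^sup>2 + (\<alpha> + \<beta>)\<^sup>2 + (3 * \<alpha> + \<beta>)\<^sup>2)"
    show "(\<lambda>n. ?C * (1 / real n)) \<longlonglongrightarrow> 0"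
      by (intro tendsto_mult_right_zero lim_1_over_n)
    show "eventually (\<lambda>n. norm (avg (perms n) (\<lambda>A. (R1 n A)\<^sup>2)) \<le> ?C * (1 / real n)) sequentially"
      using eventually_ge_at_top[of 3]
    proof eventually_elim
      case (elim n)
      have "avg (perms n) (\<lambda>A. (R1 n A)\<^sup>2) = 1 / (real n)\<^sup>2 * avg (perms n) (\<lambda>A. (toll \<alpha> \<beta> n A - mean_toll \<alpha> \<beta> (sizes n A))\<^sup>2)"
        unfolding avg_cmult[symmetric] by (simp add: R1_def power_divide)
      also have "\<dots> \<le> 1 / (real n)\<^sup>2 * (?C * real n)"
        using toll_variance[OF elim, of \<alpha> \<beta>] by (intro mult_left_mono) auto
      also have "\<dots> = ?C * (1 / real n)" using elim by (simp add: power2_eq_square)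
      finally have "avg (perms n) (\<lambda>A. (R1 n A)\<^sup>2) \<le> ?C * (1 / real n)" .
      moreover have "0 \<le> avg (perms n) (\<lambda>A. (R1 n A)\<^sup>2)"
        by (auto simp: avg_def intro!: divide_nonneg_nonneg sum_nonneg)
      ultimately show ?case by simp
    qed
  qed
  have R2: "eventually (\<lambda>n. \<forall>A\<in>perms n. \<bar>R2 n A\<bar> \<le> \<epsilon>) sequentially" if \<epsilon>: "\<epsilon> > 0" for \<epsilon>
  proof -
    \<comment> \<open>The three sizes and \<open>n\<close> add up to at most \<open>2 * n\<close>,
      so \<open>\<epsilon> / 4\<close> per key amounts to \<open>\<epsilon> / 2 * n\<close>; the
      other half is left for the bounded and logarithmic terms.\<close>
    obtain C where C: "\<And>n. \<bar>\<theta> n\<bar> \<le> \<epsilon> / 4 * real n + C"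
      using sublinear_bound[OF \<theta>, of "\<epsilon> / 4"] \<epsilon> by auto
    define D where "D = 5 * \<bar>\<alpha>\<bar> + 4 * \<bar>\<beta>\<bar> + 2 * \<bar>l\<bar> + 4 * C"
    have lim: "(\<lambda>n. D / real n + 2 * \<bar>\<kappa>\<bar> * (ln (real n) / real n) + \<epsilon> / 2) \<longlonglongrightarrow> 0 + 2 * \<bar>\<kappa>\<bar> * 0 + \<epsilon> / 2"
    proof (intro tendsto_add tendsto_mult tendsto_const)
      show "(\<lambda>n. D / real n) \<longlonglongrightarrow> 0" by (rule lim_const_over_n)
      show "(\<lambda>n. ln (real n) / real n) \<longlonglongrightarrow> 0" by real_asymp
    qed
    have "eventually (\<lambda>n. D / real n + 2 * \<bar>\<kappa>\<bar> * (ln (real n) / real n) + \<epsilon> / 2 < \<epsilon>) sequentially"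
      using order_tendstoD(2)[OF lim, of \<epsilon>] \<epsilon> by simp
    then show ?thesis using eventually_ge_at_top[of 3]
    proof eventually_elim
      case (elim n)
      show ?case
      proof
        fix A assume A: "A \<in> perms n"
        define a b c where "a = small_size n A" and "b = medium_size n A" and "c = large_size n A"
        have abc: "a + b + c = n - 2" using size_sum[of A n] A elim(2) by (simp add: a_def b_def c_def)
        then have lat: "(a, b, c) \<in> lattice (n - 2)" by (simp add: lattice_def)
        have rabc: "real a + real b + real c = real n - 2" using abc elim(2) by linarith
        have s: "sizes n A = (a, b, c)" by (simp add: sizes_def a_def b_def c_def)
        define P where "P = \<alpha> * PC (real a / real n) (real b / real n) (real c / real n) + \<beta> * PS (real a / real n) (real b / real n) (real c / real n)"
        define h where "h = entropy (real a / real n) (real b / real n) (real c / real n)"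
        have Fn: "real n * F n A = real n * P + \<kappa> * (real n * h)"
          unfolding F_def s scaled_def prod.case limit_toll_def P_def h_def \<kappa>_def by (simp add: algebra_simps)
        have h: "real n * h = real a * ln (real a) + real b * ln (real b) + real c * ln (real c) - (real n - 2) * ln (real n)"
          unfolding h_def using scaled_entropy[of n a b c] elim(2) rabc by simp
        have \<mu>: "\<mu> k = \<theta> k + \<kappa> * (real k * ln (real k)) + l * real k" for k by (simp add: \<theta>_def)
        have "real n * R2 n A = mean_toll \<alpha> \<beta> (a, b, c) + \<mu> a + \<mu> b + \<mu> c - \<mu> n - real n * F n A"
        proof -
          have "m * (x / m - y) = x - m * y" if "m \<noteq> 0" for m x y :: real using that by (simp add: right_diff_distrib)
          from this[of "real n"] show ?thesis
            unfolding R2_def s a_def[symmetric] b_def[symmetric] c_def[symmetric] using elim(2) by simp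
        qed
        \<comment> \<open>The main terms cancel here: as the sizes add up to \<open>n - 2\<close>,
          the logarithmic terms leave \<open>- 2 * \<kappa> * ln n\<close> and the linear ones
          \<open>- 2 * l\<close>, both negligible after division by \<open>n\<close>.\<close>
        also have "\<dots> = (mean_toll \<alpha> \<beta> (a, b, c) - real n * P) - 2 * \<kappa> * ln (real n) + l * (real a + real b + real c - real n) +
            (\<theta> a + \<theta> b + \<theta> c - \<theta> n)"
          unfolding Fn h \<mu> by (simp add: algebra_simps)
        also have "\<dots> = (mean_toll \<alpha> \<beta> (a, b, c) - real n * P) - 2 * \<kappa> * ln (real n) - 2 * l + (\<theta> a + \<theta> b + \<theta> c - \<theta> n)"
          unfolding rabc by simp
        finally have eq: "real n * R2 n A = (mean_toll \<alpha> \<beta> (a, b, c) - real n * P) - 2 * \<kappa> * ln (real n) - 2 * l + (\<theta> a + \<theta> b + \<theta> c - \<theta> n)" .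
        have t1: "\<bar>mean_toll \<alpha> \<beta> (a, b, c) - real n * P\<bar> \<le> 5 * \<bar>\<alpha>\<bar> + 4 * \<bar>\<beta>\<bar>"
          unfolding P_def by (rule mean_toll_approx[OF elim(2) lat])
        have t2: "\<bar>2 * \<kappa> * ln (real n)\<bar> = 2 * \<bar>\<kappa>\<bar> * ln (real n)" using elim(2) by (simp add: abs_mult)
        have t3: "\<bar>\<theta> a + \<theta> b + \<theta> c - \<theta> n\<bar> \<le> \<epsilon> / 2 * real n + 4 * C"
        proof -
          have "\<bar>\<theta> a + \<theta> b + \<theta> c - \<theta> n\<bar> \<le> \<epsilon> / 4 * (real a + real b + real c + real n) + 4 * C"
            using C[of a] C[of b] C[of c] C[of n] by (simp add: distrib_left)
          also have "real a + real b + real c + real n \<le> 2 * real n" using rabc by simp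
          finally show ?thesis using \<epsilon> by simp
        qed
        have "real n * \<bar>R2 n A\<bar> = \<bar>real n * R2 n A\<bar>" by (simp add: abs_mult)
        also have "\<dots> \<le> D + 2 * \<bar>\<kappa>\<bar> * ln (real n) + \<epsilon> / 2 * real n"
          unfolding eq D_def using t1 t2 t3 by linarith
        also have "\<dots> = real n * (D / real n + 2 * \<bar>\<kappa>\<bar> * (ln (real n) / real n) + \<epsilon> / 2)"
          using elim(2) by (simp add: distrib_left)
        also have "\<dots> \<le> real n * \<epsilon>" using elim(1) by (intro mult_left_mono) auto
        finally show "\<bar>R2 n A\<bar> \<le> \<epsilon>" using elim(2) by simp
      qed
    qed
  qed
  have R2': "(\<lambda>n. avg (perms n) (\<lambda>A. (R2 n A)\<^sup>2)) \<longlonglongrightarrow> 0"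
  proof (rule LIMSEQ_I)
    fix r :: real assume r: "0 < r"
    have "eventually (\<lambda>n. \<forall>A\<in>perms n. \<bar>R2 n A\<bar> \<le> sqrt (r / 2)) sequentially"
      using r by (intro R2) simp
    then have "eventually (\<lambda>n. norm (avg (perms n) (\<lambda>A. (R2 n A)\<^sup>2) - 0) < r) sequentially"
    proof (rule eventually_mono)
      fix n assume *: "\<forall>A\<in>perms n. \<bar>R2 n A\<bar> \<le> sqrt (r / 2)"
      have "avg (perms n) (\<lambda>A. (R2 n A)\<^sup>2) \<le> avg (perms n) (\<lambda>_. r / 2)"
      proof (rule avg_mono)
        fix A assume "A \<in> perms n"
        then have "\<bar>R2 n A\<bar>\<^sup>2 \<le> (sqrt (r / 2))\<^sup>2" using * by (intro power_mono) auto
        then show "(R2 n A)\<^sup>2 \<le> r / 2" using r by simp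
      qed
      also have "\<dots> < r" using r by (simp add: avg_const[OF finite_perms perms_nonempty])
      finally have "avg (perms n) (\<lambda>A. (R2 n A)\<^sup>2) < r" .
      moreover have "0 \<le> avg (perms n) (\<lambda>A. (R2 n A)\<^sup>2)"
        by (auto simp: avg_def intro!: divide_nonneg_nonneg sum_nonneg)
      ultimately show "norm (avg (perms n) (\<lambda>A. (R2 n A)\<^sup>2) - 0) < r" by simp
    qed
    then show "\<exists>no. \<forall>n\<ge>no. norm (avg (perms n) (\<lambda>A. (R2 n A)\<^sup>2) - 0) < r"
      by (simp add: eventually_sequentially)
  qed
  \<comment> \<open>\<open>avg_square_perturbation\<close> is used twice: with limit 0 for the sum
    of the two errors, then for \<open>F\<close> perturbed by this sum.\<close>
  have "(\<lambda>n. avg (perms n) (\<lambda>A. (G n A / real n)\<^sup>2)) \<longlonglongrightarrow> var_const \<alpha> \<beta> / 2"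
    unfolding G by (intro avg_square_perturbation F R1 R2')
  then have eps: "(\<lambda>n. avg (perms n) (\<lambda>A. (G n A)\<^sup>2) / real n ^ 2) \<longlonglongrightarrow> var_const \<alpha> \<beta> / 2"
    by (simp add: avg_def power_divide sum_divide_distrib[symmetric] divide_divide_eq_left mult.commute)
  have "quicksort_recurrence (M + 3) (var_cost \<alpha> \<beta> M) (\<lambda>n. avg (perms n) (\<lambda>A. (G n A)\<^sup>2))"
    unfolding quicksort_recurrence_def
  proof (intro conjI allI impI)
    fix n assume n: "n \<ge> M + 3"
    have "var_cost \<alpha> \<beta> M n = avg (perms n) (\<lambda>A. (G n A)\<^sup>2 + (var_cost \<alpha> \<beta> M (small_size n A) +
      var_cost \<alpha> \<beta> M (medium_size n A) + var_cost \<alpha> \<beta> M (large_size n A)))"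
      using var_cost_rec[of M n \<alpha> \<beta>] n M by (simp add: G_def \<mu>_def add.assoc)
    also have "\<dots> = avg (perms n) (\<lambda>A. (G n A)\<^sup>2) + 6 * partial_sum (partial_sum (var_cost \<alpha> \<beta> M)) n / (real n * (real n - 1))"
      using n by (subst avg_add) (simp add: avg_sizes_three)
    finally show "var_cost \<alpha> \<beta> M n = 6 * partial_sum (partial_sum (var_cost \<alpha> \<beta> M)) n / (real n * (real n - 1)) +
        avg (perms n) (\<lambda>A. (G n A)\<^sup>2)" by simp
  qed simp
  from quicksort_recurrence_quadratic[OF this eps] show ?thesis by simp
qed

section \<open>Return to variances and covariance under the random permutation\<close>

lemma expectation_random_permutation:
  "measure_pmf.expectation (random_permutation n) f = avg (perms n) f"
  unfolding random_permutation_def avg_def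
  by (rule integral_pmf_of_set) (use finite_perms perms_nonempty in auto)

lemma var_cost_components:
  "measure_pmf.variance (random_permutation n) (key_comparisons M n) = var_cost 1 0 M n"
  "measure_pmf.variance (random_permutation n) (swaps M n) = var_cost 0 1 M n"
  "covariance (random_permutation n) (key_comparisons M n) (swaps M n) =
    (var_cost 1 1 M n - var_cost 1 0 M n - var_cost 0 1 M n) / 2"
proof -
  have c: "qs_cost 1 0 M n = key_comparisons M n" "qs_cost 0 1 M n = swaps M n"
    "qs_cost 1 1 M n = (\<lambda>A. key_comparisons M n A + swaps M n A)"
    by (simp_all add: seg_cost_def key_comparisons_def swaps_def fun_eq_iff)
  show "measure_pmf.variance (random_permutation n) (key_comparisons M n) = var_cost 1 0 M n"
    "measure_pmf.variance (random_permutation n) (swaps M n) = var_cost 0 1 M n"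
    by (simp_all add: expectation_random_permutation var_cost_def variance_on_def c)
  define x y where "x = avg (perms n) (key_comparisons M n)" and "y = avg (perms n) (swaps M n)"
  have "var_cost 1 1 M n = avg (perms n) (\<lambda>A. (key_comparisons M n A + swaps M n A - (x + y))\<^sup>2)"
    unfolding var_cost_def variance_on_def c by (simp only: avg_add x_def y_def)
  also have "\<dots> = avg (perms n) (\<lambda>A. (key_comparisons M n A - x)\<^sup>2 +
      (2 * ((key_comparisons M n A - x) * (swaps M n A - y)) + (swaps M n A - y)\<^sup>2))"
    by (rule avg_cong) (simp add: power2_eq_square algebra_simps)
  also have "\<dots> = var_cost 1 0 M n + (2 * covariance (random_permutation n) (key_comparisons M n) (swaps M n) + var_cost 0 1 M n)"
    unfolding avg_add avg_cmult
    by (simp add: var_cost_def variance_on_def c covariance_def expectation_random_permutation x_def y_def)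
  finally show "covariance (random_permutation n) (key_comparisons M n) (swaps M n) =
    (var_cost 1 1 M n - var_cost 1 0 M n - var_cost 0 1 M n) / 2" by simp
qed

theorem theorem4p6:
  shows "\<bar>\<sigma>\<^sub>C\<^sub>S - (-0.00855817)\<bar> < 0.000000005 \<and>
    (\<exists>\<rho>::real. \<bar>\<rho> - (-0.0512112)\<bar> < 0.00000005 \<and>
      (\<forall>M::nat. M \<ge> 1 \<longrightarrow>
        (\<lambda>n. covariance (random_permutation n) (key_comparisons M n) (swaps M n))
          \<sim>[sequentially] (\<lambda>n. \<sigma>\<^sub>C\<^sub>S * (real n)\<^sup>2) \<and>
        (\<lambda>n. correlation (random_permutation n) (key_comparisons M n) (swaps M n))
          \<sim>[sequentially] (\<lambda>n. \<rho>)))"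
proof -
  \<comment> \<open>\<open>v\<close> and \<open>w\<close> are the constants of the two variances, so
    \<open>\<rho>\<close> is given in closed form and is common to all \<open>M\<close>.\<close>
  define v w \<rho> where "v = 2231 / 360 - 361 / 600 * pi\<^sup>2" and "w = 7 / 10 - 3 / 50 * pi\<^sup>2"
    and "\<rho> = \<sigma>\<^sub>C\<^sub>S / (sqrt v * sqrt w)"
  note num = correlation_bounds[OF refl, folded sigma_CS_def v_def w_def]
  \<comment> \<open>Asymptotic equivalence is deduced from limits of quotients, so neither constant
    may vanish; the numerical bounds exclude this.\<close>
  have \<sigma>: "\<sigma>\<^sub>C\<^sub>S \<noteq> 0" using num(1) by auto
  have \<rho>: "\<rho> \<noteq> 0" using \<sigma> num(2,3) by (simp add: \<rho>_def)
  have "(\<lambda>n. covariance (random_permutation n) (key_comparisons M n) (swaps M n)) \<sim>[sequentially] (\<lambda>n. \<sigma>\<^sub>C\<^sub>S * (real n)\<^sup>2) \<and>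
      (\<lambda>n. correlation (random_permutation n) (key_comparisons M n) (swaps M n)) \<sim>[sequentially] (\<lambda>n. \<rho>)"
    if M: "M \<ge> 1" for M
  proof -
    define cov where "cov n = covariance (random_permutation n) (key_comparisons M n) (swaps M n)" for n
    note lim = var_cost_limit[OF M]
    have "(\<lambda>n. (var_cost 1 1 M n / (real n)\<^sup>2 - var_cost 1 0 M n / (real n)\<^sup>2 - var_cost 0 1 M n / (real n)\<^sup>2) / 2) \<longlonglongrightarrow>
        (var_const 1 1 - var_const 1 0 - var_const 0 1) / 2"
      by (intro tendsto_intros lim) simp
    moreover have "(var_const 1 1 - var_const 1 0 - var_const 0 1) / 2 = \<sigma>\<^sub>C\<^sub>S"
      by (simp add: var_const_def sigma_CS_def)
    moreover have "(var_cost 1 1 M n / (real n)\<^sup>2 - var_cost 1 0 M n / (real n)\<^sup>2 - var_cost 0 1 M n / (real n)\<^sup>2) / 2 = cov n / (real n)\<^sup>2" for n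
      by (simp add: cov_def var_cost_components diff_divide_distrib)
    ultimately have cov: "(\<lambda>n. cov n / (real n)\<^sup>2) \<longlonglongrightarrow> \<sigma>\<^sub>C\<^sub>S" by simp
    have "(\<lambda>n. cov n / (real n)\<^sup>2 / \<sigma>\<^sub>C\<^sub>S) \<longlonglongrightarrow> \<sigma>\<^sub>C\<^sub>S / \<sigma>\<^sub>C\<^sub>S"
      using \<sigma> by (intro tendsto_intros cov)
    then have "(\<lambda>n. cov n / (\<sigma>\<^sub>C\<^sub>S * (real n)\<^sup>2)) \<longlonglongrightarrow> 1"
      using \<sigma> by (simp add: mult.commute)
    then have 1: "cov \<sim>[sequentially] (\<lambda>n. \<sigma>\<^sub>C\<^sub>S * (real n)\<^sup>2)"
      by (rule asymp_equivI')
    \<comment> \<open>The covariance and each variance are divided by \<open>n^2\<close>; these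
      factors cancel in the correlation for \<open>n > 0\<close>, and positivity of \<open>v\<close>
      and \<open>w\<close> lets the quotient pass to the limit.\<close>
    have "(\<lambda>n. (cov n / (real n)\<^sup>2) / (sqrt (var_cost 1 0 M n / (real n)\<^sup>2) * sqrt (var_cost 0 1 M n / (real n)\<^sup>2))) \<longlonglongrightarrow>
        \<sigma>\<^sub>C\<^sub>S / (sqrt (var_const 1 0) * sqrt (var_const 0 1))"
      using num(2,3) by (intro tendsto_intros cov lim) (auto simp: var_const_def v_def w_def)
    then have "(\<lambda>n. (cov n / (real n)\<^sup>2) / (sqrt (var_cost 1 0 M n / (real n)\<^sup>2) * sqrt (var_cost 0 1 M n / (real n)\<^sup>2))) \<longlonglongrightarrow> \<rho>"
      by (simp add: \<rho>_def var_const_def v_def w_def)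
    then have "(\<lambda>n. correlation (random_permutation n) (key_comparisons M n) (swaps M n)) \<longlonglongrightarrow> \<rho>"
    proof (rule Lim_transform_eventually)
      show "eventually (\<lambda>n. (cov n / (real n)\<^sup>2) / (sqrt (var_cost 1 0 M n / (real n)\<^sup>2) * sqrt (var_cost 0 1 M n / (real n)\<^sup>2)) =
          correlation (random_permutation n) (key_comparisons M n) (swaps M n)) sequentially"
        using eventually_gt_at_top[of 0]
      proof eventually_elim
        case (elim n)
        then show ?case
          unfolding correlation_def cov_def[symmetric] var_cost_components(1,2)
          by (simp add: real_sqrt_divide power2_eq_square)
      qed
    qed
    then have 2: "(\<lambda>n. correlation (random_permutation n) (key_comparisons M n) (swaps M n)) \<sim>[sequentially] (\<lambda>n. \<rho>)"
      by (rule tendsto_imp_asymp_equiv_const[OF _ \<rho>])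
    show ?thesis using 1 2 by (simp add: cov_def[abs_def])
  qed
  then show ?thesis using num(1,4) unfolding \<rho>_def by blast
qed

end
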